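(* Assume there is a proper class of cardinals $\theta$ with $\theta^{<\theta}=\theta$. Let $(\mathcal{K},U)$ be a large weak $(\kappa,\lambda)$-CAEC satisfying the amalgamation and joint embedding properties. If $\mathcal{K}$ is $\mu$-stable for a cardinal $\mu$ with $\mu^+\triangleright\kappa$ and $\mu\geq\lambda+\lambda_U$, then any object $M$ of size $\mu$ has a universal extension, i.e. there is a morphism $m:M\to\bar M$ with $\bar M$ of size $\mu$ such that $\bar M$ is universal over $M$.
   Context: For regular cardinals $\kappa,\lambda$, a weak $(\kappa,\lambda)$-CAEC is a pair $(\mathcal{K},U)$ of a category $\mathcal{K}$ and a faithful functor $U:\mathcal{K}\to\mathbf{Set}$ such that: (1) $\mathcal{K}$ is $\lambda$-accessible, has all directed colimits, and all its morphisms are monomorphisms; (2) $(\mathcal{K},U)$ is coherent (whenever $h:A\to C$ and $g:B\to C$ are morphisms of $\mathcal{K}$ and $f:U(A)\to U(B)$ is a map of sets with $U(g)f=U(h)$, there is a morphism $\bar f:A\to B$ in $\mathcal{K}$ with $U(\bar f)=f$) and has concrete monomorphisms ($U$ sends every morphism of $\mathcal{K}$ to an injection); (3) $U$ preserves $\kappa$-directed colimits. It is large if it has arbitrarily large objects. Amalgamation: any two morphisms $A\to B$, $A\to C$ can be completed to a commutative square. Joint embedding: any two objects admit morphisms into a common object. For regular cardinals $\kappa<\nu$, $\nu\triangleright\kappa$ (sharp inequality) means that every $\kappa$-accessible category is $\nu$-accessible; equivalently, for every set $X$ with $|X|<\nu$, the poset of subsets of $X$ of cardinality less than $\kappa$ has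 a cofinal subset of cardinality less than $\nu$. Size: the presentability rank of an object $M$ (the least regular cardinal $\rho$ such that $M$ is $\rho$-presentable) is a successor cardinal, written $|M|^+$; $|M|$ is called the size of $M$. $\lambda_U$ is the least cardinal $\geq\lambda$ such that $U$ preserves $\lambda_U$-presentable objects; $U$ then preserves all sizes $\mu$ with $\mu^+\triangleright\kappa$ and $\mu^+\geq\lambda_U$ (i.e. sends objects of size $\mu$ to sets of cardinality $\mu$). Types: a type over $M$ is an equivalence class of pairs $(f,a)$ with $f:M\to N$ a morphism of $\mathcal{K}$ and $a\in U(N)$, where $(f_0,a_0)\sim(f_1,a_1)$ (with $f_i:M\to N_i$) iff there are morphisms $h_i:N_i\to N$ with $h_0f_0=h_1f_1$ and $U(h_0)(a_0)=U(h_1)(a_1)$. $\mathcal{K}$ is $\mu$-stable if over every object of size $\mu$ there are at most $\mu$ types. Universality: given $m:M\to\bar M$ with $M$, $\bar M$ both of size $\mu$, $\bar M$ is universal over $M$ if for every morphism $h:M\to N$ with $N$ of size at most $\mu$ there is $t:N\to\bar M$ with $th=m$. *)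

theory Defs
  imports "HOL-Library.FuncSet"
begin

unbundle cardinal_syntax

text \<open>
  The set-theoretic universe is represented by an inaccessible cardinal \<open>\<Omega>\<close> on a type \<open>'v\<close>: a set is
  small if it has fewer than \<open>\<Omega>\<close> elements, and a proper class of cardinals is a class of small
  cardinals that is unbounded below \<open>\<Omega>\<close>. Every small cardinal has a representative among the
  well-orders of type \<open>'v rel\<close>, and \<open>'v\<close> also supplies the elements of the objects of \<open>Set\<close>
  and the index sets of diagrams.
\<close>

section \<open>Cardinals\<close>

definition regular_card :: "'a rel \<Rightarrow> bool" where
  "regular_card r \<longleftrightarrow> Cinfinite r \<and> regularCard r"

definition inaccessible :: "'a rel \<Rightarrow> bool" where
  "inaccessible r \<longleftrightarrow> regular_card r \<and> natLeq <o r \<and>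
     (\<forall>X \<subseteq> Field r. |X| <o r \<longrightarrow> |Pow X| <o r)"

definition small_card :: "'v rel \<Rightarrow> 'v rel \<Rightarrow> bool" where
  "small_card \<Omega> \<alpha> \<longleftrightarrow> Card_order \<alpha> \<and> \<alpha> <o \<Omega>"

text \<open>\<open>\<theta>\<^sup><\<^sup>\<theta>\<close>, as the number of sequences in \<open>\<theta>\<close> whose length is an ordinal below \<open>\<theta>\<close>.\<close>

definition weak_power :: "'v rel \<Rightarrow> ('v \<Rightarrow> 'v) rel" where
  "weak_power \<theta> = |\<Union>a \<in> Field \<theta>. Func (underS \<theta> a) (Field \<theta>)|"

definition proper_class_of_weak_power_fixpoints :: "'v rel \<Rightarrow> bool" where
  "proper_class_of_weak_power_fixpoints \<Omega> \<longleftrightarrow>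
     (\<forall>\<alpha>. small_card \<Omega> \<alpha> \<longrightarrow>
       (\<exists>\<theta>. small_card \<Omega> \<theta> \<and> \<alpha> \<le>o \<theta> \<and> weak_power \<theta> =o \<theta>))"

text \<open>
  The sharp inequality \<open>\<nu> \<triangleright> \<kappa>\<close>, in its combinatorial form, which avoids quantifying over all
  \<open>\<kappa>\<close>-accessible categories (of arbitrary types). Since \<open>\<nu>\<close> will be a small cardinal, all sets of cardinality
  less than \<open>\<nu>\<close> occur, up to bijection, as sets of elements of \<open>'v\<close>.
\<close>

definition sharply_less :: "'v rel \<Rightarrow> 'n rel \<Rightarrow> bool" where
  "sharply_less \<kappa> \<nu> \<longleftrightarrow> regular_card \<kappa> \<and> regular_card \<nu> \<and> \<kappa> <o \<nu> \<and>
     (\<forall>X :: 'v set. |X| <o \<nu> \<longrightarrow>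
       (\<exists>\<C> \<subseteq> {Y. Y \<subseteq> X \<and> |Y| <o \<kappa>}. |\<C>| <o \<nu> \<and>
          (\<forall>Y. Y \<subseteq> X \<and> |Y| <o \<kappa> \<longrightarrow> (\<exists>Z \<in> \<C>. Y \<subseteq> Z))))"


section \<open>Categories and functors\<close>

record ('o, 'm) category =
  Ob :: "'o set"
  Arr :: "'m set"
  Dom :: "'m \<Rightarrow> 'o"
  Cod :: "'m \<Rightarrow> 'o"
  Id :: "'o \<Rightarrow> 'm"
  Comp :: "'m \<Rightarrow> 'm \<Rightarrow> 'm"  (infixr \<open>\<cdot>\<index>\<close> 70)

definition hom :: "('o, 'm) category \<Rightarrow> 'o \<Rightarrow> 'o \<Rightarrow> 'm set" where
  "hom C A B = {f \<in> Arr C. Dom C f = A \<and> Cod C f = B}"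

locale category =
  fixes C :: "('o, 'm) category" (structure)
  assumes Dom_in_Ob: "f \<in> Arr C \<Longrightarrow> Dom C f \<in> Ob C"
    and Cod_in_Ob: "f \<in> Arr C \<Longrightarrow> Cod C f \<in> Ob C"
    and Id_in_hom: "A \<in> Ob C \<Longrightarrow> Id C A \<in> hom C A A"
    and Comp_in_hom: "f \<in> hom C A B \<Longrightarrow> g \<in> hom C B D \<Longrightarrow> g \<cdot> f \<in> hom C A D"
    and Comp_Id: "f \<in> hom C A B \<Longrightarrow> f \<cdot> Id C A = f"
    and Id_Comp: "f \<in> hom C A B \<Longrightarrow> Id C B \<cdot> f = f"
    and Comp_assoc: "f \<in> hom C A B \<Longrightarrow> g \<in> hom C B D \<Longrightarrow> h \<in> hom C D E \<Longrightarrow>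
      (h \<cdot> g) \<cdot> f = h \<cdot> (g \<cdot> f)"

definition locally_small :: "'v rel \<Rightarrow> ('o, 'm) category \<Rightarrow> bool" where
  "locally_small \<Omega> C \<longleftrightarrow> (\<forall>A \<in> Ob C. \<forall>B \<in> Ob C. |hom C A B| <o \<Omega>)"

definition mono_arr :: "('o, 'm) category \<Rightarrow> 'm \<Rightarrow> bool" where
  "mono_arr C f \<longleftrightarrow> f \<in> Arr C \<and>
     (\<forall>A. \<forall>g \<in> hom C A (Dom C f). \<forall>h \<in> hom C A (Dom C f). f \<cdot>\<^bsub>C\<^esub> g = f \<cdot>\<^bsub>C\<^esub> h \<longrightarrow> g = h)"

record ('o, 'm, 'p, 'n) cat_fun =
  FOb :: "'o \<Rightarrow> 'p"
  FArr :: "'m \<Rightarrow> 'n"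

locale cat_functor = C: category C + D: category D
  for C :: "('o, 'm) category" and D :: "('p, 'n) category" +
  fixes F :: "('o, 'm, 'p, 'n) cat_fun"
  assumes FOb_in_Ob: "A \<in> Ob C \<Longrightarrow> FOb F A \<in> Ob D"
    and FArr_in_hom: "f \<in> hom C A B \<Longrightarrow> FArr F f \<in> hom D (FOb F A) (FOb F B)"
    and FArr_Id: "A \<in> Ob C \<Longrightarrow> FArr F (Id C A) = Id D (FOb F A)"
    and FArr_Comp: "f \<in> hom C A B \<Longrightarrow> g \<in> hom C B E \<Longrightarrow>
      FArr F (g \<cdot>\<^bsub>C\<^esub> f) = FArr F g \<cdot>\<^bsub>D\<^esub> FArr F f"

definition faithful :: "('o, 'm) category \<Rightarrow> ('o, 'm, 'p, 'n) cat_fun \<Rightarrow> bool" where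
  "faithful C F \<longleftrightarrow> (\<forall>A \<in> Ob C. \<forall>B \<in> Ob C. inj_on (FArr F) (hom C A B))"

text \<open>
  The category of small sets with elements in \<open>'w\<close>. Arrows carry their domain and codomain, and
  the underlying function is made canonical by \<open>extensional\<close>.
\<close>

type_synonym 'w set_arr = "'w set \<times> ('w \<Rightarrow> 'w) \<times> 'w set"

definition set_cat :: "'v rel \<Rightarrow> ('w set, 'w set_arr) category" where
  "set_cat \<Omega> = \<lparr>
     Ob = {X. |X| <o \<Omega>},
     Arr = {(X, f, Y). |X| <o \<Omega> \<and> |Y| <o \<Omega> \<and> f \<in> X \<rightarrow>\<^sub>E Y},
     Dom = (\<lambda>(X, f, Y). X),
     Cod = (\<lambda>(X, f, Y). Y),
     Id = (\<lambda>X. (X, \<lambda>x\<in>X. x, X)),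
     Comp = (\<lambda>(Y, g, Z) (X, f, Y'). (X, compose X g f, Z))\<rparr>"

definition app :: "'w set_arr \<Rightarrow> 'w \<Rightarrow> 'w" where
  "app s = fst (snd s)"

definition hom_functor ::
    "('o, 'm) category \<Rightarrow> 'o \<Rightarrow> ('o, 'm, 'm set, 'm set_arr) cat_fun" where
  "hom_functor C A = \<lparr>
     FOb = (\<lambda>B. hom C A B),
     FArr = (\<lambda>f. (hom C A (Dom C f), \<lambda>g \<in> hom C A (Dom C f). f \<cdot>\<^bsub>C\<^esub> g, hom C A (Cod C f)))\<rparr>"


section \<open>Directed colimits\<close>

text \<open>
  \<open>\<kappa>\<close>-directed small posets; \<open>\<kappa> = natLeq\<close> gives the directed ones. The bound on subsets of size
  less than \<open>\<kappa>\<close> also covers the empty subset, so the posets are nonempty.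
\<close>

definition directed_posets :: "'v rel \<Rightarrow> 'k rel \<Rightarrow> ('v set \<times> 'v rel) set" where
  "directed_posets \<Omega> \<kappa> = {(I, r). |I| <o \<Omega> \<and> partial_order_on I r \<and>
     (\<forall>X \<subseteq> I. |X| <o \<kappa> \<longrightarrow> (\<exists>u \<in> I. \<forall>x \<in> X. (x, u) \<in> r))}"

definition diagram ::
    "('o, 'm) category \<Rightarrow> 'v set \<Rightarrow> 'v rel \<Rightarrow> ('v \<Rightarrow> 'o) \<Rightarrow> ('v \<Rightarrow> 'v \<Rightarrow> 'm) \<Rightarrow> bool" where
  "diagram C I r D d \<longleftrightarrow>
     (\<forall>i \<in> I. D i \<in> Ob C) \<and>
     (\<forall>(i, j) \<in> r. d i j \<in> hom C (D i) (D j)) \<and>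
     (\<forall>i \<in> I. d i i = Id C (D i)) \<and>
     (\<forall>i j k. (i, j) \<in> r \<and> (j, k) \<in> r \<longrightarrow> d i k = d j k \<cdot>\<^bsub>C\<^esub> d i j)"

definition cocone ::
    "('o, 'm) category \<Rightarrow> 'v set \<Rightarrow> 'v rel \<Rightarrow> ('v \<Rightarrow> 'o) \<Rightarrow> ('v \<Rightarrow> 'v \<Rightarrow> 'm) \<Rightarrow>
     'o \<Rightarrow> ('v \<Rightarrow> 'm) \<Rightarrow> bool" where
  "cocone C I r D d X c \<longleftrightarrow> X \<in> Ob C \<and> (\<forall>i \<in> I. c i \<in> hom C (D i) X) \<and>
     (\<forall>(i, j) \<in> r. c j \<cdot>\<^bsub>C\<^esub> d i j = c i)"

definition colimit ::
    "('o, 'm) category \<Rightarrow> 'v set \<Rightarrow> 'v rel \<Rightarrow> ('v \<Rightarrow> 'o) \<Rightarrow> ('v \<Rightarrow> 'v \<Rightarrow> 'm) \<Rightarrow>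
     'o \<Rightarrow> ('v \<Rightarrow> 'm) \<Rightarrow> bool" where
  "colimit C I r D d X c \<longleftrightarrow> cocone C I r D d X c \<and>
     (\<forall>Y e. cocone C I r D d Y e \<longrightarrow> (\<exists>!u. u \<in> hom C X Y \<and> (\<forall>i \<in> I. u \<cdot>\<^bsub>C\<^esub> c i = e i)))"

definition has_directed_colimits :: "'v rel \<Rightarrow> 'k rel \<Rightarrow> ('o, 'm) category \<Rightarrow> bool" where
  "has_directed_colimits \<Omega> \<kappa> C \<longleftrightarrow>
     (\<forall>(I, r) \<in> directed_posets \<Omega> \<kappa>. \<forall>D d. diagram C I r D d \<longrightarrow> (\<exists>X c. colimit C I r D d X c))"

definition preserves_directed_colimits ::
    "'v rel \<Rightarrow> 'k rel \<Rightarrow> ('o, 'm) category \<Rightarrow> ('p, 'n) category \<Rightarrow>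
     ('o, 'm, 'p, 'n) cat_fun \<Rightarrow> bool" where
  "preserves_directed_colimits \<Omega> \<kappa> C C' F \<longleftrightarrow>
     (\<forall>(I, r) \<in> directed_posets \<Omega> \<kappa>. \<forall>D d X c.
        diagram C I r D d \<and> colimit C I r D d X c \<longrightarrow>
        colimit C' I r (\<lambda>i. FOb F (D i)) (\<lambda>i j. FArr F (d i j)) (FOb F X) (\<lambda>i. FArr F (c i)))"


section \<open>Presentable objects and accessible categories\<close>

definition presentable :: "'v rel \<Rightarrow> 'k rel \<Rightarrow> ('o, 'm) category \<Rightarrow> 'o \<Rightarrow> bool" where
  "presentable \<Omega> \<kappa> C A \<longleftrightarrow> A \<in> Ob C \<and>
     preserves_directed_colimits \<Omega> \<kappa> C (set_cat \<Omega>) (hom_functor C A)"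

definition preserves_presentable ::
    "'v rel \<Rightarrow> 'k rel \<Rightarrow> ('o, 'm) category \<Rightarrow> ('p, 'n) category \<Rightarrow>
     ('o, 'm, 'p, 'n) cat_fun \<Rightarrow> bool" where
  "preserves_presentable \<Omega> \<kappa> C D F \<longleftrightarrow>
     (\<forall>A. presentable \<Omega> \<kappa> C A \<longrightarrow> presentable \<Omega> \<kappa> D (FOb F A))"

definition accessible :: "'v rel \<Rightarrow> 'k rel \<Rightarrow> ('o, 'm) category \<Rightarrow> bool" where
  "accessible \<Omega> lam C \<longleftrightarrow> regular_card lam \<and> category C \<and> locally_small \<Omega> C \<and>
     has_directed_colimits \<Omega> lam C \<and>
     (\<exists>\<A>. |\<A>| <o \<Omega> \<and> (\<forall>A \<in> \<A>. presentable \<Omega> lam C A) \<and>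
        (\<forall>X \<in> Ob C. \<exists>(I, r) \<in> directed_posets \<Omega> lam. \<exists>D d c.
           diagram C I r D d \<and> D ` I \<subseteq> \<A> \<and> colimit C I r D d X c))"

definition presentability_rank ::
    "'v rel \<Rightarrow> ('o, 'm) category \<Rightarrow> 'o \<Rightarrow> 'k rel \<Rightarrow> bool" where
  "presentability_rank \<Omega> C M \<rho> \<longleftrightarrow> regular_card \<rho> \<and> presentable \<Omega> \<rho> C M \<and>
     (\<forall>\<rho>'. small_card \<Omega> \<rho>' \<and> regular_card \<rho>' \<and> presentable \<Omega> \<rho>' C M \<longrightarrow> \<rho> \<le>o \<rho>')"

definition has_size :: "'v rel \<Rightarrow> ('o, 'm) category \<Rightarrow> 'o \<Rightarrow> 'v rel \<Rightarrow> bool" where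
  "has_size \<Omega> C M \<mu> \<longleftrightarrow> small_card \<Omega> \<mu> \<and> presentability_rank \<Omega> C M (cardSuc \<mu>)"

text \<open>
  ``Size at most \<open>\<mu>\<close>'' is read as ``presentability rank at most \<open>\<mu>\<^sup>+\<close>''. For an object of size
  \<open>\<mu>'\<close> this is \<open>\<mu>' \<le> \<mu>\<close>, and it does not drop objects whose rank is not a successor
  (for example of rank \<open>\<aleph>\<^sub>0\<close>).
\<close>

definition has_size_at_most :: "'v rel \<Rightarrow> ('o, 'm) category \<Rightarrow> 'o \<Rightarrow> 'v rel \<Rightarrow> bool" where
  "has_size_at_most \<Omega> C M \<mu> \<longleftrightarrow>
     (\<exists>\<rho>. small_card \<Omega> \<rho> \<and> presentability_rank \<Omega> C M \<rho> \<and> \<rho> \<le>o cardSuc \<mu>)"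


section \<open>Weak CAECs\<close>

type_synonym ('o, 'm, 'v) set_functor = "('o, 'm, 'v set, 'v set_arr) cat_fun"

definition coherent ::
    "'v rel \<Rightarrow> ('o, 'm) category \<Rightarrow> ('o, 'm, 'v) set_functor \<Rightarrow> bool" where
  "coherent \<Omega> K U \<longleftrightarrow>
     (\<forall>A \<in> Ob K. \<forall>B \<in> Ob K. \<forall>C \<in> Ob K. \<forall>h \<in> hom K A C. \<forall>g \<in> hom K B C.
       \<forall>f \<in> hom (set_cat \<Omega>) (FOb U A) (FOb U B).
         FArr U g \<cdot>\<^bsub>set_cat \<Omega>\<^esub> f = FArr U h \<longrightarrow> (\<exists>f' \<in> hom K A B. FArr U f' = f))"

definition concrete_monos :: "('o, 'm) category \<Rightarrow> ('o, 'm, 'v) set_functor \<Rightarrow> bool" where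
  "concrete_monos K U \<longleftrightarrow> (\<forall>f \<in> Arr K. inj_on (app (FArr U f)) (FOb U (Dom K f)))"

definition weak_CAEC ::
    "'v rel \<Rightarrow> 'v rel \<Rightarrow> 'v rel \<Rightarrow> ('o, 'm) category \<Rightarrow> ('o, 'm, 'v) set_functor \<Rightarrow> bool" where
  "weak_CAEC \<Omega> \<kappa> lam K U \<longleftrightarrow>
     small_card \<Omega> \<kappa> \<and> regular_card \<kappa> \<and> small_card \<Omega> lam \<and> regular_card lam \<and>
     cat_functor K (set_cat \<Omega>) U \<and> faithful K U \<and>
     accessible \<Omega> lam K \<and> has_directed_colimits \<Omega> natLeq K \<and> (\<forall>f \<in> Arr K. mono_arr K f) \<and>
     coherent \<Omega> K U \<and> concrete_monos K U \<and>
     preserves_directed_colimits \<Omega> \<kappa> K (set_cat \<Omega>) U"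

definition large :: "'v rel \<Rightarrow> ('o, 'm) category \<Rightarrow> bool" where
  "large \<Omega> K \<longleftrightarrow>
     (\<forall>\<alpha>. small_card \<Omega> \<alpha> \<longrightarrow> (\<exists>M \<in> Ob K. \<exists>\<mu>. has_size \<Omega> K M \<mu> \<and> \<alpha> \<le>o \<mu>))"

definition amalgamation :: "('o, 'm) category \<Rightarrow> bool" where
  "amalgamation K \<longleftrightarrow>
     (\<forall>A \<in> Ob K. \<forall>B \<in> Ob K. \<forall>C \<in> Ob K. \<forall>f \<in> hom K A B. \<forall>g \<in> hom K A C.
        \<exists>D \<in> Ob K. \<exists>f' \<in> hom K B D. \<exists>g' \<in> hom K C D. f' \<cdot>\<^bsub>K\<^esub> f = g' \<cdot>\<^bsub>K\<^esub> g)"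

definition joint_embedding :: "('o, 'm) category \<Rightarrow> bool" where
  "joint_embedding K \<longleftrightarrow>
     (\<forall>A \<in> Ob K. \<forall>B \<in> Ob K. \<exists>C \<in> Ob K. hom K A C \<noteq> {} \<and> hom K B C \<noteq> {})"

text \<open>
  The cardinal \<open>\<lambda>\<^sub>U\<close>, as a relation. It ranges over regular cardinals, the only ones for which
  presentability is considered.
\<close>

definition is_lambda_U ::
    "'v rel \<Rightarrow> 'v rel \<Rightarrow> ('o, 'm) category \<Rightarrow> ('o, 'm, 'v) set_functor \<Rightarrow> 'v rel \<Rightarrow> bool" where
  "is_lambda_U \<Omega> lam K U \<rho> \<longleftrightarrow>
     small_card \<Omega> \<rho> \<and> regular_card \<rho> \<and> lam \<le>o \<rho> \<and> preserves_presentable \<Omega> \<rho> K (set_cat \<Omega>) U \<and>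
     (\<forall>\<rho>'. small_card \<Omega> \<rho>' \<and> regular_card \<rho>' \<and> lam \<le>o \<rho>' \<and>
        preserves_presentable \<Omega> \<rho>' K (set_cat \<Omega>) U \<longrightarrow> \<rho> \<le>o \<rho>')"


section \<open>Types, stability and universal extensions\<close>

definition pretypes ::
    "('o, 'm) category \<Rightarrow> ('o, 'm, 'v) set_functor \<Rightarrow> 'o \<Rightarrow> ('m \<times> 'v) set" where
  "pretypes K U M = {(f, a). f \<in> Arr K \<and> Dom K f = M \<and> a \<in> FOb U (Cod K f)}"

definition type_rel ::
    "('o, 'm) category \<Rightarrow> ('o, 'm, 'v) set_functor \<Rightarrow> 'o \<Rightarrow> ('m \<times> 'v) rel" where
  "type_rel K U M = {((f0, a0), (f1, a1)).
     (f0, a0) \<in> pretypes K U M \<and> (f1, a1) \<in> pretypes K U M \<and>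
     (\<exists>N. \<exists>h0 \<in> hom K (Cod K f0) N. \<exists>h1 \<in> hom K (Cod K f1) N.
        h0 \<cdot>\<^bsub>K\<^esub> f0 = h1 \<cdot>\<^bsub>K\<^esub> f1 \<and> app (FArr U h0) a0 = app (FArr U h1) a1)}"

definition types ::
    "('o, 'm) category \<Rightarrow> ('o, 'm, 'v) set_functor \<Rightarrow> 'o \<Rightarrow> ('m \<times> 'v) set set" where
  "types K U M = pretypes K U M // type_rel K U M"

definition stable_in ::
    "'v rel \<Rightarrow> ('o, 'm) category \<Rightarrow> ('o, 'm, 'v) set_functor \<Rightarrow> 'v rel \<Rightarrow> bool" where
  "stable_in \<Omega> K U \<mu> \<longleftrightarrow> (\<forall>M \<in> Ob K. has_size \<Omega> K M \<mu> \<longrightarrow> |types K U M| \<le>o \<mu>)"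

definition universal_over ::
    "'v rel \<Rightarrow> ('o, 'm) category \<Rightarrow> 'v rel \<Rightarrow> 'o \<Rightarrow> 'o \<Rightarrow> 'm \<Rightarrow> bool" where
  "universal_over \<Omega> K \<mu> M M' m \<longleftrightarrow>
     m \<in> hom K M M' \<and> has_size \<Omega> K M \<mu> \<and> has_size \<Omega> K M' \<mu> \<and>
     (\<forall>N \<in> Ob K. has_size_at_most \<Omega> K N \<mu> \<longrightarrow>
        (\<forall>h \<in> hom K M N. \<exists>t \<in> hom K N M'. t \<cdot>\<^bsub>K\<^esub> h = m))"

end

theory Submission
  imports Defs
begin

text \<open>
  The universal extension of an object \<open>M\<close> of size \<open>\<mu>\<close> extends the colimit of a chain \<open>M\<^sub>i\<close> of length
  \<open>\<mu>\<close> that starts with \<open>M\<close> and in which \<open>M\<^sub>i\<close> realises all types over the colimit of its predecessors.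
  For a morphism \<open>h : M \<rightarrow> N\<close> with \<open>N\<close> of size at most \<open>\<mu>\<close>, enumerate the elements of \<open>N\<close> in order type
  \<open>\<mu>\<close> and build a second chain \<open>N\<^sub>i\<close>, starting with \<open>N\<close>, and morphisms \<open>f\<^sub>i : M\<^sub>i \<rightarrow> N\<^sub>i\<close>, starting
  with \<open>h\<close>. Since \<open>M\<^sub>i\<close> realises all types, \<open>N\<^sub>i\<close> and \<open>f\<^sub>i\<close> can be chosen such that the \<open>i\<close>-th element of
  \<open>N\<close> lies in the image of \<open>f\<^sub>i\<close>. In the colimit all elements of \<open>N\<close> lie in the image of
  \<open>colim M\<^sub>i \<rightarrow> colim N\<^sub>i\<close>, so coherence factors \<open>N \<rightarrow> colim N\<^sub>i\<close> through \<open>colim M\<^sub>i\<close>; as all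
  morphisms are monomorphisms, the factor \<open>N \<rightarrow> colim M\<^sub>i\<close> is compatible with \<open>h\<close>. The chains come from
  \<open>natural_chain\<close> and \<open>transfinite_chain\<close>, and the argument is carried out in \<open>universal_extension\<close>.

  An object of size \<open>\<mu>\<close> has at most \<open>\<mu>\<close> types over it. Amalgamating extensions that represent them all and
  passing to a \<open>\<mu>\<^sup>+\<close>-presentable subobject gives the successor step (\<open>all_types_realized\<close>). This uses that
  \<open>K\<close> is \<open>\<mu>\<^sup>+\<close>-accessible, which follows from the existence of all directed colimits
  (\<open>accessible_raise\<close>). Distinct elements have distinct types, so stability also yields that objects of size
  at most \<open>\<mu>\<close> have at most \<open>\<mu>\<close> elements (\<open>few_elements\<close>).

  The delicate point is that the size must be exactly \<open>\<mu>\<close>, both for the result and for each use of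
  stability. Subobjects and colimits of chains give \<open>\<mu>\<^sup>+\<close>-presentable objects, but their
  presentability rank might be smaller, and for singular \<open>\<mu>\<close> a chain whose length has one fixed
  cofinality does not exclude all smaller ranks at once. Therefore \<open>exact_extension\<close> extends a
  \<open>\<mu>\<^sup>+\<close>-presentable object \<open>X\<close> by the method of Ehrenfeucht and Mostowski. For each
  \<open>n\<close>, extensions of \<open>X\<close> with very many elements contain, by a partition theorem (\<open>erdos_rado\<close>), large sets
  of elements whose subsets with fewer than \<open>n\<close> members lie in subobjects over \<open>X\<close> that all fit together in
  the same way. This pattern can be transferred to any linear order (\<open>template_system\<close>), and the
  directed colimit over the finite subsets of a linear order of size \<open>\<mu>\<close> is not
  \<open>\<rho>\<close>-presentable for any regular \<open>\<rho> \<le> \<mu>\<close> (\<open>indiscernible_colimit_not_presentable\<close>), since no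
  proper subset of the order generates it.
\<close>

section \<open>Cardinals below an inaccessible\<close>

lemma regular_card_UNION:
  assumes "regular_card r" "|I| <o r" "\<And>i. i \<in> I \<Longrightarrow> |A i| <o r"
  shows "|\<Union>i\<in>I. A i| <o r"
  using assms card_of_UNION_ordLess_infinite_Field_regularCard[of r I A]
  unfolding regular_card_def by simp

lemma regular_card_infinite: "regular_card r \<Longrightarrow> Cinfinite r"
  by (simp add: regular_card_def)

lemma regular_card_cardSuc: "Cinfinite r \<Longrightarrow> regular_card (cardSuc r)"
  by (simp add: regular_card_def Cinfinite_cardSuc regularCard_cardSuc)

lemma natLeq_ordLeq_Cinfinite: "Cinfinite r \<Longrightarrow> natLeq \<le>o r"
  by (simp add: natLeq_ordLeq_cinfinite)

lemma finite_ordLess_Cinfinite: "finite A \<Longrightarrow> Cinfinite r \<Longrightarrow> |A| <o r"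
  by (metis finite_iff_ordLess_natLeq natLeq_ordLeq_Cinfinite ordLess_ordLeq_trans)

lemma card_ordLess_subset: "|B| <o r \<Longrightarrow> A \<subseteq> B \<Longrightarrow> |A| <o r"
  by (rule ordLeq_ordLess_trans[OF card_of_mono1])

lemma card_ordLess_image: "|A| <o r \<Longrightarrow> |f ` A| <o r"
  by (rule ordLeq_ordLess_trans[OF card_of_image])

lemma card_ordLess_cardSuc_iff: "Card_order r \<Longrightarrow> |A| <o cardSuc r \<longleftrightarrow> |A| \<le>o r"
  by (rule cardSuc_ordLeq_ordLess[OF _ card_of_Card_order])

lemma ordLess_cardSuc_iff: "Card_order r \<Longrightarrow> Card_order s \<Longrightarrow> s <o cardSuc r \<longleftrightarrow> s \<le>o r"
  by (rule cardSuc_ordLeq_ordLess)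

lemma card_Fpow_le:
  assumes "Cinfinite r" "|A| \<le>o r"
  shows "|Fpow A| \<le>o r"
proof -
  \<comment> \<open>The finite subsets are a countable union of levels, each covered by \<open>|A|\<close> copies of the one before.\<close>
  have level: "|{s \<in> Fpow A. card s = n}| \<le>o r" for n
  proof (induction n)
    case 0
    have "{s \<in> Fpow A. card s = 0} \<subseteq> {{}}" by (auto simp: Fpow_def)
    then have "finite {s \<in> Fpow A. card s = 0}" using finite_subset by blast
    then show ?case by (intro ordLess_imp_ordLeq finite_ordLess_Cinfinite assms(1))
  next
    case (Suc n)
    have "{s \<in> Fpow A. card s = Suc n} \<subseteq> (\<Union>a\<in>A. insert a ` {s \<in> Fpow A. card s = n})"
    proof
      fix s assume s: "s \<in> {s \<in> Fpow A. card s = Suc n}"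
      then obtain a where "a \<in> s" by fastforce
      then have "s = insert a (s - {a})" "a \<in> A" "s - {a} \<in> Fpow A" "card (s - {a}) = n"
        using s by (auto simp: Fpow_def)
      then show "s \<in> (\<Union>a\<in>A. insert a ` {s \<in> Fpow A. card s = n})" by blast
    qed
    moreover have "|\<Union>a\<in>A. insert a ` {s \<in> Fpow A. card s = n}| \<le>o r"
    proof (rule UNION_Cinfinite_bound[OF assms(2) _ assms(1)], rule ballI)
      fix a
      show "|insert a ` {s \<in> Fpow A. card s = n}| \<le>o r"
        by (rule ordLeq_transitive[OF card_of_image Suc])
    qed
    ultimately show ?case by (rule ordLeq_transitive[OF card_of_mono1])
  qed
  have "Fpow A = (\<Union>n\<in>(UNIV::nat set). {s \<in> Fpow A. card s = n})" by auto
  moreover have "|UNIV :: nat set| \<le>o r"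
    by (rule ordIso_ordLeq_trans[OF card_of_nat natLeq_ordLeq_Cinfinite[OF assms(1)]])
  ultimately show ?thesis
    using UNION_Cinfinite_bound[OF _ _ assms(1), of "UNIV :: nat set" "\<lambda>n. {s \<in> Fpow A. card s = n}"]
      level by simp
qed

lemma card_Fpow_less:
  assumes "Cinfinite r" "|A| <o r"
  shows "|Fpow A| <o r"
proof (cases "finite A")
  case True
  then have "finite (Fpow A)" by (simp add: Fpow_Pow_finite)
  then show ?thesis using assms(1) by (rule finite_ordLess_Cinfinite)
next
  case False
  then have "Cinfinite |A|" using card_of_Card_order[of A] by (simp add: cinfinite_def Field_card_of)
  then have "|Fpow A| \<le>o |A|" by (rule card_Fpow_le) (rule ordLeq_refl[OF card_of_Card_order])
  then show ?thesis using assms(2) by (rule ordLeq_ordLess_trans)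
qed

lemma nonempty_surj:
  assumes "|A| \<le>o |B|" "B \<noteq> {}"
  obtains a where "A \<subseteq> a ` B"
proof (cases "A = {}")
  case True then show ?thesis using that by auto
next
  case False
  then show ?thesis using card_of_ordLeq2[OF False, of B] assms(1) that by auto
qed

locale universe =
  fixes \<Omega> :: "'v rel"
  assumes inaccessible: "inaccessible \<Omega>"
begin

lemma regular: "regular_card \<Omega>" and uncountable: "natLeq <o \<Omega>"
  using inaccessible by (auto simp: inaccessible_def)

lemma Omega_Cinfinite: "Cinfinite \<Omega>" by (rule regular_card_infinite[OF regular])

lemma Omega_Card_order: "Card_order \<Omega>" using Omega_Cinfinite by blast

text \<open>Small sets of any type have copies in \<open>'v\<close>, the type that supplies the index sets of diagrams.\<close>

lemma small_copy:
  assumes "|A| <o \<Omega>"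
  obtains f :: "'a \<Rightarrow> 'v" where "inj_on f A" "f ` A \<subseteq> Field \<Omega>"
proof -
  have "|A| \<le>o |Field \<Omega>|"
    using assms card_of_Field_ordIso[OF Omega_Card_order]
    by (meson ordLess_imp_ordLeq ordLeq_ordIso_trans ordIso_symmetric)
  then show ?thesis using that card_of_ordLeq[of A "Field \<Omega>"] by auto
qed

lemma small_Pow:
  assumes "|A| <o \<Omega>" shows "|Pow A| <o \<Omega>"
proof -
  obtain f :: "'a \<Rightarrow> 'v" where f: "inj_on f A" "f ` A \<subseteq> Field \<Omega>" using small_copy assms by blast
  have "|Pow (f ` A)| <o \<Omega>" using f(2) inaccessible card_ordLess_image[OF assms, of f]
    unfolding inaccessible_def by blast
  moreover have "|Pow A| \<le>o |Pow (f ` A)|"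
    by (rule card_of_ordLeqI[of "image f"]) (use f in \<open>auto intro: inj_on_image_Pow\<close>)
  ultimately show ?thesis by (rule ordLeq_ordLess_trans[rotated])
qed

lemma small_finite: "finite A \<Longrightarrow> |A| <o \<Omega>"
  by (rule finite_ordLess_Cinfinite[OF _ Omega_Cinfinite])

lemma small_UN: "|I| <o \<Omega> \<Longrightarrow> (\<And>i. i \<in> I \<Longrightarrow> |A i| <o \<Omega>) \<Longrightarrow> |\<Union>i\<in>I. A i| <o \<Omega>"
  by (rule regular_card_UNION[OF regular])

lemma small_Un: "|A| <o \<Omega> \<Longrightarrow> |B| <o \<Omega> \<Longrightarrow> |A \<union> B| <o \<Omega>"
  by (rule Un_Cinfinite_bound_strict[OF _ _ Omega_Cinfinite])

lemma small_insert: "|A| <o \<Omega> \<Longrightarrow> |insert a A| <o \<Omega>"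
  using small_Un[of "{a}" A] small_finite[of "{a}"] by simp

lemma small_Times:
  assumes "|A| <o \<Omega>" "|B| <o \<Omega>" shows "|A \<times> B| <o \<Omega>"
proof -
  have "A \<times> B = (\<Union>a\<in>A. Pair a ` B)" by auto
  then show ?thesis using small_UN[OF assms(1), of "\<lambda>a. Pair a ` B"] card_ordLess_image[OF assms(2)]
    by auto
qed

lemma small_Func:
  assumes "|A| <o \<Omega>" "|B| <o \<Omega>" shows "|Func A B| <o \<Omega>"
proof -
  have "|Func A B| \<le>o |Pow (A \<times> B)|"
  proof (rule card_of_ordLeqI[of "\<lambda>f. {(a, f a) |a. a \<in> A}"])
    show "inj_on (\<lambda>f. {(a, f a) |a. a \<in> A}) (Func A B)"
    proof (rule inj_onI)
      fix f g assume fg: "f \<in> Func A B" "g \<in> Func A B" "{(a, f a) |a. a \<in> A} = {(a, g a) |a. a \<in> A}"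
      have "f a = g a" for a
      proof (cases "a \<in> A")
        case True then show ?thesis using fg(3) by blast
      next
        case False then show ?thesis using fg(1,2) by (simp add: Func_def)
      qed
      then show "f = g" by blast
    qed
  qed (auto simp: Func_def)
  then show ?thesis using small_Pow[OF small_Times[OF assms]] by (rule ordLeq_ordLess_trans)
qed

lemma small_card_infinite_set:
  assumes "|A| <o \<Omega>"
  obtains B :: "'v set" where "|B| <o \<Omega>" "|A| \<le>o |B|" "infinite B"
proof -
  obtain f :: "'a \<Rightarrow> 'v" where f: "inj_on f A" using small_copy assms by blast
  have N: "|UNIV :: nat set| <o \<Omega>" by (rule ordIso_ordLess_trans[OF card_of_nat uncountable])
  obtain g :: "nat \<Rightarrow> 'v" where g: "inj_on g UNIV" using small_copy[OF N] by blast
  have "|f ` A \<union> range g| <o \<Omega>" by (intro small_Un card_ordLess_image assms N)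
  moreover have "|A| \<le>o |f ` A \<union> range g|" by (rule card_of_ordLeqI[of f]) (use f in auto)
  moreover have "infinite (f ` A \<union> range g)" using g by (simp add: finite_image_iff)
  ultimately show ?thesis using that by blast
qed

lemma small_cardSuc:
  assumes "Card_order r" "r <o \<Omega>" shows "cardSuc r <o \<Omega>"
proof -
  have "|Field r| <o \<Omega>" by (rule ordIso_ordLess_trans[OF card_of_Field_ordIso[OF assms(1)] assms(2)])
  then have "|Pow (Field r)| <o \<Omega>" by (rule small_Pow)
  moreover have "cardSuc r \<le>o |Pow (Field r)|"
    using cardSuc_least[OF assms(1) card_of_Card_order Card_order_Pow[OF assms(1)]] .
  ultimately show ?thesis by (rule ordLeq_ordLess_trans[rotated])
qed

lemma small_card_of: "|A :: 'v set| <o \<Omega> \<Longrightarrow> small_card \<Omega> |A|"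
  by (simp add: small_card_def card_of_Card_order)

end

section \<open>Directed colimits over arbitrary index types\<close>

text \<open>
  Subsets of an index set, and finite sets of elements, will themselves serve as indices, so the type of
  the indices is arbitrary here.
\<close>

definition directed_on :: "'k rel \<Rightarrow> 'i set \<Rightarrow> 'i rel \<Rightarrow> bool" where
  "directed_on \<rho> J s \<longleftrightarrow> partial_order_on J s \<and>
     (\<forall>X \<subseteq> J. |X| <o \<rho> \<longrightarrow> (\<exists>u \<in> J. \<forall>x \<in> X. (x, u) \<in> s))"

lemma directed_posets_iff: "(I, r) \<in> directed_posets \<Omega> \<rho> \<longleftrightarrow> |I| <o \<Omega> \<and> directed_on \<rho> I r"
  by (simp add: directed_posets_def directed_on_def)

lemma directed_on_mono: "directed_on \<rho> J s \<Longrightarrow> \<rho>' \<le>o \<rho> \<Longrightarrow> directed_on \<rho>' J s"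
  unfolding directed_on_def using ordLess_ordLeq_trans by blast

lemma directed_onD:
  assumes "directed_on \<rho> J s" "X \<subseteq> J" "|X| <o \<rho>"
  obtains u where "u \<in> J" "\<And>x. x \<in> X \<Longrightarrow> (x, u) \<in> s"
  using assms unfolding directed_on_def by blast

lemma directed_on_finite:
  assumes "directed_on natLeq J s" "finite X" "X \<subseteq> J"
  obtains u where "u \<in> J" "\<And>x. x \<in> X \<Longrightarrow> (x, u) \<in> s"
  using directed_onD[OF assms(1,3)] assms(2) finite_iff_ordLess_natLeq by blast

lemma directed_on_order:
  assumes "directed_on \<rho> J s"
  shows "s \<subseteq> J \<times> J" "j \<in> J \<Longrightarrow> (j, j) \<in> s" "(i, j) \<in> s \<Longrightarrow> (j, k) \<in> s \<Longrightarrow> (i, k) \<in> s"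
    "(i, j) \<in> s \<Longrightarrow> (j, i) \<in> s \<Longrightarrow> i = j"
  using assms unfolding directed_on_def partial_order_on_def preorder_on_def refl_on_def
  by (auto dest: transD antisymD)

lemma directed_onI:
  assumes "s \<subseteq> J \<times> J" "\<And>j. j \<in> J \<Longrightarrow> (j, j) \<in> s"
    "\<And>i j k. (i, j) \<in> s \<Longrightarrow> (j, k) \<in> s \<Longrightarrow> (i, k) \<in> s"
    "\<And>i j. (i, j) \<in> s \<Longrightarrow> (j, i) \<in> s \<Longrightarrow> i = j"
    "\<And>X. X \<subseteq> J \<Longrightarrow> |X| <o \<rho> \<Longrightarrow> \<exists>u \<in> J. \<forall>x \<in> X. (x, u) \<in> s"
  shows "directed_on \<rho> J s"
  unfolding directed_on_def partial_order_on_def preorder_on_def refl_on_def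
  using assms by (auto intro!: transI antisymI)

lemma directed_on_natLeqI:
  assumes "s \<subseteq> J \<times> J" "\<And>j. j \<in> J \<Longrightarrow> (j, j) \<in> s"
    "\<And>i j k. (i, j) \<in> s \<Longrightarrow> (j, k) \<in> s \<Longrightarrow> (i, k) \<in> s"
    "\<And>i j. (i, j) \<in> s \<Longrightarrow> (j, i) \<in> s \<Longrightarrow> i = j"
    "J \<noteq> {}" "\<And>i j. i \<in> J \<Longrightarrow> j \<in> J \<Longrightarrow> \<exists>u \<in> J. (i, u) \<in> s \<and> (j, u) \<in> s"
  shows "directed_on natLeq J s"
proof (rule directed_onI)
  fix X assume "X \<subseteq> J" "|X| <o natLeq"
  then have "finite X" by (simp add: finite_iff_ordLess_natLeq)
  then show "\<exists>u\<in>J. \<forall>x\<in>X. (x, u) \<in> s" using \<open>X \<subseteq> J\<close>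
  proof induction
    case empty then show ?case using assms(5) by blast
  next
    case (insert x X)
    then obtain u where "u \<in> J" "\<forall>x\<in>X. (x, u) \<in> s" by auto
    moreover obtain v where "v \<in> J" "(x, v) \<in> s" "(u, v) \<in> s" using assms(6) insert.prems calculation(1) by blast
    ultimately show ?case using assms(3) by blast
  qed
qed (use assms in blast)+

text \<open>
  Finite subsets of any set can be sent monotonically into a directed poset, above prescribed
  lower bounds: a finite set has finitely many proper subsets, so the values can be chosen
  by recursion along inclusion.
\<close>

lemma monotone_choice_on_finite_subsets:
  assumes dir: "directed_on natLeq J r"
    and g: "\<And>s. finite s \<Longrightarrow> s \<subseteq> S \<Longrightarrow> g s \<in> J"
  obtains h where "\<And>s. finite s \<Longrightarrow> s \<subseteq> S \<Longrightarrow> h s \<in> J \<and> (g s, h s) \<in> r"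
    "\<And>s t. finite t \<Longrightarrow> t \<subseteq> S \<Longrightarrow> s \<subseteq> t \<Longrightarrow> (h s, h t) \<in> r"
proof -
  let ?R = "finite_psubset :: 'b set rel"
  let ?P = "\<lambda>h t u. finite t \<and> t \<subseteq> S \<longrightarrow> u \<in> J \<and> (g t, u) \<in> r \<and> (\<forall>s. s \<subset> t \<longrightarrow> (h s, u) \<in> r)"
  have "\<exists>h. \<forall>t. ?P h t (h t)"
  proof (rule dependent_wf_choice[OF wf_finite_psubset])
    fix f g' :: "'b set \<Rightarrow> 'a" and t u
    assume "\<And>z. (z, t) \<in> ?R \<Longrightarrow> f z = g' z"
    then show "?P f t u = ?P g' t u" by auto
  next
    fix t and h :: "'b set \<Rightarrow> 'a" assume IH: "\<And>s. (s, t) \<in> ?R \<Longrightarrow> ?P h s (h s)"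
    show "\<exists>u. ?P h t u"
    proof (cases "finite t \<and> t \<subseteq> S")
      case True
      have "finite (insert (g t) (h ` {s. s \<subset> t}))"
        using True by (auto intro: finite_subset[of _ "Pow t"])
      moreover have "insert (g t) (h ` {s. s \<subset> t}) \<subseteq> J"
      proof -
        have "h s \<in> J" if "s \<subset> t" for s
          using IH[of s] that True finite_subset[of s t] by auto
        then show ?thesis using g True by auto
      qed
      ultimately obtain u where "u \<in> J" "\<And>x. x \<in> insert (g t) (h ` {s. s \<subset> t}) \<Longrightarrow> (x, u) \<in> r"
        using directed_on_finite[OF dir] by blast
      then show ?thesis by blast
    qed blast
  qed
  then obtain h where h: "\<And>t. ?P h t (h t)" by blast
  show ?thesis
  proof
    show "h s \<in> J \<and> (g s, h s) \<in> r" if "finite s" "s \<subseteq> S" for s using h that by blast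
    show "(h s, h t) \<in> r" if "finite t" "t \<subseteq> S" "s \<subseteq> t" for s t
    proof (cases "s = t")
      case True then show ?thesis using h that directed_on_order(2)[OF dir] by blast
    next
      case False then show ?thesis using h[of t] that by blast
    qed
  qed
qed

text \<open>
  Adding to \<open>Z\<close> the values of a monotone choice of upper bounds for its finite subsets is enough: two
  such values have the value at the union of the two finite sets as a common bound.
\<close>

lemma directed_hull:
  assumes dir: "directed_on natLeq J r" and \<nu>: "Cinfinite \<nu>" and Z: "Z \<subseteq> J" "|Z| <o \<nu>"
  obtains T where "Z \<subseteq> T" "T \<subseteq> J" "|T| <o \<nu>" "directed_on natLeq T (r \<inter> T \<times> T)"
proof -
  define g where "g F = (SOME u. u \<in> J \<and> (\<forall>x\<in>F. (x, u) \<in> r))" for F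
  have g: "g F \<in> J \<and> (\<forall>x\<in>F. (x, g F) \<in> r)" if "finite F" "F \<subseteq> Z" for F
  proof -
    have "\<exists>u. u \<in> J \<and> (\<forall>x\<in>F. (x, u) \<in> r)"
      using directed_on_finite[OF dir that(1)] that(2) Z(1) by (metis subset_trans)
    then show ?thesis unfolding g_def by (rule someI_ex)
  qed
  then have gJ: "\<And>F. finite F \<Longrightarrow> F \<subseteq> Z \<Longrightarrow> g F \<in> J" by blast
  obtain h where h: "\<And>F. finite F \<Longrightarrow> F \<subseteq> Z \<Longrightarrow> h F \<in> J \<and> (g F, h F) \<in> r"
      "\<And>F G. finite G \<Longrightarrow> G \<subseteq> Z \<Longrightarrow> F \<subseteq> G \<Longrightarrow> (h F, h G) \<in> r"
    by (rule monotone_choice_on_finite_subsets[OF dir, where S = Z and g = g, OF gJ]) auto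
  note ord = directed_on_order[OF dir]
  have up: "(x, h F) \<in> r" if "finite F" "F \<subseteq> Z" "x \<in> F" for x F
    using g[OF that(1,2)] h(1)[OF that(1,2)] that(3) ord(3) by blast
  let ?T = "Z \<union> h ` Fpow Z"
  have hT: "\<exists>F. finite F \<and> F \<subseteq> Z \<and> (x, h F) \<in> r" if x: "x \<in> ?T" for x
  proof (cases "x \<in> Z")
    case True then show ?thesis using up[of "{x}" x] by blast
  next
    case False
    then obtain F where "F \<in> Fpow Z" "x = h F" using x by blast
    then show ?thesis using h(2)[of F F] by (auto simp: Fpow_def)
  qed
  show ?thesis
  proof
    show "Z \<subseteq> ?T" "?T \<subseteq> J" using Z h(1) by (auto simp: Fpow_def)
    have "|h ` Fpow Z| <o \<nu>" using card_ordLess_image card_Fpow_less[OF \<nu> Z(2)] .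
    then show "|?T| <o \<nu>" using Un_Cinfinite_bound_strict[OF Z(2)] \<nu> by blast
    show "directed_on natLeq ?T (r \<inter> ?T \<times> ?T)"
    proof (rule directed_on_natLeqI)
      show "?T \<noteq> {}" using empty_in_Fpow by blast
      fix x y assume xy: "x \<in> ?T" "y \<in> ?T"
      then obtain F G where FG: "finite F" "F \<subseteq> Z" "(x, h F) \<in> r" "finite G" "G \<subseteq> Z" "(y, h G) \<in> r"
        using hT by meson
      have "(h F, h (F \<union> G)) \<in> r" "(h G, h (F \<union> G)) \<in> r" using h(2) FG by simp_all
      then have "(x, h (F \<union> G)) \<in> r" "(y, h (F \<union> G)) \<in> r" using FG ord(3) by blast+
      moreover have "h (F \<union> G) \<in> ?T" using FG by (auto simp: Fpow_def)
      ultimately show "\<exists>u\<in>?T. (x, u) \<in> r \<inter> ?T \<times> ?T \<and> (y, u) \<in> r \<inter> ?T \<times> ?T"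
        using xy by blast
    qed (use ord \<open>?T \<subseteq> J\<close> in blast)+
  qed
qed

lemma directed_on_image:
  assumes "directed_on \<rho> J s" "inj_on \<phi> J"
  shows "directed_on \<rho> (\<phi> ` J) (map_prod \<phi> \<phi> ` s)"
proof (rule directed_onI)
  note ord = directed_on_order[OF assms(1)]
  have inj: "\<phi> x = \<phi> y \<longleftrightarrow> x = y" if "x \<in> J" "y \<in> J" for x y using assms(2) that by (auto dest: inj_onD)
  show "map_prod \<phi> \<phi> ` s \<subseteq> \<phi> ` J \<times> \<phi> ` J" using ord(1) by auto
  show "\<And>j. j \<in> \<phi> ` J \<Longrightarrow> (j, j) \<in> map_prod \<phi> \<phi> ` s" using ord(2) by auto
  fix i j k
  assume ij: "(i, j) \<in> map_prod \<phi> \<phi> ` s"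
  then obtain a b where ab: "(a, b) \<in> s" "i = \<phi> a" "j = \<phi> b" by auto
  {
    assume "(j, k) \<in> map_prod \<phi> \<phi> ` s"
    then obtain b' c where "(b', c) \<in> s" "j = \<phi> b'" "k = \<phi> c" by auto
    moreover from this have "b' = b" using inj ab ord(1) by blast
    ultimately show "(i, k) \<in> map_prod \<phi> \<phi> ` s" using ab ord(3) by blast
  }
  {
    assume "(j, i) \<in> map_prod \<phi> \<phi> ` s"
    then obtain b' a' where *: "(b', a') \<in> s" "j = \<phi> b'" "i = \<phi> a'" by auto
    then have "b' = b" "a' = a" using inj ab ord(1) by blast+
    then show "i = j" using ab * ord(4) by blast
  }
next
  fix X assume X: "X \<subseteq> \<phi> ` J" "|X| <o \<rho>"
  have sub: "inv_into J \<phi> ` X \<subseteq> J" using X(1) by (auto intro!: inv_into_into)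
  obtain u where u: "u \<in> J" "\<And>x. x \<in> inv_into J \<phi> ` X \<Longrightarrow> (x, u) \<in> s"
    using directed_onD[OF assms(1) sub card_ordLess_image[OF X(2)]] by blast
  have "(x, \<phi> u) \<in> map_prod \<phi> \<phi> ` s" if "x \<in> X" for x
  proof -
    have "(inv_into J \<phi> x, u) \<in> s" "\<phi> (inv_into J \<phi> x) = x"
      using u(2) that X(1) by (auto simp: f_inv_into_f)
    then show ?thesis by (metis map_prod_imageI)
  qed
  then show "\<exists>u\<in>\<phi> ` J. \<forall>x\<in>X. (x, u) \<in> map_prod \<phi> \<phi> ` s" using u(1) by blast
qed

lemma diagramI:
  assumes "\<And>i. i \<in> I \<Longrightarrow> D i \<in> Ob C" "\<And>i j. (i, j) \<in> r \<Longrightarrow> d i j \<in> hom C (D i) (D j)"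
    "\<And>i. i \<in> I \<Longrightarrow> d i i = Id C (D i)"
    "\<And>i j k. (i, j) \<in> r \<Longrightarrow> (j, k) \<in> r \<Longrightarrow> d i k = d j k \<cdot>\<^bsub>C\<^esub> d i j"
  shows "diagram C I r D d"
  unfolding diagram_def
proof (intro conjI ballI allI impI)
  fix p assume "p \<in> r"
  then show "case p of (i, j) \<Rightarrow> d i j \<in> hom C (D i) (D j)" using assms(2) by (cases p) simp
next
  fix i j k assume "(i, j) \<in> r \<and> (j, k) \<in> r"
  then show "d i k = d j k \<cdot>\<^bsub>C\<^esub> d i j" by (intro assms(4)) simp_all
qed (use assms(1,3) in blast)+

lemma diagramD:
  assumes "diagram C I r D d"
  shows "i \<in> I \<Longrightarrow> D i \<in> Ob C" "(i, j) \<in> r \<Longrightarrow> d i j \<in> hom C (D i) (D j)"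
    "i \<in> I \<Longrightarrow> d i i = Id C (D i)"
    "(i, j) \<in> r \<Longrightarrow> (j, k) \<in> r \<Longrightarrow> d i k = d j k \<cdot>\<^bsub>C\<^esub> d i j"
proof -
  from assms have "\<forall>i\<in>I. D i \<in> Ob C" and 2: "\<forall>(i, j)\<in>r. d i j \<in> hom C (D i) (D j)"
    and "\<forall>i\<in>I. d i i = Id C (D i)"
    and 4: "\<forall>i j k. (i, j) \<in> r \<and> (j, k) \<in> r \<longrightarrow> d i k = d j k \<cdot>\<^bsub>C\<^esub> d i j"
    unfolding diagram_def by simp_all
  then show "i \<in> I \<Longrightarrow> D i \<in> Ob C" "i \<in> I \<Longrightarrow> d i i = Id C (D i)" by simp_all
  show "(i, j) \<in> r \<Longrightarrow> d i j \<in> hom C (D i) (D j)" using bspec[OF 2, of "(i, j)"] by simp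
  show "(i, j) \<in> r \<Longrightarrow> (j, k) \<in> r \<Longrightarrow> d i k = d j k \<cdot>\<^bsub>C\<^esub> d i j"
    using 4[rule_format, of i j k] by simp
qed

lemma coconeI:
  assumes "X \<in> Ob C" "\<And>i. i \<in> I \<Longrightarrow> c i \<in> hom C (D i) X"
    "\<And>i j. (i, j) \<in> r \<Longrightarrow> c j \<cdot>\<^bsub>C\<^esub> d i j = c i"
  shows "cocone C I r D d X c"
  unfolding cocone_def
proof (intro conjI ballI)
  fix p assume "p \<in> r"
  then show "case p of (i, j) \<Rightarrow> c j \<cdot>\<^bsub>C\<^esub> d i j = c i" using assms(3) by (cases p) simp
qed (use assms(1,2) in blast)+

lemma coconeD:
  assumes "cocone C I r D d X c"
  shows "X \<in> Ob C" "i \<in> I \<Longrightarrow> c i \<in> hom C (D i) X"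
    "(i, j) \<in> r \<Longrightarrow> c j \<cdot>\<^bsub>C\<^esub> d i j = c i"
proof -
  from assms have "X \<in> Ob C" "\<forall>i\<in>I. c i \<in> hom C (D i) X"
    and 3: "\<forall>(i, j)\<in>r. c j \<cdot>\<^bsub>C\<^esub> d i j = c i"
    unfolding cocone_def by simp_all
  then show "X \<in> Ob C" "i \<in> I \<Longrightarrow> c i \<in> hom C (D i) X" by simp_all
  show "(i, j) \<in> r \<Longrightarrow> c j \<cdot>\<^bsub>C\<^esub> d i j = c i" using bspec[OF 3, of "(i, j)"] by simp
qed

lemma colimit_cocone: "colimit C I r D d X c \<Longrightarrow> cocone C I r D d X c"
  by (simp add: colimit_def)

lemma colimit_ex:
  assumes "colimit C I r D d X c" "cocone C I r D d Y e"
  obtains u where "u \<in> hom C X Y" "\<And>i. i \<in> I \<Longrightarrow> u \<cdot>\<^bsub>C\<^esub> c i = e i"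
  using assms unfolding colimit_def by blast

lemma colimit_eq:
  assumes "colimit C I r D d X c" "cocone C I r D d Y e" "u \<in> hom C X Y" "v \<in> hom C X Y"
    "\<And>i. i \<in> I \<Longrightarrow> u \<cdot>\<^bsub>C\<^esub> c i = e i" "\<And>i. i \<in> I \<Longrightarrow> v \<cdot>\<^bsub>C\<^esub> c i = e i"
  shows "u = v"
  using assms unfolding colimit_def by blast

lemma cocone_cong:
  assumes "\<And>i. i \<in> J \<Longrightarrow> D i = D' i" "\<And>i j. (i, j) \<in> s \<Longrightarrow> d i j = d' i j"
    "\<And>i. i \<in> J \<Longrightarrow> c i = c' i" "s \<subseteq> J \<times> J"
  shows "cocone C J s D d X c \<longleftrightarrow> cocone C J s D' d' X c'"
proof -
  have "cocone C J s D' d' X c'" if "cocone C J s D d X c"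
    and "\<And>i. i \<in> J \<Longrightarrow> D i = D' i" "\<And>i j. (i, j) \<in> s \<Longrightarrow> d i j = d' i j"
      "\<And>i. i \<in> J \<Longrightarrow> c i = c' i" for D D' d d' c c'
  proof (rule coconeI)
    note c = coconeD[OF that(1)]
    fix i j assume ij: "(i, j) \<in> s"
    then have "i \<in> J" "j \<in> J" using assms(4) by auto
    then show "c' j \<cdot>\<^bsub>C\<^esub> d' i j = c' i" using c(3)[OF ij] that(3)[OF ij] that(4) by simp
  next
    fix i assume i: "i \<in> J"
    show "c' i \<in> hom C (D' i) X" using coconeD(2)[OF that(1) i] that(2,4)[OF i] by simp
  qed (rule coconeD(1)[OF that(1)])
  from this[of D d c D' d' c'] this[of D' d' c' D d c] show ?thesis using assms(1,2,3) by metis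
qed

lemma colimit_cong:
  assumes "\<And>i. i \<in> J \<Longrightarrow> D i = D' i" "\<And>i j. (i, j) \<in> s \<Longrightarrow> d i j = d' i j"
    "\<And>i. i \<in> J \<Longrightarrow> c i = c' i" "s \<subseteq> J \<times> J"
  shows "colimit C J s D d X c \<longleftrightarrow> colimit C J s D' d' X c'"
proof -
  have "cocone C J s D d Y e \<longleftrightarrow> cocone C J s D' d' Y e" for Y e
    by (rule cocone_cong) (use assms in auto)
  moreover have "cocone C J s D d X c \<longleftrightarrow> cocone C J s D' d' X c'"
    by (rule cocone_cong) (use assms in auto)
  ultimately show ?thesis unfolding colimit_def using assms(3) by auto
qed

lemma cocone_image:
  "cocone C (\<phi> ` J) (map_prod \<phi> \<phi> ` s) D d X c \<longleftrightarrow>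
   cocone C J s (\<lambda>j. D (\<phi> j)) (\<lambda>i j. d (\<phi> i) (\<phi> j)) X (\<lambda>j. c (\<phi> j))"
  unfolding cocone_def by (auto simp: split_beta)

lemma colimit_image:
  assumes "inj_on \<phi> J" "s \<subseteq> J \<times> J"
  shows "colimit C (\<phi> ` J) (map_prod \<phi> \<phi> ` s) D d X c \<longleftrightarrow>
   colimit C J s (\<lambda>j. D (\<phi> j)) (\<lambda>i j. d (\<phi> i) (\<phi> j)) X (\<lambda>j. c (\<phi> j))" (is "?L \<longleftrightarrow> ?R")
proof
  assume ?L
  show ?R unfolding colimit_def
  proof (intro conjI allI impI)
    show "cocone C J s (\<lambda>j. D (\<phi> j)) (\<lambda>i j. d (\<phi> i) (\<phi> j)) X (\<lambda>j. c (\<phi> j))"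
      using \<open>?L\<close> by (simp add: colimit_def cocone_image)
    fix Y e assume e: "cocone C J s (\<lambda>j. D (\<phi> j)) (\<lambda>i j. d (\<phi> i) (\<phi> j)) Y e"
    have inv: "inv_into J \<phi> (\<phi> j) = j" if "j \<in> J" for j using assms(1) that by simp
    have "cocone C (\<phi> ` J) (map_prod \<phi> \<phi> ` s) D d Y (e \<circ> inv_into J \<phi>)"
      unfolding cocone_image by (rule iffD1[OF cocone_cong e]) (use inv assms(2) in auto)
    then have "\<exists>!u. u \<in> hom C X Y \<and> (\<forall>i\<in>\<phi> ` J. u \<cdot>\<^bsub>C\<^esub> c i = (e \<circ> inv_into J \<phi>) i)"
      using \<open>?L\<close> unfolding colimit_def by blast
    then show "\<exists>!u. u \<in> hom C X Y \<and> (\<forall>i\<in>J. u \<cdot>\<^bsub>C\<^esub> c (\<phi> i) = e i)" using inv by simp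
  qed
next
  assume ?R
  show ?L unfolding colimit_def
  proof (intro conjI allI impI)
    show "cocone C (\<phi> ` J) (map_prod \<phi> \<phi> ` s) D d X c"
      using \<open>?R\<close> by (simp add: colimit_def cocone_image)
    fix Y e assume "cocone C (\<phi> ` J) (map_prod \<phi> \<phi> ` s) D d Y e"
    then have "\<exists>!u. u \<in> hom C X Y \<and> (\<forall>i\<in>J. u \<cdot>\<^bsub>C\<^esub> c (\<phi> i) = e (\<phi> i))"
      using \<open>?R\<close> unfolding colimit_def cocone_image by blast
    then show "\<exists>!u. u \<in> hom C X Y \<and> (\<forall>i\<in>\<phi> ` J. u \<cdot>\<^bsub>C\<^esub> c i = e i)" by simp
  qed
qed

lemma diagram_image:
  assumes "diagram C J s D d" "inj_on \<phi> J" "s \<subseteq> J \<times> J"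
  shows "diagram C (\<phi> ` J) (map_prod \<phi> \<phi> ` s) (D \<circ> inv_into J \<phi>)
    (\<lambda>i j. d (inv_into J \<phi> i) (inv_into J \<phi> j))"
proof -
  have inv: "inv_into J \<phi> (\<phi> j) = j" if "j \<in> J" for j using assms(2) that by simp
  have inj: "i \<in> J \<Longrightarrow> j \<in> J \<Longrightarrow> \<phi> i = \<phi> j \<Longrightarrow> i = j" for i j using assms(2) by (auto dest: inj_onD)
  have s: "\<And>i j. (i, j) \<in> s \<Longrightarrow> i \<in> J \<and> j \<in> J" using assms(3) by auto
  note D = diagramD[OF assms(1)]
  show ?thesis
  proof (rule diagramI)
    fix i j assume "(i, j) \<in> map_prod \<phi> \<phi> ` s"
    then obtain a b where ab: "(a, b) \<in> s" "i = \<phi> a" "j = \<phi> b" by auto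
    then show "d (inv_into J \<phi> i) (inv_into J \<phi> j)
      \<in> hom C ((D \<circ> inv_into J \<phi>) i) ((D \<circ> inv_into J \<phi>) j)"
      using D(2) s by (simp add: inv)
    fix k assume "(j, k) \<in> map_prod \<phi> \<phi> ` s"
    then obtain b' c where bc: "(b', c) \<in> s" "j = \<phi> b'" "k = \<phi> c" by auto
    then have "b' = b" using ab inj s by blast
    then show "d (inv_into J \<phi> i) (inv_into J \<phi> k) =
      d (inv_into J \<phi> j) (inv_into J \<phi> k) \<cdot>\<^bsub>C\<^esub> d (inv_into J \<phi> i) (inv_into J \<phi> j)"
      using ab bc s D(4)[of a b c] by (simp add: inv)
  qed (use D inv in auto)
qed

section \<open>The category of small sets\<close>

lemma hom_set_cat:
  "s \<in> hom (set_cat \<Omega>) A B \<longleftrightarrow> |A| <o \<Omega> \<and> |B| <o \<Omega> \<and> (\<exists>f \<in> A \<rightarrow>\<^sub>E B. s = (A, f, B))"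
  by (cases s) (auto simp: hom_def set_cat_def)

lemma set_arrE:
  assumes "s \<in> hom (set_cat \<Omega>) A B"
  obtains f where "f \<in> A \<rightarrow>\<^sub>E B" "s = (A, f, B)" "|A| <o \<Omega>" "|B| <o \<Omega>"
  using iffD1[OF hom_set_cat assms] by auto

lemma app_in: "s \<in> hom (set_cat \<Omega>) A B \<Longrightarrow> x \<in> A \<Longrightarrow> app s x \<in> B"
  unfolding hom_set_cat by (elim conjE bexE) (auto simp: app_def)

lemma comp_set_cat: "(B, g, Z) \<cdot>\<^bsub>set_cat \<Omega>\<^esub> (A, f, B') = (A, compose A g f, Z)"
  by (simp add: set_cat_def)

lemma app_comp:
  "s \<in> hom (set_cat \<Omega>) A B \<Longrightarrow> t \<in> hom (set_cat \<Omega>) B Z \<Longrightarrow> x \<in> A \<Longrightarrow>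
    app (t \<cdot>\<^bsub>set_cat \<Omega>\<^esub> s) x = app t (app s x)"
  unfolding hom_set_cat by (elim conjE bexE) (simp add: app_def comp_set_cat compose_def)

lemma set_arr_eqI:
  assumes "s \<in> hom (set_cat \<Omega>) A B" "t \<in> hom (set_cat \<Omega>) A B" "\<And>x. x \<in> A \<Longrightarrow> app s x = app t x"
  shows "s = t"
proof -
  obtain f where f: "f \<in> A \<rightarrow>\<^sub>E B" "s = (A, f, B)" using assms(1) by (rule set_arrE)
  obtain g where g: "g \<in> A \<rightarrow>\<^sub>E B" "t = (A, g, B)" using assms(2) by (rule set_arrE)
  have "f = g" by (rule PiE_ext[OF f(1) g(1)]) (use assms(3) f g in \<open>simp add: app_def\<close>)
  then show ?thesis using f g by simp
qed

lemma set_arrI: "|A| <o \<Omega> \<Longrightarrow> |B| <o \<Omega> \<Longrightarrow> (\<And>x. x \<in> A \<Longrightarrow> f x \<in> B) \<Longrightarrow>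
    (A, restrict f A, B) \<in> hom (set_cat \<Omega>) A B"
  unfolding hom_set_cat by (intro conjI bexI[of _ "restrict f A"]) auto

lemma app_restrict [simp]: "x \<in> A \<Longrightarrow> app (A, restrict f A, B) x = f x"
  by (simp add: app_def)

lemma set_cat_comp_hom:
  assumes "s \<in> hom (set_cat \<Omega>) A B" "t \<in> hom (set_cat \<Omega>) B Z"
  shows "t \<cdot>\<^bsub>set_cat \<Omega>\<^esub> s \<in> hom (set_cat \<Omega>) A Z"
proof -
  obtain f where f: "f \<in> A \<rightarrow>\<^sub>E B" "s = (A, f, B)" using assms(1) by (rule set_arrE)
  obtain g where g: "g \<in> B \<rightarrow>\<^sub>E Z" "t = (B, g, Z)" using assms(2) by (rule set_arrE)
  have "|A| <o \<Omega>" using assms(1) by (rule set_arrE)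
  moreover have "|Z| <o \<Omega>" using assms(2) by (rule set_arrE)
  moreover have "g (f x) \<in> Z" if "x \<in> A" for x using that f(1) g(1) by (auto simp: PiE_def)
  ultimately show ?thesis
    using set_arrI[of A \<Omega> Z "\<lambda>x. g (f x)"] f g by (simp add: comp_set_cat compose_def restrict_def)
qed

text \<open>
  The union \<open>V\<close> of the images carries a cocone, which yields a map \<open>X \<rightarrow> V\<close>; followed by the
  inclusion it must be the identity of \<open>X\<close>.
\<close>

lemma set_cat_colimit_surj:
  assumes "colimit (set_cat \<Omega>) I r D d X c" "x \<in> X" "r \<subseteq> I \<times> I"
    and "\<And>i j. (i, j) \<in> r \<Longrightarrow> d i j \<in> hom (set_cat \<Omega>) (D i) (D j)"
  shows "\<exists>i \<in> I. \<exists>y \<in> D i. app (c i) y = x"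
proof -
  let ?S = "set_cat \<Omega>"
  define V where "V = (\<Union>i\<in>I. app (c i) ` D i)"
  have cX: "cocone ?S I r D d X c" using assms(1) by (simp add: colimit_def)
  then have c: "\<And>i. i \<in> I \<Longrightarrow> c i \<in> hom ?S (D i) X"
    and cd: "\<And>i j. (i, j) \<in> r \<Longrightarrow> c j \<cdot>\<^bsub>?S\<^esub> d i j = c i" by (auto simp: cocone_def)
  have "X \<in> Ob ?S" using cX by (simp add: cocone_def)
  then have X: "|X| <o \<Omega>" by (simp add: set_cat_def)
  have "V \<subseteq> X" using c app_in unfolding V_def by fastforce
  then have V: "|V| <o \<Omega>" using X card_ordLess_subset by blast
  define c' where "c' i = (D i, restrict (app (c i)) (D i), V)" for i
  have D: "\<And>i. i \<in> I \<Longrightarrow> |D i| <o \<Omega>" using c set_arrE by metis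
  have c': "c' i \<in> hom ?S (D i) V" if "i \<in> I" for i
    unfolding c'_def by (rule set_arrI) (use that D V V_def in auto)
  have appc': "app (c' i) y = app (c i) y" if "y \<in> D i" for i y using that by (simp add: c'_def)
  have "cocone ?S I r D d V c'"
    unfolding cocone_def
  proof (intro conjI ballI)
    show "V \<in> Ob ?S" using V by (simp add: set_cat_def)
    fix p assume "p \<in> r"
    then obtain i j where p: "p = (i, j)" "(i, j) \<in> r" by (cases p) auto
    then have ij: "i \<in> I" "j \<in> I" using assms(3) by auto
    have "c' j \<cdot>\<^bsub>?S\<^esub> d i j = c' i"
    proof (rule set_arr_eqI[OF set_cat_comp_hom[OF assms(4) c'] c'])
      fix y assume y: "y \<in> D i"
      have "app (c' j \<cdot>\<^bsub>?S\<^esub> d i j) y = app (c' j) (app (d i j) y)"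
        using app_comp[OF assms(4) c'] p ij y by blast
      also have "\<dots> = app (c j) (app (d i j) y)" using appc' app_in[OF assms(4)] p y by blast
      also have "\<dots> = app (c j \<cdot>\<^bsub>?S\<^esub> d i j) y" using app_comp[OF assms(4) c] p ij y by metis
      finally show "app (c' j \<cdot>\<^bsub>?S\<^esub> d i j) y = app (c' i) y" using cd p y appc' by simp
    qed (use p ij in auto)
    then show "case p of (i, j) \<Rightarrow> c' j \<cdot>\<^bsub>?S\<^esub> d i j = c' i" using p by simp
  qed (use c' in blast)
  then obtain u where u: "u \<in> hom ?S X V" "\<And>i. i \<in> I \<Longrightarrow> u \<cdot>\<^bsub>?S\<^esub> c i = c' i"
    using assms(1) unfolding colimit_def by blast
  define \<iota> where "\<iota> = (V, restrict (\<lambda>x. x) V, X)"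
  have \<iota>: "\<iota> \<in> hom ?S V X" unfolding \<iota>_def by (rule set_arrI) (use V X \<open>V \<subseteq> X\<close> in auto)
  define e where "e = (X, restrict (\<lambda>x. x) X, X)"
  have e: "e \<in> hom ?S X X" unfolding e_def by (rule set_arrI) (use X in auto)
  note \<iota>u = set_cat_comp_hom[OF u(1) \<iota>]
  have "(\<iota> \<cdot>\<^bsub>?S\<^esub> u) \<cdot>\<^bsub>?S\<^esub> c i = c i" if "i \<in> I" for i
  proof (rule set_arr_eqI[OF set_cat_comp_hom[OF c[OF that] \<iota>u] c[OF that]])
    fix y assume y: "y \<in> D i"
    have "app ((\<iota> \<cdot>\<^bsub>?S\<^esub> u) \<cdot>\<^bsub>?S\<^esub> c i) y = app \<iota> (app u (app (c i) y))"
      using app_comp[OF c[OF that] \<iota>u y] app_comp[OF u(1) \<iota>] app_in[OF c[OF that] y] by simp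
    also have "\<dots> = app \<iota> (app (c' i) y)" using app_comp[OF c[OF that] u(1) y] u(2)[OF that] by simp
    also have "\<dots> = app \<iota> (app (c i) y)" using appc'[OF y] by simp
    also have "\<dots> = app (c i) y"
    proof -
      have "app (c i) y \<in> V" using that y by (auto simp: V_def)
      then show ?thesis by (simp add: \<iota>_def)
    qed
    finally show "app ((\<iota> \<cdot>\<^bsub>?S\<^esub> u) \<cdot>\<^bsub>?S\<^esub> c i) y = app (c i) y" .
  qed
  moreover have "e \<cdot>\<^bsub>?S\<^esub> c i = c i" if "i \<in> I" for i
  proof (rule set_arr_eqI[OF set_cat_comp_hom[OF c[OF that] e] c[OF that]])
    fix y assume y: "y \<in> D i"
    show "app (e \<cdot>\<^bsub>?S\<^esub> c i) y = app (c i) y"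
      using app_comp[OF c[OF that] e y] app_in[OF c[OF that] y] by (simp add: e_def)
  qed
  ultimately have "\<iota> \<cdot>\<^bsub>?S\<^esub> u = e" by (rule colimit_eq[OF assms(1) cX \<iota>u e])
  then have "app \<iota> (app u x) = x" using app_comp[OF u(1) \<iota> assms(2)] assms(2) by (simp add: e_def)
  moreover have "app u x \<in> V" using app_in[OF u(1) assms(2)] .
  ultimately have "x \<in> V" by (simp add: \<iota>_def)
  then show ?thesis by (auto simp: V_def)
qed

section \<open>Presentability when all morphisms are monomorphisms\<close>

lemma homD: "f \<in> hom C A B \<Longrightarrow> f \<in> Arr C" "f \<in> hom C A B \<Longrightarrow> Dom C f = A" "f \<in> hom C A B \<Longrightarrow> Cod C f = B"
  by (auto simp: hom_def)

locale mono_category = universe \<Omega> + category K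
  for \<Omega> :: "'v rel" and K :: "('o, 'm) category" (structure) +
  assumes locally_small: "locally_small \<Omega> K"
    and all_mono: "f \<in> Arr K \<Longrightarrow> mono_arr K f"
    and directed_colimits: "has_directed_colimits \<Omega> natLeq K"
begin

lemma hom_Ob: "f \<in> hom K A B \<Longrightarrow> A \<in> Ob K" "f \<in> hom K A B \<Longrightarrow> B \<in> Ob K"
  using Dom_in_Ob Cod_in_Ob by (auto simp: hom_def)

lemma small_hom: "A \<in> Ob K \<Longrightarrow> B \<in> Ob K \<Longrightarrow> |hom K A B| <o \<Omega>"
  using locally_small by (simp add: locally_small_def)

lemma mono_cancel: "f \<in> hom K B C \<Longrightarrow> g \<in> hom K A B \<Longrightarrow> h \<in> hom K A B \<Longrightarrow> f \<cdot> g = f \<cdot> h \<Longrightarrow> g = h"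
  using all_mono[of f] unfolding mono_arr_def by (simp add: homD)

text \<open>A small directed diagram over any index type is renamed to one over \<open>'v\<close>.\<close>

lemma colimit_exists:
  assumes "directed_on natLeq J s" "|J| <o \<Omega>" "diagram K J s D d"
  obtains X c where "colimit K J s D d X c"
proof -
  obtain \<phi> :: "_ \<Rightarrow> 'v" where \<phi>: "inj_on \<phi> J" using small_copy assms(2) by blast
  note s = directed_on_order(1)[OF assms(1)]
  have "(\<phi> ` J, map_prod \<phi> \<phi> ` s) \<in> directed_posets \<Omega> natLeq"
    using directed_on_image[OF assms(1) \<phi>] card_ordLess_image[OF assms(2)] by (simp add: directed_posets_iff)
  then obtain X c where "colimit K (\<phi> ` J) (map_prod \<phi> \<phi> ` s) (D \<circ> inv_into J \<phi>)
    (\<lambda>i j. d (inv_into J \<phi> i) (inv_into J \<phi> j)) X c"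
    using directed_colimits diagram_image[OF assms(3) \<phi> s] unfolding has_directed_colimits_def by blast
  then have "colimit K J s (\<lambda>j. D (inv_into J \<phi> (\<phi> j)))
      (\<lambda>i j. d (inv_into J \<phi> (\<phi> i)) (inv_into J \<phi> (\<phi> j))) X (\<lambda>j. c (\<phi> j))"
    unfolding colimit_image[OF \<phi> s] by simp
  then have "colimit K J s D d X (\<lambda>j. c (\<phi> j))"
    by (rule iffD1[OF colimit_cong, rotated -1]) (use \<phi> s in auto)
  then show ?thesis by (rule that)
qed

text \<open>A colimit cocone of sets is jointly surjective; renaming the indices makes this available for every index type.\<close>

lemma preserved_colimit_surj:
  assumes pres: "preserves_directed_colimits \<Omega> \<rho> K (set_cat \<Omega>) F"
    and F: "\<And>A B f. f \<in> hom K A B \<Longrightarrow> FArr F f \<in> hom (set_cat \<Omega>) (FOb F A) (FOb F B)"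
    and J: "directed_on \<rho> J s" "|J| <o \<Omega>" "diagram K J s D d" and X: "colimit K J s D d X c"
    and x: "x \<in> FOb F X"
  obtains j y where "j \<in> J" "y \<in> FOb F (D j)" "app (FArr F (c j)) y = x"
proof -
  obtain \<phi> :: "_ \<Rightarrow> 'v" where \<phi>: "inj_on \<phi> J" using small_copy J(2) by blast
  note s = directed_on_order(1)[OF J(1)]
  let ?\<psi> = "inv_into J \<phi>"
  have \<psi>: "?\<psi> (\<phi> j) = j" if "j \<in> J" for j using \<phi> that by simp
  have dp: "(\<phi> ` J, map_prod \<phi> \<phi> ` s) \<in> directed_posets \<Omega> \<rho>"
    using directed_on_image[OF J(1) \<phi>] card_ordLess_image[OF J(2)] by (simp add: directed_posets_iff)
  have diag: "diagram K (\<phi> ` J) (map_prod \<phi> \<phi> ` s) (D \<circ> ?\<psi>) (\<lambda>i j. d (?\<psi> i) (?\<psi> j))"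
    by (rule diagram_image[OF J(3) \<phi> s])
  have col: "colimit K (\<phi> ` J) (map_prod \<phi> \<phi> ` s) (D \<circ> ?\<psi>) (\<lambda>i j. d (?\<psi> i) (?\<psi> j)) X (\<lambda>i. c (?\<psi> i))"
    unfolding colimit_image[OF \<phi> s]
    by (rule iffD1[OF colimit_cong X]) (use \<psi> s in auto)
  have "colimit (set_cat \<Omega>) (\<phi> ` J) (map_prod \<phi> \<phi> ` s) (\<lambda>i. FOb F ((D \<circ> ?\<psi>) i))
      (\<lambda>i j. FArr F (d (?\<psi> i) (?\<psi> j))) (FOb F X) (\<lambda>i. FArr F (c (?\<psi> i)))"
    using pres dp diag col unfolding preserves_directed_colimits_def by fast
  from set_cat_colimit_surj[OF this x] obtain i y
    where "i \<in> \<phi> ` J" "y \<in> FOb F ((D \<circ> ?\<psi>) i)" "app (FArr F (c (?\<psi> i))) y = x"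
    using directed_on_order(1)[OF directed_on_image[OF J(1) \<phi>]] F[OF diagramD(2)[OF diag]] by metis
  then show ?thesis using that[of "?\<psi> i" y] \<psi> by auto
qed

abbreviation "postcomp A f \<equiv> FArr (hom_functor K A) f"

lemma postcomp_hom:
  assumes "A \<in> Ob K" "f \<in> hom K B C"
  shows "postcomp A f \<in> hom (set_cat \<Omega>) (hom K A B) (hom K A C)"
  unfolding hom_functor_def using set_arrI[of "hom K A B" \<Omega> "hom K A C" "\<lambda>g. f \<cdot> g"]
    small_hom hom_Ob[OF assms(2)] assms Comp_in_hom by (simp add: homD[OF assms(2)])

lemma app_postcomp: "f \<in> hom K B C \<Longrightarrow> g \<in> hom K A B \<Longrightarrow> app (postcomp A f) g = f \<cdot> g"
  by (simp add: hom_functor_def homD)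

lemma FOb_hom_functor [simp]: "FOb (hom_functor K A) B = hom K A B"
  by (simp add: hom_functor_def)

lemma presentable_factor:
  assumes "presentable \<Omega> \<rho> K A" "directed_on \<rho> J s" "|J| <o \<Omega>" "diagram K J s D d"
    "colimit K J s D d X c" "f \<in> hom K A X"
  obtains j g where "j \<in> J" "g \<in> hom K A (D j)" "c j \<cdot> g = f"
proof -
  have A: "A \<in> Ob K" and pres: "preserves_directed_colimits \<Omega> \<rho> K (set_cat \<Omega>) (hom_functor K A)"
    using assms(1) by (auto simp: presentable_def)
  have F: "postcomp A f \<in> hom (set_cat \<Omega>) (FOb (hom_functor K A) B) (FOb (hom_functor K A) C)"
    if "f \<in> hom K B C" for f B C using postcomp_hom[OF A that] by simp
  obtain j g where j: "j \<in> J" "g \<in> FOb (hom_functor K A) (D j)" "app (postcomp A (c j)) g = f"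
    by (rule preserved_colimit_surj[OF pres F assms(2-5), of f]) (use assms(6) in simp_all)
  have "c j \<in> hom K (D j) X" using coconeD(2)[OF colimit_cocone[OF assms(5)] j(1)] .
  then show ?thesis using that[of j g] j app_postcomp by simp
qed

text \<open>
  Conversely, factorisation of all morphisms into colimits suffices: two factorisations agree at a
  common later index because the cocone consists of monomorphisms.
\<close>

lemma presentableI:
  assumes A: "A \<in> Ob K" and \<rho>: "Cinfinite \<rho>"
    and fac: "\<And>I r D d X c f. directed_on \<rho> I r \<Longrightarrow> |I :: 'v set| <o \<Omega> \<Longrightarrow> diagram K I r D d \<Longrightarrow>
      colimit K I r D d X c \<Longrightarrow> f \<in> hom K A X \<Longrightarrow> \<exists>i\<in>I. \<exists>g \<in> hom K A (D i). c i \<cdot> g = f"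
  shows "presentable \<Omega> \<rho> K A"
proof -
  let ?S = "set_cat \<Omega>"
  have "colimit ?S I r (\<lambda>i. FOb (hom_functor K A) (D i)) (\<lambda>i j. postcomp A (d i j))
      (FOb (hom_functor K A) X) (\<lambda>i. postcomp A (c i))"
    if I: "(I, r) \<in> directed_posets \<Omega> \<rho>" and dia: "diagram K I r D d" and col: "colimit K I r D d X c"
    for I r D d X c
  proof -
    have dir: "directed_on \<rho> I r" "|I| <o \<Omega>" using I by (simp_all add: directed_posets_iff)
    note D = diagramD[OF dia]
    note c = coconeD[OF colimit_cocone[OF col]]
    note rI = directed_on_order(1)[OF dir(1)]
    have hc: "\<And>i. i \<in> I \<Longrightarrow> postcomp A (c i) \<in> hom ?S (hom K A (D i)) (hom K A X)"
      using postcomp_hom[OF A c(2)] .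
    have hd: "\<And>i j. (i, j) \<in> r \<Longrightarrow> postcomp A (d i j) \<in> hom ?S (hom K A (D i)) (hom K A (D j))"
      using postcomp_hom[OF A D(2)] .
    have cocone: "cocone ?S I r (\<lambda>i. hom K A (D i)) (\<lambda>i j. postcomp A (d i j)) (hom K A X) (\<lambda>i. postcomp A (c i))"
    proof (rule coconeI)
      show "hom K A X \<in> Ob ?S" using small_hom[OF A c(1)] by (simp add: set_cat_def)
      fix i j assume ij: "(i, j) \<in> r"
      then have mem: "i \<in> I" "j \<in> I" using rI by auto
      show "postcomp A (c j) \<cdot>\<^bsub>?S\<^esub> postcomp A (d i j) = postcomp A (c i)"
      proof (rule set_arr_eqI[OF set_cat_comp_hom[OF hd[OF ij] hc[OF mem(2)]] hc[OF mem(1)]])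
        fix g assume g: "g \<in> hom K A (D i)"
        have "app (postcomp A (c j) \<cdot>\<^bsub>?S\<^esub> postcomp A (d i j)) g = c j \<cdot> (d i j \<cdot> g)"
          using app_comp[OF hd[OF ij] hc[OF mem(2)] g] app_postcomp[OF D(2)[OF ij] g]
            app_postcomp[OF c(2)[OF mem(2)] Comp_in_hom[OF g D(2)[OF ij]]] by simp
        also have "\<dots> = c i \<cdot> g" using Comp_assoc[OF g D(2)[OF ij] c(2)[OF mem(2)]] c(3)[OF ij] by simp
        finally show "app (postcomp A (c j) \<cdot>\<^bsub>?S\<^esub> postcomp A (d i j)) g = app (postcomp A (c i)) g"
          using app_postcomp[OF c(2)[OF mem(1)] g] by simp
      qed
    qed (use hc in auto)
    moreover have "\<exists>!u. u \<in> hom ?S (hom K A X) Y \<and> (\<forall>i\<in>I. u \<cdot>\<^bsub>?S\<^esub> postcomp A (c i) = e i)"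
      if Y: "cocone ?S I r (\<lambda>i. hom K A (D i)) (\<lambda>i j. postcomp A (d i j)) Y e" for Y e
    proof -
      note e = coconeD[OF Y]
      have agree: "app (e i) g = app (e j) h"
        if i: "i \<in> I" "g \<in> hom K A (D i)" and j: "j \<in> I" "h \<in> hom K A (D j)" and eq: "c i \<cdot> g = c j \<cdot> h"
        for i j g h
      proof -
        have fin: "|{i, j}| <o \<rho>" by (rule finite_ordLess_Cinfinite[OF _ \<rho>]) simp
        obtain k where k: "k \<in> I" "\<And>x. x \<in> {i, j} \<Longrightarrow> (x, k) \<in> r"
          by (rule directed_onD[OF dir(1) _ fin]) (use i j in auto)
        then have ik: "(i, k) \<in> r" and jk: "(j, k) \<in> r" by auto
        have step: "app (e i) g = app (e k) (d i k \<cdot> g)" "c k \<cdot> (d i k \<cdot> g) = c i \<cdot> g"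
          if "(i, k) \<in> r" "g \<in> hom K A (D i)" for i g
        proof -
          have "i \<in> I" using that rI by auto
          show "app (e i) g = app (e k) (d i k \<cdot> g)"
            using app_comp[OF hd[OF that(1)] e(2)[OF k(1)] that(2)] e(3)[OF that(1)]
              app_postcomp[OF D(2)[OF that(1)] that(2)] by simp
          show "c k \<cdot> (d i k \<cdot> g) = c i \<cdot> g"
            using Comp_assoc[OF that(2) D(2)[OF that(1)] c(2)[OF k(1)]] c(3)[OF that(1)] by simp
        qed
        have "d i k \<cdot> g = d j k \<cdot> h"
          by (rule mono_cancel[OF c(2)[OF k(1)] Comp_in_hom[OF i(2) D(2)[OF ik]] Comp_in_hom[OF j(2) D(2)[OF jk]]])
            (use step(2)[OF ik i(2)] step(2)[OF jk j(2)] eq in simp)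
        then show ?thesis using step(1)[OF ik i(2)] step(1)[OF jk j(2)] by simp
      qed
      \<comment> \<open>The mediating map sends \<open>f\<close> to the value of the cocone at any factorisation of \<open>f\<close>.\<close>
      define P where "P f q \<longleftrightarrow> fst q \<in> I \<and> snd q \<in> hom K A (D (fst q)) \<and> c (fst q) \<cdot> snd q = f" for f q
      define w where "w f = (SOME q. P f q)" for f
      have w: "P f (w f)" if f: "f \<in> hom K A X" for f
      proof -
        obtain i g where "i \<in> I" "g \<in> hom K A (D i)" "c i \<cdot> g = f"
          using fac[OF dir dia col f] by blast
        then have "P f (i, g)" by (simp add: P_def)
        then show ?thesis unfolding w_def by (rule someI)
      qed
      define u where "u = (hom K A X, restrict (\<lambda>f. app (e (fst (w f))) (snd (w f))) (hom K A X), Y)"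
      have small: "|hom K A X| <o \<Omega>" "|Y| <o \<Omega>" using small_hom[OF A c(1)] e(1) by (simp_all add: set_cat_def)
      have u: "u \<in> hom ?S (hom K A X) Y" unfolding u_def
      proof (rule set_arrI[OF small])
        fix f assume "f \<in> hom K A X"
        then show "app (e (fst (w f))) (snd (w f)) \<in> Y" using w[of f] app_in[OF e(2)] by (simp add: P_def)
      qed
      have uc: "u \<cdot>\<^bsub>?S\<^esub> postcomp A (c i) = e i" if i: "i \<in> I" for i
      proof (rule set_arr_eqI[OF set_cat_comp_hom[OF hc[OF i] u] e(2)[OF i]])
        fix g assume g: "g \<in> hom K A (D i)"
        have cg: "c i \<cdot> g \<in> hom K A X" using Comp_in_hom[OF g c(2)[OF i]] .
        have "app (u \<cdot>\<^bsub>?S\<^esub> postcomp A (c i)) g = app u (c i \<cdot> g)"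
          using app_comp[OF hc[OF i] u g] app_postcomp[OF c(2)[OF i] g] by simp
        also have "\<dots> = app (e (fst (w (c i \<cdot> g)))) (snd (w (c i \<cdot> g)))" using cg by (simp add: u_def)
        also have "\<dots> = app (e i) g" using w[OF cg] by (intro agree i g) (simp_all add: P_def)
        finally show "app (u \<cdot>\<^bsub>?S\<^esub> postcomp A (c i)) g = app (e i) g" .
      qed
      have uniq: "v = u" if v: "v \<in> hom ?S (hom K A X) Y" "\<forall>i\<in>I. v \<cdot>\<^bsub>?S\<^esub> postcomp A (c i) = e i" for v
      proof (rule set_arr_eqI[OF v(1) u])
        fix f assume f: "f \<in> hom K A X"
        obtain i g where i: "i \<in> I" and g: "g \<in> hom K A (D i)" and fg: "c i \<cdot> g = f"
          using fac[OF dir dia col f] by blast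
        have "app v f = app (e i) g"
          using app_comp[OF hc[OF i] v(1) g] app_postcomp[OF c(2)[OF i] g] v(2) i fg by simp
        also have "\<dots> = app u f"
          using app_comp[OF hc[OF i] u g] app_postcomp[OF c(2)[OF i] g] uc[OF i] fg by simp
        finally show "app v f = app u f" .
      qed
      show ?thesis
      proof (rule ex1I[of _ u])
        show "u \<in> hom ?S (hom K A X) Y \<and> (\<forall>i\<in>I. u \<cdot>\<^bsub>?S\<^esub> postcomp A (c i) = e i)" using u uc by blast
      qed (use uniq in blast)
    qed
    ultimately show ?thesis unfolding colimit_def FOb_hom_functor by blast
  qed
  then show ?thesis unfolding presentable_def preserves_directed_colimits_def using A by blast
qed

lemma presentable_mono:
  assumes "presentable \<Omega> \<rho> K A" "\<rho> \<le>o \<rho>'"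
  shows "presentable \<Omega> \<rho>' K A"
proof -
  have "p \<in> directed_posets \<Omega> \<rho>" if "p \<in> directed_posets \<Omega> \<rho>'" for p
    using that by (cases p) (auto simp: directed_posets_iff intro: directed_on_mono[OF _ assms(2)])
  then show ?thesis using assms(1)
    unfolding presentable_def preserves_directed_colimits_def by auto
qed

lemma presentable_Ob: "presentable \<Omega> \<rho> K A \<Longrightarrow> A \<in> Ob K"
  by (simp add: presentable_def)

text \<open>
  A morphism \<open>P \<rightarrow> X\<close> into a \<open>\<rho>\<close>-directed colimit factors on each \<open>D j\<close>. The fewer than \<open>\<rho>\<close> indices used
  have an upper bound, where the factorisations agree because they agree in \<open>X\<close>.
\<close>

lemma colimit_of_presentables:
  assumes \<rho>: "Cinfinite \<rho>" and J: "|J| <o \<rho>" "s \<subseteq> J \<times> J"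
    and dia: "diagram K J s D d" and col: "colimit K J s D d P p"
    and pr: "\<And>j. j \<in> J \<Longrightarrow> presentable \<Omega> \<rho> K (D j)"
  shows "presentable \<Omega> \<rho> K P"
proof (rule presentableI[OF _ \<rho>])
  note p = coconeD[OF colimit_cocone[OF col]]
  note D = diagramD[OF dia]
  show "P \<in> Ob K" by (rule p(1))
  fix I r E e X c f
  assume I: "directed_on \<rho> I r" "|I :: 'v set| <o \<Omega>" and diaE: "diagram K I r E e"
    and colE: "colimit K I r E e X c" and f: "f \<in> hom K P X"
  note c = coconeD[OF colimit_cocone[OF colE]]
  note E = diagramD[OF diaE]
  have "\<exists>i g. i \<in> I \<and> g \<in> hom K (D j) (E i) \<and> c i \<cdot> g = f \<cdot> p j" if "j \<in> J" for j
    using presentable_factor[OF pr[OF that] I diaE colE Comp_in_hom[OF p(2)[OF that] f]] by metis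
  then obtain i g where ig: "\<And>j. j \<in> J \<Longrightarrow> i j \<in> I" "\<And>j. j \<in> J \<Longrightarrow> g j \<in> hom K (D j) (E (i j))"
    "\<And>j. j \<in> J \<Longrightarrow> c (i j) \<cdot> g j = f \<cdot> p j" by metis
  have "i ` J \<subseteq> I" using ig(1) by auto
  then obtain k where k: "k \<in> I" "\<And>x. x \<in> i ` J \<Longrightarrow> (x, k) \<in> r"
    by (rule directed_onD[OF I(1) _ card_ordLess_image[OF J(1)]]) auto
  define h where "h j = e (i j) k \<cdot> g j" for j
  have h: "h j \<in> hom K (D j) (E k)" if "j \<in> J" for j
    unfolding h_def by (rule Comp_in_hom[OF ig(2)[OF that] E(2)]) (use k that in auto)
  have ch: "c k \<cdot> h j = f \<cdot> p j" if "j \<in> J" for j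
  proof -
    have ik: "(i j, k) \<in> r" using k that by auto
    show ?thesis unfolding h_def
      using Comp_assoc[OF ig(2)[OF that] E(2)[OF ik] c(2)[OF k(1)]] c(3)[OF ik] ig(3)[OF that] by simp
  qed
  have coc: "cocone K J s D d (E k) h"
  proof (rule coconeI)
    show "E k \<in> Ob K" using E(1) k(1) .
    fix a b assume ab: "(a, b) \<in> s"
    then have mem: "a \<in> J" "b \<in> J" using J(2) by auto
    have dab: "h b \<cdot> d a b \<in> hom K (D a) (E k)" using Comp_in_hom[OF D(2)[OF ab] h[OF mem(2)]] .
    have "c k \<cdot> (h b \<cdot> d a b) = c k \<cdot> h a"
      using Comp_assoc[OF D(2)[OF ab] h[OF mem(2)] c(2)[OF k(1)]] ch[OF mem(2)] ch[OF mem(1)]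
        Comp_assoc[OF D(2)[OF ab] p(2)[OF mem(2)] f] p(3)[OF ab] by simp
    then show "h b \<cdot> d a b = h a" by (rule mono_cancel[OF c(2)[OF k(1)] dab h[OF mem(1)]])
  qed (use h in auto)
  obtain u where u: "u \<in> hom K P (E k)" "\<And>j. j \<in> J \<Longrightarrow> u \<cdot> p j = h j"
    by (rule colimit_ex[OF col coc]) auto
  have cocX: "cocone K J s D d X (\<lambda>j. f \<cdot> p j)"
  proof (rule coconeI)
    show "X \<in> Ob K" by (rule c(1))
    show "\<And>j. j \<in> J \<Longrightarrow> f \<cdot> p j \<in> hom K (D j) X" using Comp_in_hom[OF p(2) f] .
    fix a b assume ab: "(a, b) \<in> s"
    then have mem: "b \<in> J" using J(2) by auto
    show "(f \<cdot> p b) \<cdot> d a b = f \<cdot> p a" using Comp_assoc[OF D(2)[OF ab] p(2)[OF mem] f] p(3)[OF ab] by simp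
  qed
  have "c k \<cdot> u = f"
  proof (rule colimit_eq[OF col cocX Comp_in_hom[OF u(1) c(2)[OF k(1)]] f])
    fix j assume j: "j \<in> J"
    show "(c k \<cdot> u) \<cdot> p j = f \<cdot> p j"
      using Comp_assoc[OF p(2)[OF j] u(1) c(2)[OF k(1)]] u(2)[OF j] ch[OF j] by simp
  qed simp
  then show "\<exists>i\<in>I. \<exists>g\<in>hom K P (E i). c i \<cdot> g = f" using k(1) u(1) by blast
qed

text \<open>
  Any two members of the cover \<open>\<T>\<close> lie in a third one, so a cocone on the colimits \<open>N T\<close> assigns to each
  index \<open>j\<close> a morphism that does not depend on the member through which \<open>j\<close> is reached, and these
  morphisms form a cocone on the original diagram.
\<close>

lemma colimit_of_subdiagrams:
  assumes s: "s \<subseteq> J \<times> J" and dia: "diagram K J s D d" and col: "colimit K J s D d X c"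
    and T: "\<And>T. T \<in> \<T> \<Longrightarrow> T \<subseteq> J \<and> colimit K T (s \<inter> T \<times> T) D d (N T) (n T)"
    and up: "\<And>T T'. T \<in> \<T> \<Longrightarrow> T' \<in> \<T> \<Longrightarrow> \<exists>T''\<in>\<T>. T \<subseteq> T'' \<and> T' \<subseteq> T''"
    and cover: "J \<subseteq> \<Union>\<T>"
  obtains e k where "diagram K \<T> {(T, T'). T \<in> \<T> \<and> T' \<in> \<T> \<and> T \<subseteq> T'} N e"
    "colimit K \<T> {(T, T'). T \<in> \<T> \<and> T' \<in> \<T> \<and> T \<subseteq> T'} N e X k"
    "\<And>T j. T \<in> \<T> \<Longrightarrow> j \<in> T \<Longrightarrow> k T \<cdot> n T j = c j"
    "\<And>T T' j. T \<in> \<T> \<Longrightarrow> T' \<in> \<T> \<Longrightarrow> T \<subseteq> T' \<Longrightarrow> j \<in> T \<Longrightarrow> e T T' \<cdot> n T j = n T' j"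
proof -
  note D = diagramD[OF dia]
  note c = coconeD[OF colimit_cocone[OF col]]
  have TJ: "\<And>T. T \<in> \<T> \<Longrightarrow> T \<subseteq> J" and colT: "\<And>T. T \<in> \<T> \<Longrightarrow> colimit K T (s \<inter> T \<times> T) D d (N T) (n T)"
    using T by blast+
  note n = coconeD[OF colimit_cocone[OF colT]]
  let ?O = "{(T, T'). T \<in> \<T> \<and> T' \<in> \<T> \<and> T \<subseteq> T'}"
  have coc: "cocone K T (s \<inter> T \<times> T) D d (N T') (n T')" if "T \<in> \<T>" "T' \<in> \<T>" "T \<subseteq> T'" for T T'
  proof (rule coconeI)
    fix i j assume "(i, j) \<in> s \<inter> T \<times> T"
    then show "n T' j \<cdot> d i j = n T' i" using n(3)[OF that(2), of i j] that(3) by auto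
  qed (use n that in auto)
  have cocX: "cocone K T (s \<inter> T \<times> T) D d X c" if "T \<in> \<T>" for T
  proof (rule coconeI)
    fix i j assume "(i, j) \<in> s \<inter> T \<times> T"
    then show "c j \<cdot> d i j = c i" using c(3) by auto
  qed (use c TJ[OF that] in auto)
  have "\<exists>u. u \<in> hom K (N T) (N T') \<and> (\<forall>j\<in>T. u \<cdot> n T j = n T' j)" if "T \<in> \<T>" "T' \<in> \<T>" "T \<subseteq> T'" for T T'
    by (rule colimit_ex[OF colT[OF that(1)] coc[OF that]]) blast
  then obtain e where e: "\<And>T T'. T \<in> \<T> \<Longrightarrow> T' \<in> \<T> \<Longrightarrow> T \<subseteq> T' \<Longrightarrow> e T T' \<in> hom K (N T) (N T')"
    "\<And>T T' j. T \<in> \<T> \<Longrightarrow> T' \<in> \<T> \<Longrightarrow> T \<subseteq> T' \<Longrightarrow> j \<in> T \<Longrightarrow> e T T' \<cdot> n T j = n T' j" by metis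
  have "\<exists>u. u \<in> hom K (N T) X \<and> (\<forall>j\<in>T. u \<cdot> n T j = c j)" if "T \<in> \<T>" for T
    by (rule colimit_ex[OF colT[OF that] cocX[OF that]]) blast
  then obtain k where k: "\<And>T. T \<in> \<T> \<Longrightarrow> k T \<in> hom K (N T) X"
    "\<And>T j. T \<in> \<T> \<Longrightarrow> j \<in> T \<Longrightarrow> k T \<cdot> n T j = c j" by metis
  have diaT: "diagram K \<T> ?O N e"
  proof (rule diagramI)
    fix T assume T: "T \<in> \<T>"
    show "N T \<in> Ob K" by (rule n(1)[OF T])
    show "e T T = Id K (N T)"
      by (rule colimit_eq[OF colT[OF T] coc[OF T T subset_refl] e(1)[OF T T subset_refl] Id_in_hom[OF n(1)[OF T]]])
        (use e(2)[OF T T] Id_Comp[OF n(2)[OF T]] in simp_all)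
  next
    fix T T' assume "(T, T') \<in> ?O"
    then show "e T T' \<in> hom K (N T) (N T')" using e(1) by auto
  next
    fix A B C assume "(A, B) \<in> ?O" "(B, C) \<in> ?O"
    then have A: "A \<in> \<T>" and B: "B \<in> \<T>" and C: "C \<in> \<T>" and AB: "A \<subseteq> B" and BC: "B \<subseteq> C" by auto
    have AC: "A \<subseteq> C" using AB BC by blast
    show "e A C = e B C \<cdot> e A B"
    proof (rule colimit_eq[OF colT[OF A] coc[OF A C AC] e(1)[OF A C AC] Comp_in_hom[OF e(1)[OF A B AB] e(1)[OF B C BC]]])
      fix j assume j: "j \<in> A"
      then have jB: "j \<in> B" using AB by blast
      show "e A C \<cdot> n A j = n C j" by (rule e(2)[OF A C AC j])
      show "(e B C \<cdot> e A B) \<cdot> n A j = n C j"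
        using Comp_assoc[OF n(2)[OF A j] e(1)[OF A B AB] e(1)[OF B C BC]] e(2)[OF A B AB j] e(2)[OF B C BC jB] by simp
    qed
  qed
  have cocT: "cocone K \<T> ?O N e X k"
  proof (rule coconeI)
    fix T T' assume "(T, T') \<in> ?O"
    then have T: "T \<in> \<T>" and T': "T' \<in> \<T>" and TT: "T \<subseteq> T'" by auto
    show "k T' \<cdot> e T T' = k T"
    proof (rule colimit_eq[OF colT[OF T] cocX[OF T] Comp_in_hom[OF e(1)[OF T T' TT] k(1)[OF T']] k(1)[OF T]])
      fix j assume j: "j \<in> T"
      then have "j \<in> T'" using TT by blast
      then show "(k T' \<cdot> e T T') \<cdot> n T j = c j"
        using Comp_assoc[OF n(2)[OF T j] e(1)[OF T T' TT] k(1)[OF T']] e(2)[OF T T' TT j] k(2)[OF T'] by simp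
    qed (use k(2)[OF T] in simp)
  qed (use c(1) k(1) in auto)
  have "colimit K \<T> ?O N e X k"
    unfolding colimit_def
  proof (intro conjI allI impI)
    show "cocone K \<T> ?O N e X k" by (rule cocT)
    fix Y f assume "cocone K \<T> ?O N e Y f"
    note f = coconeD[OF this]
    define g where "g j = (let T = SOME T. T \<in> \<T> \<and> j \<in> T in f T \<cdot> n T j)" for j
    have g: "g j = f T \<cdot> n T j" if T: "T \<in> \<T>" "j \<in> T" for T j
    proof -
      define T0 where "T0 = (SOME T. T \<in> \<T> \<and> j \<in> T)"
      have T0: "T0 \<in> \<T> \<and> j \<in> T0" unfolding T0_def by (rule someI[of _ T]) (use T in blast)
      then obtain T2 where T2: "T2 \<in> \<T>" "T0 \<subseteq> T2" "T \<subseteq> T2" using up[of T0 T] T by blast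
      have "f S \<cdot> n S j = f T2 \<cdot> n T2 j" if "S \<in> \<T>" "j \<in> S" "S \<subseteq> T2" for S
        using f(3)[of S T2] that T2(1) Comp_assoc[OF n(2)[OF that(1,2)] e(1)[OF that(1) T2(1) that(3)] f(2)[OF T2(1)]]
          e(2)[OF that(1) T2(1) that(3) that(2)] by simp
      then show ?thesis using T0 T2 T by (simp add: g_def T0_def[symmetric])
    qed
    have gh: "g j \<in> hom K (D j) Y" if j: "j \<in> J" for j
    proof -
      obtain T where "T \<in> \<T>" "j \<in> T" using cover j by blast
      then show ?thesis using g Comp_in_hom[OF n(2) f(2)] by simp
    qed
    have cocg: "cocone K J s D d Y g"
    proof (rule coconeI)
      fix i j assume ij: "(i, j) \<in> s"
      then have mem: "i \<in> J" "j \<in> J" using s by auto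
      then obtain Ti Tj where "Ti \<in> \<T>" "i \<in> Ti" "Tj \<in> \<T>" "j \<in> Tj" using cover by blast
      then obtain T where T: "T \<in> \<T>" "i \<in> T" "j \<in> T" using up[of Ti Tj] by blast
      show "g j \<cdot> d i j = g i"
        using g[OF T(1,2)] g[OF T(1,3)] Comp_assoc[OF D(2)[OF ij] n(2)[OF T(1,3)] f(2)[OF T(1)]]
          n(3)[OF T(1), of i j] ij T by simp
    qed (use f(1) gh in auto)
    obtain u where u: "u \<in> hom K X Y" "\<And>j. j \<in> J \<Longrightarrow> u \<cdot> c j = g j" by (rule colimit_ex[OF col cocg]) auto
    have uk: "u \<cdot> k T = f T" if T: "T \<in> \<T>" for T
    proof -
      have cocT: "cocone K T (s \<inter> T \<times> T) D d Y g"
        by (rule coconeI) (use coconeD[OF cocg] TJ[OF T] in auto)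
      show ?thesis
      proof (rule colimit_eq[OF colT[OF T] cocT Comp_in_hom[OF k(1)[OF T] u(1)] f(2)[OF T]])
        fix j assume j: "j \<in> T"
        show "(u \<cdot> k T) \<cdot> n T j = g j"
          using Comp_assoc[OF n(2)[OF T j] k(1)[OF T] u(1)] k(2)[OF T j] u(2) TJ[OF T] j by auto
        show "f T \<cdot> n T j = g j" using g[OF T j] by simp
      qed
    qed
    show "\<exists>!u. u \<in> hom K X Y \<and> (\<forall>i\<in>\<T>. u \<cdot> k i = f i)"
    proof (rule ex1I[of _ u])
      show "u \<in> hom K X Y \<and> (\<forall>i\<in>\<T>. u \<cdot> k i = f i)" using u uk by blast
      fix v assume v: "v \<in> hom K X Y \<and> (\<forall>i\<in>\<T>. v \<cdot> k i = f i)"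
      show "v = u"
      proof (rule colimit_eq[OF col cocg _ u(1)])
        show "v \<in> hom K X Y" using v by blast
        fix j assume j: "j \<in> J"
        then obtain T where T: "T \<in> \<T>" "j \<in> T" using cover by blast
        have "v \<cdot> c j = (v \<cdot> k T) \<cdot> n T j"
          using Comp_assoc[OF n(2)[OF T] k(1)[OF T(1)], of v Y] v k(2)[OF T] by simp
        then show "v \<cdot> c j = g j" using v T g by simp
      qed (use u in auto)
    qed
  qed
  then show ?thesis by (rule that[OF diaT _ k(2) e(2)])
qed

end

lemma accessible_presentation:
  assumes "accessible \<Omega> \<rho> C"
  obtains \<A> where "|\<A>| <o \<Omega>" "\<And>A. A \<in> \<A> \<Longrightarrow> presentable \<Omega> \<rho> C A"
    "\<And>X. X \<in> Ob C \<Longrightarrow> \<exists>I r D d c. directed_on \<rho> I r \<and> |I :: 'v set| <o (\<Omega> :: 'v rel) \<and>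
      diagram C I r D d \<and> D ` I \<subseteq> \<A> \<and> colimit C I r D d X c"
proof -
  have "\<exists>\<A>. |\<A>| <o \<Omega> \<and> (\<forall>A \<in> \<A>. presentable \<Omega> \<rho> C A) \<and>
        (\<forall>X \<in> Ob C. \<exists>(I, r) \<in> directed_posets \<Omega> \<rho>. \<exists>D d c.
           diagram C I r D d \<and> D ` I \<subseteq> \<A> \<and> colimit C I r D d X c)"
    using assms by (simp add: accessible_def)
  then obtain \<A> where \<A>: "|\<A>| <o \<Omega>" "\<forall>A\<in>\<A>. presentable \<Omega> \<rho> C A"
    "\<forall>X \<in> Ob C. \<exists>(I, r) \<in> directed_posets \<Omega> \<rho>. \<exists>D d c.
           diagram C I r D d \<and> D ` I \<subseteq> \<A> \<and> colimit C I r D d X c"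
    by (elim exE conjE)
  show ?thesis
  proof (rule that[of \<A>])
    fix X assume X: "X \<in> Ob C"
    obtain p where "p \<in> directed_posets \<Omega> \<rho>" "case p of (I, r) \<Rightarrow> \<exists>D d c.
           diagram C I r D d \<and> D ` I \<subseteq> \<A> \<and> colimit C I r D d X c"
      using bspec[OF \<A>(3) X] by (rule bexE)
    note p = this
    show "\<exists>I r D d c. directed_on \<rho> I r \<and> |I :: 'v set| <o \<Omega> \<and>
      diagram C I r D d \<and> D ` I \<subseteq> \<A> \<and> colimit C I r D d X c"
    proof (cases p)
      case (Pair I r)
      show ?thesis by (rule exI[of _ I], rule exI[of _ r]) (use Pair p in \<open>auto simp: directed_posets_iff\<close>)
    qed
  qed (use \<A> in auto)
qed

context mono_category begin

lemma reindex_colimit: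
  assumes "directed_on \<rho> J s" "|J| <o \<Omega>" "diagram K J s D d" "colimit K J s D d X c"
  obtains I r D' d' c' where "(I, r) \<in> directed_posets \<Omega> \<rho>" "diagram K I r D' d'" "D' ` I = D ` J"
    "colimit K I r D' d' X c'"
proof -
  obtain \<phi> :: "_ \<Rightarrow> 'v" where \<phi>: "inj_on \<phi> J" using small_copy assms(2) by blast
  note s = directed_on_order(1)[OF assms(1)]
  let ?\<psi> = "inv_into J \<phi>"
  have \<psi>: "?\<psi> (\<phi> j) = j" if "j \<in> J" for j using \<phi> that by simp
  show ?thesis
  proof
    show "(\<phi> ` J, map_prod \<phi> \<phi> ` s) \<in> directed_posets \<Omega> \<rho>"
      using directed_on_image[OF assms(1) \<phi>] card_ordLess_image[OF assms(2)] by (simp add: directed_posets_iff)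
    show "diagram K (\<phi> ` J) (map_prod \<phi> \<phi> ` s) (D \<circ> ?\<psi>) (\<lambda>i j. d (?\<psi> i) (?\<psi> j))"
      by (rule diagram_image[OF assms(3) \<phi> s])
    show "(D \<circ> ?\<psi>) ` \<phi> ` J = D ` J" using \<psi> by (force simp: image_iff)
    show "colimit K (\<phi> ` J) (map_prod \<phi> \<phi> ` s) (D \<circ> ?\<psi>) (\<lambda>i j. d (?\<psi> i) (?\<psi> j)) X (\<lambda>i. c (?\<psi> i))"
      unfolding colimit_image[OF \<phi> s] by (rule iffD1[OF colimit_cong assms(4)]) (use \<psi> s in auto)
  qed
qed

lemma retract_presentable:
  assumes "presentable \<Omega> \<rho> K A" "Cinfinite \<rho>" "f \<in> hom K A B" "g \<in> hom K B A" "f \<cdot> g = Id K B"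
  shows "presentable \<Omega> \<rho> K B"
proof (rule presentableI[OF hom_Ob(2)[OF assms(3)] assms(2)])
  fix I r D d X c h
  assume I: "directed_on \<rho> I r" "|I :: 'v set| <o \<Omega>" and dia: "diagram K I r D d"
    and col: "colimit K I r D d X c" and h: "h \<in> hom K B X"
  obtain i k where ik: "i \<in> I" "k \<in> hom K A (D i)" "c i \<cdot> k = h \<cdot> f"
    by (rule presentable_factor[OF assms(1) I dia col Comp_in_hom[OF assms(3) h]]) auto
  have ci: "c i \<in> hom K (D i) X" using coconeD(2)[OF colimit_cocone[OF col] ik(1)] .
  have "c i \<cdot> (k \<cdot> g) = h"
    using Comp_assoc[OF assms(4) ik(2) ci] Comp_assoc[OF assms(4) assms(3) h] ik(3) assms(5) Comp_Id[OF h]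
    by simp
  then show "\<exists>i\<in>I. \<exists>g\<in>hom K B (D i). c i \<cdot> g = h" using ik(1) Comp_in_hom[OF assms(4) ik(2)] by blast
qed

text \<open>
  There is only a small set of diagrams of fewer than \<open>\<nu>\<close> objects of \<open>\<A>\<close> up to renaming of
  indices, so their colimits can be taken in a small set of objects.
\<close>

lemma small_set_of_small_colimits:
  assumes \<A>: "|\<A>| <o \<Omega>" "\<A> \<subseteq> Ob K" and \<nu>: "Card_order \<nu>" "\<nu> <o \<Omega>"
  obtains \<B> where "|\<B>| <o \<Omega>"
    "\<And>(T :: 'i set) s D d X c. s \<subseteq> T \<times> T \<Longrightarrow> |T| <o \<nu> \<Longrightarrow> D ` T \<subseteq> \<A> \<Longrightarrow>
      (\<And>i j. (i, j) \<in> s \<Longrightarrow> d i j \<in> hom K (D i) (D j)) \<Longrightarrow> colimit K T s D d X c \<Longrightarrow>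
      \<exists>Y\<in>\<B>. \<exists>c'. colimit K T s D d Y c'"
proof -
  have F\<nu>: "|Field \<nu>| =o \<nu>" using card_of_Field_ordIso[OF \<nu>(1)] .
  have "|Field \<nu>| <o \<Omega>" using ordIso_ordLess_trans[OF F\<nu> \<nu>(2)] .
  then obtain \<beta> :: "_ \<Rightarrow> 'v" where \<beta>: "inj_on \<beta> (Field \<nu>)" using small_copy by blast
  define B where "B = \<beta> ` Field \<nu>"
  have B: "|B| <o \<Omega>" unfolding B_def using card_ordLess_image \<open>|Field \<nu>| <o \<Omega>\<close> .
  define M where "M = (\<Union>A\<in>\<A>. \<Union>A'\<in>\<A>. hom K A A')"
  have M: "|M| <o \<Omega>" unfolding M_def
    using \<A>(2) by (intro small_UN[OF \<A>(1)] small_hom) auto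
  \<comment> \<open>The diagrams with indices in a fixed set of size \<open>\<nu>\<close>; functions are \<open>undefined\<close> elsewhere.\<close>
  define Q where "Q = Pow B \<times> Pow (B \<times> B) \<times> Func B (insert undefined \<A>) \<times> Func (B \<times> B) (insert undefined M)"
  have Q: "|Q| <o \<Omega>" unfolding Q_def
    by (intro small_Times small_Pow small_Func small_insert B M \<A>)
  define pick where
    "pick q = (case q of (J :: 'v set, s, D, d) \<Rightarrow> SOME X. \<exists>c. colimit K J s D (\<lambda>i j. d (i, j)) X c)" for q
  show ?thesis
  proof
    show "|pick ` Q| <o \<Omega>" by (rule card_ordLess_image[OF Q])
    fix T :: "'i set" and s D d X c
    assume s: "s \<subseteq> T \<times> T" and T: "|T| <o \<nu>" and D: "D ` T \<subseteq> \<A>"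
      and d: "\<And>i j. (i, j) \<in> s \<Longrightarrow> d i j \<in> hom K (D i) (D j)" and col: "colimit K T s D d X c"
    have "|T| \<le>o |Field \<nu>|"
      using ordLeq_ordIso_trans[OF ordLess_imp_ordLeq[OF T] ordIso_symmetric[OF F\<nu>]] .
    then obtain f where f: "inj_on f T" "f ` T \<subseteq> Field \<nu>" using card_of_ordLeq[of T "Field \<nu>"] by auto
    define \<phi> where "\<phi> = \<beta> \<circ> f"
    have \<phi>: "inj_on \<phi> T" "\<phi> ` T \<subseteq> B"
      using f \<beta> by (auto simp: \<phi>_def B_def intro: comp_inj_on inj_on_subset)
    let ?\<psi> = "inv_into T \<phi>"
    have \<psi>: "?\<psi> (\<phi> j) = j" if "j \<in> T" for j using \<phi> that by simp
    let ?s = "map_prod \<phi> \<phi> ` s"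
    define D' where "D' b = (if b \<in> \<phi> ` T then D (?\<psi> b) else undefined)" for b
    define d' where "d' p = (if p \<in> ?s then d (?\<psi> (fst p)) (?\<psi> (snd p)) else undefined)" for p
    have sT: "i \<in> T" "j \<in> T" if "(i, j) \<in> s" for i j using s that by auto
    have d'\<phi>: "d' (\<phi> i, \<phi> j) = d i j" if "(i, j) \<in> s" for i j
    proof -
      have "(\<phi> i, \<phi> j) \<in> ?s" using that by (metis map_prod_imageI)
      then show ?thesis using sT[OF that] by (simp add: d'_def \<psi>)
    qed
    have D'\<phi>: "D' (\<phi> j) = D j" if "j \<in> T" for j using that by (simp add: D'_def \<psi>)
    have iff: "colimit K (\<phi> ` T) ?s D' (\<lambda>i j. d' (i, j)) Y c' \<longleftrightarrow> colimit K T s D d Y (\<lambda>j. c' (\<phi> j))" for Y c'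
      unfolding colimit_image[OF \<phi>(1) s]
      by (rule colimit_cong) (use d'\<phi> D'\<phi> s in auto)
    have "colimit K (\<phi> ` T) ?s D' (\<lambda>i j. d' (i, j)) X (\<lambda>i. c (?\<psi> i))"
      unfolding iff by (rule iffD1[OF colimit_cong col]) (use \<psi> s in auto)
    then have "\<exists>X c. colimit K (\<phi> ` T) ?s D' (\<lambda>i j. d' (i, j)) X c" by blast
    from someI_ex[OF this] obtain c' where
      "colimit K (\<phi> ` T) ?s D' (\<lambda>i j. d' (i, j)) (pick (\<phi> ` T, ?s, D', d')) c'"
      unfolding pick_def by auto
    then have "colimit K T s D d (pick (\<phi> ` T, ?s, D', d')) (\<lambda>j. c' (\<phi> j))" unfolding iff .
    moreover have "(\<phi> ` T, ?s, D', d') \<in> Q"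
    proof -
      have "?s \<subseteq> B \<times> B" using s \<phi>(2) by auto
      moreover have "D' \<in> Func B (insert undefined \<A>)"
        using D \<phi>(2) by (auto simp: Func_def D'_def \<psi>)
      moreover have "d' p \<in> insert undefined M" for p
      proof (cases "p \<in> ?s")
        case True
        then obtain i j where ij: "(i, j) \<in> s" "p = (\<phi> i, \<phi> j)" by auto
        then have "d' p \<in> hom K (D i) (D j)" using d'\<phi> d by simp
        then show ?thesis using D sT[OF ij(1)] by (auto simp: M_def)
      qed (simp add: d'_def)
      moreover have "d' p = undefined" if "p \<notin> B \<times> B" for p using calculation(1) that by (auto simp: d'_def)
      ultimately show ?thesis using \<phi>(2) by (auto simp: Q_def Func_def)
    qed
    ultimately show "\<exists>Y\<in>pick ` Q. \<exists>c'. colimit K T s D d Y c'" by blast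
  qed
qed

text \<open>
  With directed colimits, accessibility passes to every larger regular cardinal (Beke and Rosicky).
  An object \<open>X\<close> is the colimit of a diagram of \<open>\<lambda>\<close>-presentable objects over a directed poset
  \<open>I\<close>. The directed subsets of \<open>I\<close> of size below \<open>\<nu>\<close> are \<open>\<nu>\<close>-directed under inclusion, and
  their colimits are \<open>\<nu>\<close>-presentable.
\<close>

theorem accessible_raise:
  assumes acc: "accessible \<Omega> lam K" and \<nu>: "regular_card \<nu>" "lam \<le>o \<nu>" "\<nu> <o \<Omega>"
  shows "accessible \<Omega> \<nu> K"
proof -
  have C\<nu>: "Cinfinite \<nu>" by (rule regular_card_infinite[OF \<nu>(1)])
  have lam: "Cinfinite lam" using acc by (auto simp: accessible_def regular_card_infinite)
  obtain \<A> where \<A>: "|\<A>| <o \<Omega>" "\<And>A. A \<in> \<A> \<Longrightarrow> presentable \<Omega> lam K A"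
    and gen: "\<And>X. X \<in> Ob K \<Longrightarrow> \<exists>I r D d c. directed_on lam I r \<and> |I :: 'v set| <o \<Omega> \<and>
      diagram K I r D d \<and> D ` I \<subseteq> \<A> \<and> colimit K I r D d X c"
    by (rule accessible_presentation[OF acc], rule that)
  have \<A>Ob: "\<A> \<subseteq> Ob K" using \<A>(2) presentable_Ob by blast
  obtain \<B> where \<B>: "|\<B>| <o \<Omega>"
    "\<And>(T :: 'v set) s D d X c. s \<subseteq> T \<times> T \<Longrightarrow> |T| <o \<nu> \<Longrightarrow> D ` T \<subseteq> \<A> \<Longrightarrow>
      (\<And>i j. (i, j) \<in> s \<Longrightarrow> d i j \<in> hom K (D i) (D j)) \<Longrightarrow> colimit K T s D d X c \<Longrightarrow>
      \<exists>Y\<in>\<B>. \<exists>c'. colimit K T s D d Y c'"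
    by (rule small_set_of_small_colimits[OF \<A>(1) \<A>Ob _ \<nu>(3)]) (use C\<nu> in auto)
  let ?\<B> = "{Y \<in> \<B>. presentable \<Omega> \<nu> K Y}"
  have "\<exists>(I, r)\<in>directed_posets \<Omega> \<nu>. \<exists>D d c. diagram K I r D d \<and> D ` I \<subseteq> ?\<B> \<and> colimit K I r D d X c"
    if X: "X \<in> Ob K" for X
  proof -
    obtain I :: "'v set" and r D d c where dirl: "directed_on lam I r" and sI: "|I| <o \<Omega>"
      and dia: "diagram K I r D d" and D\<A>: "D ` I \<subseteq> \<A>" and col: "colimit K I r D d X c"
      using gen[OF X] by (elim exE conjE)
    have dir: "directed_on natLeq I r" by (rule directed_on_mono[OF dirl natLeq_ordLeq_Cinfinite[OF lam]])
    note ord = directed_on_order[OF dir]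
    define \<T> where "\<T> = {T. T \<subseteq> I \<and> |T| <o \<nu> \<and> directed_on natLeq T (r \<inter> T \<times> T)}"
    have dirT: "directed_on \<nu> \<T> {(T, T'). T \<in> \<T> \<and> T' \<in> \<T> \<and> T \<subseteq> T'}"
    proof (rule directed_onI)
      fix \<S> assume S: "\<S> \<subseteq> \<T>" "|\<S>| <o \<nu>"
      have "|\<Union>T\<in>\<S>. T| <o \<nu>" by (rule regular_card_UNION[OF \<nu>(1) S(2)]) (use S(1) \<T>_def in auto)
      then obtain T where T: "(\<Union>T\<in>\<S>. T) \<subseteq> T" "T \<subseteq> I" "|T| <o \<nu>" "directed_on natLeq T (r \<inter> T \<times> T)"
        using directed_hull[OF dir C\<nu>, of "\<Union>T\<in>\<S>. T"] S(1) unfolding \<T>_def by blast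
      then have "T \<in> \<T>" by (simp add: \<T>_def)
      then show "\<exists>T\<in>\<T>. \<forall>S\<in>\<S>. (S, T) \<in> {(T, T'). T \<in> \<T> \<and> T' \<in> \<T> \<and> T \<subseteq> T'}"
        using T(1) S(1) by blast
    qed auto
    have "\<exists>Y c'. Y \<in> \<B> \<and> presentable \<Omega> \<nu> K Y \<and> colimit K T (r \<inter> T \<times> T) D d Y c'" if T: "T \<in> \<T>" for T
    proof -
      have TI: "T \<subseteq> I" "|T| <o \<nu>" "directed_on natLeq T (r \<inter> T \<times> T)" using T by (auto simp: \<T>_def)
      have diaT: "diagram K T (r \<inter> T \<times> T) D d"
      proof (rule diagramI)
        fix i j k assume "(i, j) \<in> r \<inter> T \<times> T" "(j, k) \<in> r \<inter> T \<times> T"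
        then show "d i k = d j k \<cdot> d i j" using diagramD(4)[OF dia, of i j k] by blast
      qed (use diagramD(1-3)[OF dia] TI(1) in auto)
      obtain Z c0 where "colimit K T (r \<inter> T \<times> T) D d Z c0"
        by (rule colimit_exists[OF TI(3) card_ordLess_subset[OF sI TI(1)] diaT])
      then obtain Y c' where Y: "Y \<in> \<B>" "colimit K T (r \<inter> T \<times> T) D d Y c'"
        using \<B>(2)[of "r \<inter> T \<times> T" T D d Z c0] TI D\<A> diagramD(2)[OF diaT] by blast
      have "presentable \<Omega> \<nu> K Y"
        by (rule colimit_of_presentables[OF C\<nu> TI(2) _ diaT Y(2)])
          (use D\<A> TI(1) \<A>(2) presentable_mono[OF _ \<nu>(2)] in auto)
      then show ?thesis using Y by blast
    qed
    then obtain N n where N: "\<And>T. T \<in> \<T> \<Longrightarrow> N T \<in> \<B>" "\<And>T. T \<in> \<T> \<Longrightarrow> presentable \<Omega> \<nu> K (N T)"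
      "\<And>T. T \<in> \<T> \<Longrightarrow> colimit K T (r \<inter> T \<times> T) D d (N T) (n T)" by metis
    have cover: "I \<subseteq> \<Union>\<T>"
    proof
      fix i assume i: "i \<in> I"
      have "|{i}| <o \<nu>" by (rule finite_ordLess_Cinfinite[OF _ C\<nu>]) simp
      then obtain T where "{i} \<subseteq> T" "T \<subseteq> I" "|T| <o \<nu>" "directed_on natLeq T (r \<inter> T \<times> T)"
        using directed_hull[OF dir C\<nu>, of "{i}"] i by blast
      then show "i \<in> \<Union>\<T>" by (auto simp: \<T>_def)
    qed
    have up: "\<exists>T''\<in>\<T>. T \<subseteq> T'' \<and> T' \<subseteq> T''" if T: "T \<in> \<T>" "T' \<in> \<T>" for T T'
    proof -
      have fin: "|{T, T'}| <o \<nu>" by (rule finite_ordLess_Cinfinite[OF _ C\<nu>]) simp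
      obtain U where "U \<in> \<T>" "\<And>S. S \<in> {T, T'} \<Longrightarrow> (S, U) \<in> {(T, T'). T \<in> \<T> \<and> T' \<in> \<T> \<and> T \<subseteq> T'}"
        by (rule directed_onD[OF dirT _ fin]) (use T in auto)
      then show ?thesis by blast
    qed
    obtain e k where ek: "diagram K \<T> {(T, T'). T \<in> \<T> \<and> T' \<in> \<T> \<and> T \<subseteq> T'} N e"
      "colimit K \<T> {(T, T'). T \<in> \<T> \<and> T' \<in> \<T> \<and> T \<subseteq> T'} N e X k"
      by (rule colimit_of_subdiagrams[OF ord(1) dia col _ up cover, where N = N and n = n])
        (use N(3) \<T>_def in auto)
    have s\<T>: "|\<T>| <o \<Omega>"
      by (rule card_ordLess_subset[OF small_Pow[OF sI]]) (auto simp: \<T>_def)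
    obtain I' r' D' d' c' where *: "(I', r') \<in> directed_posets \<Omega> \<nu>" "diagram K I' r' D' d'" "D' ` I' = N ` \<T>"
      "colimit K I' r' D' d' X c'" by (rule reindex_colimit[OF dirT s\<T> ek])
    have "D' ` I' \<subseteq> ?\<B>" using * N by auto
    then show ?thesis using * by blast
  qed
  moreover have "|?\<B>| <o \<Omega>" by (rule card_ordLess_subset[OF \<B>(1)]) auto
  moreover have "has_directed_colimits \<Omega> \<nu> K"
  proof -
    have "p \<in> directed_posets \<Omega> natLeq" if "p \<in> directed_posets \<Omega> \<nu>" for p
      using that by (cases p) (auto simp: directed_posets_iff
          intro: directed_on_mono[OF _ natLeq_ordLeq_Cinfinite[OF C\<nu>]])
    then show ?thesis using directed_colimits unfolding has_directed_colimits_def by blast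
  qed
  moreover have "category K" ..
  ultimately show ?thesis using \<nu>(1) locally_small unfolding accessible_def
    by (intro conjI exI[of _ ?\<B>]) auto
qed

end

section \<open>Concrete accessible categories\<close>

locale concrete_category = mono_category \<Omega> K
  for \<Omega> :: "'v rel" and K :: "('o, 'm) category" (structure) +
  fixes U :: "('o, 'm, 'v) set_functor" and \<kappa> lam :: "'v rel"
  assumes U_functor: "cat_functor K (set_cat \<Omega>) U" and U_faithful: "faithful K U"
    and U_coherent: "coherent \<Omega> K U" and U_monos: "concrete_monos K U"
    and U_preserves: "preserves_directed_colimits \<Omega> \<kappa> K (set_cat \<Omega>) U"
    and K_accessible: "accessible \<Omega> lam K"
begin

abbreviation carrier ("\<bar>_\<bar>\<^sub>U") where "\<bar>A\<bar>\<^sub>U \<equiv> FOb U A"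
abbreviation "fn f \<equiv> app (FArr U f)"

lemma U_hom: "f \<in> hom K A B \<Longrightarrow> FArr U f \<in> hom (set_cat \<Omega>) \<bar>A\<bar>\<^sub>U \<bar>B\<bar>\<^sub>U"
  using cat_functor.FArr_in_hom[OF U_functor] .

lemma U_in: "f \<in> hom K A B \<Longrightarrow> a \<in> \<bar>A\<bar>\<^sub>U \<Longrightarrow> fn f a \<in> \<bar>B\<bar>\<^sub>U"
  using app_in[OF U_hom] .

lemma U_comp: "f \<in> hom K A B \<Longrightarrow> g \<in> hom K B C \<Longrightarrow> a \<in> \<bar>A\<bar>\<^sub>U \<Longrightarrow> fn (g \<cdot> f) a = fn g (fn f a)"
  using app_comp[OF U_hom U_hom] cat_functor.FArr_Comp[OF U_functor] by simp

lemma U_id: "A \<in> Ob K \<Longrightarrow> a \<in> \<bar>A\<bar>\<^sub>U \<Longrightarrow> fn (Id K A) a = a"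
  using cat_functor.FArr_Id[OF U_functor] by (simp add: set_cat_def app_def)

lemma U_small: "A \<in> Ob K \<Longrightarrow> |\<bar>A\<bar>\<^sub>U| <o \<Omega>"
  using cat_functor.FOb_in_Ob[OF U_functor] by (simp add: set_cat_def)

lemma U_inj: "f \<in> hom K A B \<Longrightarrow> a \<in> \<bar>A\<bar>\<^sub>U \<Longrightarrow> b \<in> \<bar>A\<bar>\<^sub>U \<Longrightarrow> fn f a = fn f b \<Longrightarrow> a = b"
  using U_monos unfolding concrete_monos_def by (auto simp: hom_def dest: inj_onD)

text \<open>
  The underlying map of the factor is obtained by inverting \<open>U g\<close> on its image; coherence lifts it to a
  morphism, and faithfulness makes the triangle commute in \<open>K\<close>.
\<close>

lemma coherent_factor:
  assumes h: "h \<in> hom K A C" and g: "g \<in> hom K B C" and sub: "\<And>a. a \<in> \<bar>A\<bar>\<^sub>U \<Longrightarrow> fn h a \<in> fn g ` \<bar>B\<bar>\<^sub>U"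
  obtains f where "f \<in> hom K A B" "g \<cdot> f = h"
proof -
  have Ob: "A \<in> Ob K" "B \<in> Ob K" "C \<in> Ob K" using hom_Ob h g by blast+
  define w where "w a = inv_into \<bar>B\<bar>\<^sub>U (fn g) (fn h a)" for a
  have w: "w a \<in> \<bar>B\<bar>\<^sub>U" "fn g (w a) = fn h a" if "a \<in> \<bar>A\<bar>\<^sub>U" for a
    using sub[OF that] unfolding w_def by (rule inv_into_into, rule f_inv_into_f)
  define f where "f = (\<bar>A\<bar>\<^sub>U, restrict w \<bar>A\<bar>\<^sub>U, \<bar>B\<bar>\<^sub>U)"
  have f: "f \<in> hom (set_cat \<Omega>) \<bar>A\<bar>\<^sub>U \<bar>B\<bar>\<^sub>U" unfolding f_def
    by (rule set_arrI[OF U_small[OF Ob(1)] U_small[OF Ob(2)] w(1)])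
  have "FArr U g \<cdot>\<^bsub>set_cat \<Omega>\<^esub> f = FArr U h"
  proof (rule set_arr_eqI[OF set_cat_comp_hom[OF f U_hom[OF g]] U_hom[OF h]])
    fix a assume a: "a \<in> \<bar>A\<bar>\<^sub>U"
    show "app (FArr U g \<cdot>\<^bsub>set_cat \<Omega>\<^esub> f) a = fn h a"
      using app_comp[OF f U_hom[OF g] a] w(2)[OF a] a by (simp add: f_def)
  qed
  then obtain f' where f': "f' \<in> hom K A B" "FArr U f' = f"
    using U_coherent Ob h g f unfolding coherent_def by metis
  have "FArr U (g \<cdot> f') = FArr U h"
    using cat_functor.FArr_Comp[OF U_functor f'(1) g] f'(2) \<open>FArr U g \<cdot>\<^bsub>set_cat \<Omega>\<^esub> f = FArr U h\<close> by simp
  then have "g \<cdot> f' = h"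
    using U_faithful Ob Comp_in_hom[OF f'(1) g] h unfolding faithful_def by (meson inj_onD)
  then show ?thesis using that f'(1) by blast
qed

lemma U_colimit_surj:
  assumes "directed_on \<kappa> J s" "|J| <o \<Omega>" "diagram K J s D d" "colimit K J s D d X c" "x \<in> \<bar>X\<bar>\<^sub>U"
  obtains j y where "j \<in> J" "y \<in> \<bar>D j\<bar>\<^sub>U" "fn (c j) y = x"
  by (rule preserved_colimit_surj[OF U_preserves U_hom assms]) auto

end

text \<open>A regular cardinal \<open>\<nu>\<close> at which \<open>K\<close> is accessible and whose directed colimits are preserved by \<open>U\<close>.\<close>

locale concrete_category_at = concrete_category \<Omega> K U \<kappa> lam
  for \<Omega> \<kappa> lam :: "'v rel" and K :: "('o, 'm) category" (structure)
    and U :: "('o, 'm, 'v) set_functor" +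
  fixes \<nu> :: "'k rel"
  assumes \<nu>_regular: "regular_card \<nu>" and lam_le: "lam \<le>o \<nu>" and \<kappa>_le: "\<kappa> \<le>o \<nu>" and \<nu>_small: "\<nu> <o \<Omega>"
begin

lemma \<nu>_infinite: "Cinfinite \<nu>" by (rule regular_card_infinite[OF \<nu>_regular])

lemma K_accessible_\<nu>: "accessible \<Omega> \<nu> K"
  by (rule accessible_raise[OF K_accessible \<nu>_regular lam_le \<nu>_small])

lemma presentation:
  assumes "X \<in> Ob K"
  obtains I :: "'v set" and r D d c where "directed_on \<nu> I r" "|I| <o \<Omega>" "diagram K I r D d"
    "colimit K I r D d X c" "\<And>i. i \<in> I \<Longrightarrow> presentable \<Omega> \<nu> K (D i)"
proof -
  obtain \<A> where \<A>: "|\<A>| <o \<Omega>" "\<And>A. A \<in> \<A> \<Longrightarrow> presentable \<Omega> \<nu> K A"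
    "\<And>X. X \<in> Ob K \<Longrightarrow> \<exists>I r D d c. directed_on \<nu> I r \<and> |I :: 'v set| <o \<Omega> \<and>
      diagram K I r D d \<and> D ` I \<subseteq> \<A> \<and> colimit K I r D d X c"
    by (rule accessible_presentation[OF K_accessible_\<nu>], rule that)
  from this(3)[OF assms] obtain I :: "'v set" and r D d c where I: "directed_on \<nu> I r" "|I| <o \<Omega>"
    "diagram K I r D d" "D ` I \<subseteq> \<A>" "colimit K I r D d X c" by (elim exE conjE)
  show ?thesis by (rule that[OF I(1,2,3,5)]) (use \<A>(2) I(4) in auto)
qed

text \<open>
  Each element lies in some member of the \<open>\<nu>\<close>-directed diagram, because \<open>U\<close> preserves its colimit, and
  fewer than \<open>\<nu>\<close> indices have an upper bound.
\<close>

lemma index_capturing: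
  assumes I: "directed_on \<nu> I r" "|I| <o \<Omega>" "diagram K I r D d" "colimit K I r D d X c"
    and Z: "Z \<subseteq> \<bar>X\<bar>\<^sub>U" "|Z| <o \<nu>" and i0: "i0 \<in> I"
  obtains i where "i \<in> I" "(i0, i) \<in> r" "Z \<subseteq> fn (c i) ` \<bar>D i\<bar>\<^sub>U"
proof -
  note c = coconeD[OF colimit_cocone[OF I(4)]]
  note D = diagramD[OF I(3)]
  have "\<exists>j. j \<in> I \<and> z \<in> fn (c j) ` \<bar>D j\<bar>\<^sub>U" if "z \<in> Z" for z
  proof -
    have z: "z \<in> \<bar>X\<bar>\<^sub>U" using Z that by blast
    obtain j y where "j \<in> I" "y \<in> \<bar>D j\<bar>\<^sub>U" "fn (c j) y = z"
      by (rule U_colimit_surj[OF directed_on_mono[OF I(1) \<kappa>_le] I(2,3,4) z])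
    then show ?thesis by blast
  qed
  then obtain j where j: "\<And>z. z \<in> Z \<Longrightarrow> j z \<in> I" "\<And>z. z \<in> Z \<Longrightarrow> z \<in> fn (c (j z)) ` \<bar>D (j z)\<bar>\<^sub>U" by metis
  have few: "|{i0} \<union> j ` Z| <o \<nu>"
    by (rule Un_Cinfinite_bound_strict[OF finite_ordLess_Cinfinite[OF _ \<nu>_infinite]
          card_ordLess_image[OF Z(2)] \<nu>_infinite]) simp
  obtain i where i: "i \<in> I" "\<And>x. x \<in> {i0} \<union> j ` Z \<Longrightarrow> (x, i) \<in> r"
    by (rule directed_onD[OF I(1) _ few]) (use i0 j(1) in auto)
  have "z \<in> fn (c i) ` \<bar>D i\<bar>\<^sub>U" if z: "z \<in> Z" for z
  proof -
    obtain y where y: "y \<in> \<bar>D (j z)\<bar>\<^sub>U" "z = fn (c (j z)) y" using j(2)[OF z] by blast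
    have ji: "(j z, i) \<in> r" using i z by blast
    have "z = fn (c i) (fn (d (j z) i) y)"
      using U_comp[OF D(2)[OF ji] c(2)[OF i(1)] y(1)] c(3)[OF ji] y(2) by simp
    then show ?thesis using U_in[OF D(2)[OF ji] y(1)] by blast
  qed
  then show ?thesis using that[of i] i by blast
qed

lemma loewenheim_skolem:
  assumes A: "presentable \<Omega> \<nu> K A" and f: "f \<in> hom K A X" and Z: "Z \<subseteq> \<bar>X\<bar>\<^sub>U" "|Z| <o \<nu>"
  obtains Y y g where "presentable \<Omega> \<nu> K Y" "y \<in> hom K Y X" "g \<in> hom K A Y" "y \<cdot> g = f" "Z \<subseteq> fn y ` \<bar>Y\<bar>\<^sub>U"
proof -
  obtain I :: "'v set" and r D d c where I: "directed_on \<nu> I r" "|I| <o \<Omega>" "diagram K I r D d"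
    "colimit K I r D d X c" "\<And>i. i \<in> I \<Longrightarrow> presentable \<Omega> \<nu> K (D i)"
    by (rule presentation[OF hom_Ob(2)[OF f]], rule that)
  obtain i0 g where i0: "i0 \<in> I" "g \<in> hom K A (D i0)" "c i0 \<cdot> g = f"
    by (rule presentable_factor[OF A I(1-4) f])
  obtain i where i: "i \<in> I" "(i0, i) \<in> r" "Z \<subseteq> fn (c i) ` \<bar>D i\<bar>\<^sub>U"
    by (rule index_capturing[OF I(1-4) Z i0(1)])
  note c = coconeD[OF colimit_cocone[OF I(4)]]
  note D = diagramD[OF I(3)]
  show ?thesis
  proof (rule that)
    show "presentable \<Omega> \<nu> K (D i)" using I(5) i(1) by blast
    show "c i \<in> hom K (D i) X" by (rule c(2)[OF i(1)])
    show "d i0 i \<cdot> g \<in> hom K A (D i)" by (rule Comp_in_hom[OF i0(2) D(2)[OF i(2)]])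
    show "c i \<cdot> (d i0 i \<cdot> g) = f"
      using Comp_assoc[OF i0(2) D(2)[OF i(2)] c(2)[OF i(1)]] c(3)[OF i(2)] i0(3) by simp
  qed (rule i(3))
qed

text \<open>
  If the underlying set is smaller than \<open>\<nu>\<close>, a single member of a \<open>\<nu>\<close>-directed presentation
  covers all elements and is isomorphic to the object by coherence.
\<close>

lemma presentable_if_few_elements:
  assumes X: "X \<in> Ob K" "|\<bar>X\<bar>\<^sub>U| <o \<nu>"
  shows "presentable \<Omega> \<nu> K X"
proof -
  obtain I :: "'v set" and r D d c where I: "directed_on \<nu> I r" "|I| <o \<Omega>" "diagram K I r D d"
    "colimit K I r D d X c" "\<And>i. i \<in> I \<Longrightarrow> presentable \<Omega> \<nu> K (D i)"
    by (rule presentation[OF X(1)], rule that)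
  have "|{}::'v set| <o \<nu>" by (rule finite_ordLess_Cinfinite[OF _ \<nu>_infinite]) simp
  then obtain i0 where i0: "i0 \<in> I" by (rule directed_onD[OF I(1) empty_subsetI])
  obtain i where i: "i \<in> I" "(i0, i) \<in> r" "\<bar>X\<bar>\<^sub>U \<subseteq> fn (c i) ` \<bar>D i\<bar>\<^sub>U"
    by (rule index_capturing[OF I(1-4) subset_refl X(2) i0])
  have ci: "c i \<in> hom K (D i) X" by (rule coconeD(2)[OF colimit_cocone[OF I(4)] i(1)])
  have surj: "fn (Id K X) a \<in> fn (c i) ` \<bar>D i\<bar>\<^sub>U" if "a \<in> \<bar>X\<bar>\<^sub>U" for a
    using that i(3) U_id[OF X(1) that] by auto
  obtain g where "g \<in> hom K X (D i)" "c i \<cdot> g = Id K X"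
    by (rule coherent_factor[OF Id_in_hom[OF X(1)] ci surj])
  then show ?thesis using retract_presentable[OF I(5)[OF i(1)] \<nu>_infinite ci] by blast
qed

end

section \<open>A partition theorem below an inaccessible cardinal\<close>

lemma finite_linear_max:
  assumes "linear_order_on B W" "finite T" "T \<noteq> {}" "T \<subseteq> B"
  obtains m where "m \<in> T" "\<And>x. x \<in> T \<Longrightarrow> (x, m) \<in> W"
proof -
  have W: "\<And>x. x \<in> B \<Longrightarrow> (x, x) \<in> W" "\<And>x y z. (x, y) \<in> W \<Longrightarrow> (y, z) \<in> W \<Longrightarrow> (x, z) \<in> W"
    "\<And>x y. x \<in> B \<Longrightarrow> y \<in> B \<Longrightarrow> (x, y) \<in> W \<or> (y, x) \<in> W"
    using assms(1) unfolding linear_order_on_def partial_order_on_def preorder_on_def refl_on_def total_on_def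
    by (blast, meson transD, metis)
  have "\<exists>m\<in>T. \<forall>x\<in>T. (x, m) \<in> W" using assms(2,3,4)
  proof (induction rule: finite_ne_induct)
    case (singleton x) then show ?case using W(1) by simp
  next
    case (insert x F)
    then obtain m where m: "m \<in> F" "\<forall>y\<in>F. (y, m) \<in> W" by auto
    have "(x, m) \<in> W \<or> (m, x) \<in> W" using W(3) insert.prems m(1) by auto
    then show ?case
    proof
      assume "(x, m) \<in> W" then show ?thesis using m by auto
    next
      assume "(m, x) \<in> W"
      then have "\<forall>y\<in>insert x F. (y, x) \<in> W" using m W insert.prems by blast
      then show ?thesis by blast
    qed
  qed
  then show ?thesis using that by blast
qed

text \<open>
  A qualitative form of the theorem of Erdos and Rado.

  For the step from \<open>n\<close> to \<open>n + 1\<close>, let \<open>B\<close> be large enough for \<open>n\<close> and well-order it. Each \<open>x \<in> S\<close>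
  determines a \<open>B\<close>-indexed sequence \<open>y\<close> of elements of \<open>S\<close>: the next term is a chosen element
  that receives, together with any finite set of earlier terms, the same colour as \<open>x\<close>. If \<open>x\<close> itself
  occurs in its sequence, it can be recovered from its place there and from the colours, so if \<open>S\<close>
  is large some \<open>x\<close> does not occur. Its sequence never breaks down, and the colour of a set
  of its terms does not depend on the last one, which leaves a colouring of \<open>n\<close>-element
  subsets of \<open>B\<close>.
\<close>

lemma (in universe) erdos_rado:
  fixes C :: "'c set" and A :: "'v set"
  assumes C: "|C| <o \<Omega>" and A: "|A| <o \<Omega>"
  shows "\<exists>B :: 'v set. |B| <o \<Omega> \<and> (\<forall>(S :: 'v set) f. |B| \<le>o |S| \<longrightarrow> (\<forall>s. f s \<in> C) \<longrightarrow>
    (\<exists>H q. H \<subseteq> S \<and> |A| \<le>o |H| \<and> (\<forall>s. s \<subseteq> H \<and> finite s \<and> card s = n \<longrightarrow> f s = q)))"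
proof (induction n)
  case 0
  show ?case
  proof (rule exI[of _ A], intro conjI allI impI A)
    fix S :: "'v set" and f :: "'v set \<Rightarrow> 'c" assume S: "|A| \<le>o |S|"
    show "\<exists>H q. H \<subseteq> S \<and> |A| \<le>o |H| \<and> (\<forall>s. s \<subseteq> H \<and> finite s \<and> card s = 0 \<longrightarrow> f s = q)"
      by (rule exI[of _ S], rule exI[of _ "f {}"]) (use S in auto)
  qed
next
  case (Suc n)
  obtain B :: "'v set" where B: "|B| <o \<Omega>"
    and IH: "\<forall>(S :: 'v set) f. |B| \<le>o |S| \<longrightarrow> (\<forall>s. f s \<in> C) \<longrightarrow>
      (\<exists>H q. H \<subseteq> S \<and> |A| \<le>o |H| \<and> (\<forall>s. s \<subseteq> H \<and> finite s \<and> card s = n \<longrightarrow> f s = q))"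
    using Suc.IH by (elim exE conjE)
  obtain W where W: "well_order_on B W" using well_order_on by blast
  have lin: "linear_order_on B W" and wf: "wf (W - Relation.Id)" using W by (auto simp: well_order_on_def)
  have WB: "W \<subseteq> B \<times> B" using lin by (auto simp: linear_order_on_def partial_order_on_def preorder_on_def)
  define E where "E = B \<times> Func (Fpow B) C"
  have E: "|E| <o \<Omega>" unfolding E_def
    by (intro small_Times small_Func B C card_ordLess_subset[OF small_Pow[OF B]] Fpow_subset_Pow)
  obtain B' :: "'v set" where B': "|B'| <o \<Omega>" "|Pow E| \<le>o |B'|"
    by (rule small_card_infinite_set[OF small_Pow[OF E]])
  show ?case
  proof (rule exI[of _ B'], intro conjI allI impI B'(1))
    fix S :: "'v set" and f :: "'v set \<Rightarrow> 'c"
    assume S: "|B'| \<le>o |S|" and f: "\<forall>s. f s \<in> C"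
    define G where "G x h \<xi> = (SOME y. y \<in> S - h ` underS W \<xi> \<and>
      (\<forall>\<sigma>. \<sigma> \<subseteq> underS W \<xi> \<and> finite \<sigma> \<longrightarrow> f (insert y (h ` \<sigma>)) = f (insert x (h ` \<sigma>))))" for x h \<xi>
    have G_cong: "G x g \<xi> = G x' h \<xi>"
      if "\<And>\<eta>. \<eta> \<in> underS W \<xi> \<Longrightarrow> g \<eta> = h \<eta>"
        "\<And>\<sigma>. \<sigma> \<subseteq> underS W \<xi> \<Longrightarrow> finite \<sigma> \<Longrightarrow> f (insert x (g ` \<sigma>)) = f (insert x' (h ` \<sigma>))" for x x' g h \<xi>
    proof -
      have "g ` \<sigma> = h ` \<sigma>" if "\<sigma> \<subseteq> underS W \<xi>" for \<sigma>
        using that \<open>\<And>\<eta>. \<eta> \<in> underS W \<xi> \<Longrightarrow> g \<eta> = h \<eta>\<close> by (intro image_cong) auto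
      then show ?thesis unfolding G_def using that(2) by (intro arg_cong[where f = Eps] ext) auto
    qed
    have "\<exists>h. \<forall>\<xi>. h \<xi> = G x h \<xi>" for x
    proof (rule dependent_wf_choice[OF wf, where P = "\<lambda>h \<xi> r. r = G x h \<xi>"])
      fix g h :: "'v \<Rightarrow> 'v" and \<xi> r assume "\<And>z. (z, \<xi>) \<in> W - Relation.Id \<Longrightarrow> g z = h z"
      then have gh: "\<And>\<eta>. \<eta> \<in> underS W \<xi> \<Longrightarrow> g \<eta> = h \<eta>" by (auto simp: underS_def)
      have "g ` \<sigma> = h ` \<sigma>" if "\<sigma> \<subseteq> underS W \<xi>" for \<sigma>
        using that gh by (intro image_cong) auto
      then show "(r = G x g \<xi>) = (r = G x h \<xi>)" using G_cong[of \<xi> g h x x] gh by simp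
    qed auto
    then obtain y where y: "\<And>x \<xi>. y x \<xi> = G x (y x) \<xi>" by metis
    have "\<exists>x\<in>S. x \<notin> y x ` B"
    proof (rule ccontr)
      assume "\<not> (\<exists>x\<in>S. x \<notin> y x ` B)"
      then have "\<forall>x\<in>S. \<exists>\<xi>\<in>B. x = y x \<xi>" by blast
      then obtain place where place: "\<And>x. x \<in> S \<Longrightarrow> place x \<in> B" "\<And>x. x \<in> S \<Longrightarrow> y x (place x) = x" by metis
      define code where "code x = (place x, \<lambda>\<sigma>. if \<sigma> \<in> Fpow B then f (insert x (y x ` \<sigma>)) else undefined)" for x
      have "inj_on code S"
      proof (rule inj_onI)
        fix x x' assume x: "x \<in> S" "x' \<in> S" "code x = code x'"
        then have pl: "place x = place x'"
          and co: "(\<lambda>\<sigma>. if \<sigma> \<in> Fpow B then f (insert x (y x ` \<sigma>)) else undefined) =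
            (\<lambda>\<sigma>. if \<sigma> \<in> Fpow B then f (insert x' (y x' ` \<sigma>)) else undefined)"
          by (simp_all add: code_def)
        have co: "f (insert x (y x ` \<sigma>)) = f (insert x' (y x' ` \<sigma>))" if "\<sigma> \<in> Fpow B" for \<sigma>
          using fun_cong[OF co, of \<sigma>] that by simp
        have "y x \<xi> = y x' \<xi>" for \<xi>
        proof (induction \<xi> rule: wf_induct_rule[OF wf])
          case (1 \<xi>)
          have "G x (y x) \<xi> = G x' (y x') \<xi>"
          proof (rule G_cong)
            show "\<And>\<eta>. \<eta> \<in> underS W \<xi> \<Longrightarrow> y x \<eta> = y x' \<eta>" using 1 by (auto simp: underS_def)
            fix \<sigma> assume "\<sigma> \<subseteq> underS W \<xi>" "finite \<sigma>"
            then have "\<sigma> \<in> Fpow B" using WB by (auto simp: Fpow_def underS_def)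
            then show "f (insert x (y x ` \<sigma>)) = f (insert x' (y x' ` \<sigma>))" by (rule co)
          qed
          then show ?case using y by metis
        qed
        then show "x = x'" using place(2)[OF x(1)] place(2)[OF x(2)] pl by metis
      qed
      moreover have "code ` S \<subseteq> E" using place(1) f by (auto simp: code_def E_def Func_def)
      ultimately have "|S| \<le>o |E|" using card_of_ordLeq[of S E] by auto
      then have "|S| <o |S|"
        by (rule ordLeq_ordLess_trans[OF _ ordLess_ordLeq_trans[OF card_of_Pow ordLeq_transitive[OF B'(2) S]]])
      then show False by (simp add: ordLess_irreflexive)
    qed
    then obtain x where x: "x \<in> S" "x \<notin> y x ` B" by blast
    let ?y = "y x"
    have step: "?y \<xi> \<in> S - ?y ` underS W \<xi> \<and>
      (\<forall>\<sigma>. \<sigma> \<subseteq> underS W \<xi> \<and> finite \<sigma> \<longrightarrow> f (insert (?y \<xi>) (?y ` \<sigma>)) = f (insert x (?y ` \<sigma>)))"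
      if "\<xi> \<in> B" for \<xi>
    proof -
      have "underS W \<xi> \<subseteq> B" using WB by (auto simp: underS_def)
      then have "x \<in> S - ?y ` underS W \<xi>" using x by blast
      let ?Q = "\<lambda>z. z \<in> S - ?y ` underS W \<xi> \<and>
        (\<forall>\<sigma>. \<sigma> \<subseteq> underS W \<xi> \<and> finite \<sigma> \<longrightarrow> f (insert z (?y ` \<sigma>)) = f (insert x (?y ` \<sigma>)))"
      have eq: "?y \<xi> = (SOME z. ?Q z)" using y[of x \<xi>] unfolding G_def .
      have "?Q x" using \<open>x \<in> S - ?y ` underS W \<xi>\<close> by simp
      then show ?thesis unfolding eq by (rule someI)
    qed
    have inj: "inj_on ?y B"
    proof (rule inj_onI, rule ccontr)
      fix \<xi> \<eta> assume *: "\<xi> \<in> B" "\<eta> \<in> B" "?y \<xi> = ?y \<eta>" "\<xi> \<noteq> \<eta>"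
      then have "\<xi> \<in> underS W \<eta> \<or> \<eta> \<in> underS W \<xi>"
        using lin by (auto simp: linear_order_on_def total_on_def underS_def)
      then show False using step[OF *(1)] step[OF *(2)] *(3) by (metis DiffD2 imageI)
    qed
    have "\<exists>H q. H \<subseteq> B \<and> |A| \<le>o |H| \<and>
        (\<forall>s. s \<subseteq> H \<and> finite s \<and> card s = n \<longrightarrow> f (insert x (?y ` s)) = q)"
      by (rule IH[rule_format, of B "\<lambda>\<sigma>. f (insert x (?y ` \<sigma>))"])
        (use f in \<open>simp_all add: ordLeq_refl[OF card_of_Card_order]\<close>)
    then obtain H0 q where H0: "H0 \<subseteq> B" "|A| \<le>o |H0|"
      "\<forall>s. s \<subseteq> H0 \<and> finite s \<and> card s = n \<longrightarrow> f (insert x (?y ` s)) = q"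
      by (elim exE conjE)
    have "|A| \<le>o |?y ` H0|"
      using ordLeq_transitive[OF H0(2)] card_of_ordLeqI[of ?y H0 "?y ` H0"] inj_on_subset[OF inj H0(1)] by auto
    moreover have "?y ` H0 \<subseteq> S" using step H0(1) by blast
    moreover have "f s = q" if s: "s \<subseteq> ?y ` H0 \<and> finite s \<and> card s = Suc n" for s
    proof -
      obtain \<tau> where \<tau>: "\<tau> \<subseteq> H0" "s = ?y ` \<tau>" using s subset_imageE by metis
      have inj\<tau>: "inj_on ?y \<tau>" using inj_on_subset[OF inj] \<tau>(1) H0(1) by blast
      then have fin: "finite \<tau>" "card \<tau> = Suc n" using s \<tau>(2) by (simp_all add: finite_image_iff card_image)
      then have "\<tau> \<noteq> {}" by auto
      obtain \<xi> where \<xi>: "\<xi> \<in> \<tau>" "\<And>\<eta>. \<eta> \<in> \<tau> \<Longrightarrow> (\<eta>, \<xi>) \<in> W"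
        by (rule finite_linear_max[OF lin fin(1) \<open>\<tau> \<noteq> {}\<close>]) (use \<tau>(1) H0(1) in auto)
      let ?\<sigma> = "\<tau> - {\<xi>}"
      have "?\<sigma> \<subseteq> underS W \<xi>" using \<xi>(2) by (auto simp: underS_def)
      then have "f (insert (?y \<xi>) (?y ` ?\<sigma>)) = f (insert x (?y ` ?\<sigma>))"
        using step[of \<xi>] \<xi>(1) \<tau>(1) H0(1) fin(1) by blast
      moreover have "insert (?y \<xi>) (?y ` ?\<sigma>) = s" using \<tau>(2) \<xi>(1) by auto
      moreover have "f (insert x (?y ` ?\<sigma>)) = q" using spec[OF H0(3), of ?\<sigma>] \<tau>(1) fin \<xi>(1) by auto
      ultimately show ?thesis by simp
    qed
    ultimately show "\<exists>H q. H \<subseteq> S \<and> |A| \<le>o |H| \<and> (\<forall>s. s \<subseteq> H \<and> finite s \<and> card s = Suc n \<longrightarrow> f s = q)"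
      by (rule_tac exI[of _ "?y ` H0"], rule_tac exI[of _ q]) simp
  qed
qed

section \<open>Positions in finite linear orders\<close>

definition strict_linear :: "'a set \<Rightarrow> ('a \<Rightarrow> 'a \<Rightarrow> bool) \<Rightarrow> bool" where
  "strict_linear L lt \<longleftrightarrow> (\<forall>x\<in>L. \<not> lt x x) \<and>
     (\<forall>x\<in>L. \<forall>y\<in>L. \<forall>z\<in>L. lt x y \<longrightarrow> lt y z \<longrightarrow> lt x z) \<and>
     (\<forall>x\<in>L. \<forall>y\<in>L. x \<noteq> y \<longrightarrow> lt x y \<or> lt y x)"

definition pos :: "('a \<Rightarrow> 'a \<Rightarrow> bool) \<Rightarrow> 'a set \<Rightarrow> 'a \<Rightarrow> nat" where
  "pos lt t k = card {y \<in> t. lt y k}"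

lemma pos_strict_mono:
  assumes "strict_linear L lt" "finite t" "t \<subseteq> L" "k \<in> t" "l \<in> t" "lt k l"
  shows "pos lt t k < pos lt t l"
  unfolding pos_def
proof (rule psubset_card_mono)
  show "finite {y \<in> t. lt y l}" using assms(2) by simp
  have "lt y l" if "y \<in> t" "lt y k" for y using assms that unfolding strict_linear_def by blast
  moreover have "\<not> lt k k" using assms unfolding strict_linear_def by blast
  ultimately show "{y \<in> t. lt y k} \<subset> {y \<in> t. lt y l}" using assms(4,6) by blast
qed

lemma pos_less_iff:
  assumes "strict_linear L lt" "finite t" "t \<subseteq> L" "k \<in> t" "l \<in> t"
  shows "pos lt t k < pos lt t l \<longleftrightarrow> lt k l"
proof
  assume less: "pos lt t k < pos lt t l"
  show "lt k l"
  proof (rule ccontr)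
    assume "\<not> lt k l"
    then have "k = l \<or> lt l k" using assms unfolding strict_linear_def by blast
    then show False using less pos_strict_mono[OF assms(1,2,3,5,4)] by auto
  qed
qed (rule pos_strict_mono[OF assms])

lemma pos_bij:
  assumes "strict_linear L lt" "finite t" "t \<subseteq> L"
  shows "bij_betw (pos lt t) t {..<card t}"
proof -
  have inj: "inj_on (pos lt t) t"
  proof (rule inj_onI, rule ccontr)
    fix k l assume kl: "k \<in> t" "l \<in> t" "pos lt t k = pos lt t l" "k \<noteq> l"
    then have "lt k l \<or> lt l k" using assms unfolding strict_linear_def by blast
    then show False using pos_strict_mono[OF assms] kl by (metis less_irrefl)
  qed
  have "pos lt t k < card t" if "k \<in> t" for k
    unfolding pos_def
  proof (rule psubset_card_mono[OF assms(2)])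
    have "\<not> lt k k" using assms that unfolding strict_linear_def by blast
    then show "{y \<in> t. lt y k} \<subset> t" using that by blast
  qed
  then have "pos lt t ` t \<subseteq> {..<card t}" by auto
  moreover have "card (pos lt t ` t) = card {..<card t}" using card_image[OF inj] by simp
  ultimately have "pos lt t ` t = {..<card t}" by (simp add: card_subset_eq)
  then show ?thesis using inj by (simp add: bij_betw_def)
qed

lemma pos_order_iso:
  assumes "inj_on e t" "\<And>x y. x \<in> t \<Longrightarrow> y \<in> t \<Longrightarrow> lt' (e x) (e y) \<longleftrightarrow> lt x y" "s \<subseteq> t" "k \<in> t"
  shows "pos lt' (e ` s) (e k) = pos lt s k"
proof -
  have "{y \<in> e ` s. lt' y (e k)} = e ` {y \<in> s. lt y k}" using assms(2,3,4) by blast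
  moreover have "inj_on e {y \<in> s. lt y k}" by (rule inj_on_subset[OF assms(1)]) (use assms(3) in auto)
  ultimately show ?thesis unfolding pos_def by (simp add: card_image)
qed

lemma finite_order_iso:
  assumes "strict_linear L lt" "finite t" "t \<subseteq> L" "strict_linear L' lt'" "finite t'" "t' \<subseteq> L'" "card t = card t'"
  obtains e where "inj_on e t" "e ` t = t'" "\<And>x y. x \<in> t \<Longrightarrow> y \<in> t \<Longrightarrow> lt' (e x) (e y) \<longleftrightarrow> lt x y"
proof -
  note b = pos_bij[OF assms(1-3)]
  note b' = pos_bij[OF assms(4-6)]
  define e where "e = inv_into t' (pos lt' t') \<circ> pos lt t"
  have be: "bij_betw e t t'"
    unfolding e_def by (rule bij_betw_trans[OF b]) (use bij_betw_inv_into[OF b'] assms(7) in simp)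
  have pe: "pos lt' t' (e x) = pos lt t x" if "x \<in> t" for x
    unfolding e_def o_def
    by (rule f_inv_into_f) (use bij_betwE[OF b] that assms(7) b' in \<open>auto simp: bij_betw_def\<close>)
  show ?thesis
  proof (rule that[of e])
    fix x y assume xy: "x \<in> t" "y \<in> t"
    then have "e x \<in> t'" "e y \<in> t'" using be by (auto simp: bij_betw_def)
    then show "lt' (e x) (e y) \<longleftrightarrow> lt x y"
      using pos_less_iff[OF assms(4-6), of "e x" "e y"] pos_less_iff[OF assms(1-3) xy] pe xy by simp
  qed (use be in \<open>auto simp: bij_betw_def\<close>)
qed

section \<open>Indiscernible systems of subobjects\<close>

text \<open>
  What a functor on finite index sets, under a fixed object and with an element chosen for each index,
  provides at one index set.
\<close>

record ('o, 'm, 'v, 'i) stage =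
  st_ob :: 'o
  st_base :: 'm
  st_map :: "'i set \<Rightarrow> 'm"
  st_elt :: "'i \<Rightarrow> 'v"

text \<open>
  The colour of \<open>u\<close> records its stage with every index replaced by its position in \<open>u\<close>, so that stages at
  different index sets can be compared. Outside the relevant positions it is \<open>undefined\<close>, which keeps
  the set of colours small.
\<close>

definition colour :: "('i \<Rightarrow> 'i \<Rightarrow> bool) \<Rightarrow> ('i set \<Rightarrow> ('o, 'm, 'v, 'i) stage) \<Rightarrow> 'i set \<Rightarrow> ('o, 'm, 'v, nat) stage"
  where "colour lt \<sigma> u = \<lparr>st_ob = st_ob (\<sigma> u), st_base = st_base (\<sigma> u),
    st_map = (\<lambda>P. if P \<subseteq> {..<card u} then st_map (\<sigma> u) (inv_into u (pos lt u) ` P) else undefined),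
    st_elt = (\<lambda>i. if i < card u then st_elt (\<sigma> u) (inv_into u (pos lt u) i) else undefined)\<rparr>"

lemma colourD:
  assumes "colour lt \<sigma> u = q" "strict_linear L lt" "finite u" "u \<subseteq> L"
  shows "st_ob (\<sigma> u) = st_ob q" "st_base (\<sigma> u) = st_base q"
    "s \<subseteq> u \<Longrightarrow> st_map (\<sigma> u) s = st_map q (pos lt u ` s)"
    "k \<in> u \<Longrightarrow> st_elt (\<sigma> u) k = st_elt q (pos lt u k)"
proof -
  note b = pos_bij[OF assms(2-4)]
  then have inj: "inj_on (pos lt u) u" and im: "pos lt u ` u = {..<card u}" by (auto simp: bij_betw_def)
  show "st_ob (\<sigma> u) = st_ob q" "st_base (\<sigma> u) = st_base q" using assms(1) by (auto simp: colour_def)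
  show "st_map (\<sigma> u) s = st_map q (pos lt u ` s)" if "s \<subseteq> u"
  proof -
    have "inv_into u (pos lt u) ` pos lt u ` s = s" using inv_into_image_cancel[OF inj that] .
    moreover have "pos lt u ` s \<subseteq> {..<card u}" using im that by blast
    ultimately show ?thesis using assms(1) by (auto simp: colour_def)
  qed
  show "st_elt (\<sigma> u) k = st_elt q (pos lt u k)" if "k \<in> u"
  proof -
    have "pos lt u k < card u" using im that by blast
    then show ?thesis using assms(1) inj that by (auto simp: colour_def)
  qed
qed

text \<open>The stage at \<open>u\<close> that has the colour prescribed by the template \<open>q\<close> for sets of the size of \<open>u\<close>.\<close>

definition template_stage ::
    "('i \<Rightarrow> 'i \<Rightarrow> bool) \<Rightarrow> (nat \<Rightarrow> ('o, 'm, 'v, nat) stage) \<Rightarrow> 'i set \<Rightarrow> ('o, 'm, 'v, 'i) stage" where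
  "template_stage lt q u = \<lparr>st_ob = st_ob (q (card u)), st_base = st_base (q (card u)),
     st_map = (\<lambda>s. st_map (q (card u)) (pos lt u ` s)),
     st_elt = (\<lambda>k. st_elt (q (card u)) (pos lt u k))\<rparr>"

context concrete_category_at begin

text \<open>
  Systems are functors on the finite subsets of \<open>L\<close> with values in \<open>\<A>\<close>, under \<open>X\<close>, with a compatible family
  of distinct elements indexed by \<open>L\<close>. The conditions are collected at each finite \<open>u\<close>, where they involve
  only subsets of \<open>u\<close>.
\<close>

definition system_at :: "'o \<Rightarrow> 'o set \<Rightarrow> ('i set \<Rightarrow> ('o, 'm, 'v, 'i) stage) \<Rightarrow> 'i set \<Rightarrow> bool" where
  "system_at X \<A> \<sigma> u \<longleftrightarrow> st_ob (\<sigma> u) \<in> \<A> \<and> st_base (\<sigma> u) \<in> hom K X (st_ob (\<sigma> u)) \<and>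
     st_map (\<sigma> u) u = Id K (st_ob (\<sigma> u)) \<and>
     (\<forall>k\<in>u. st_elt (\<sigma> u) k \<in> \<bar>st_ob (\<sigma> u)\<bar>\<^sub>U) \<and> inj_on (st_elt (\<sigma> u)) u \<and>
     (\<forall>t\<subseteq>u. st_map (\<sigma> u) t \<in> hom K (st_ob (\<sigma> t)) (st_ob (\<sigma> u)) \<and>
        st_map (\<sigma> u) t \<cdot> st_base (\<sigma> t) = st_base (\<sigma> u) \<and>
        (\<forall>k\<in>t. fn (st_map (\<sigma> u) t) (st_elt (\<sigma> t) k) = st_elt (\<sigma> u) k) \<and>
        (\<forall>s\<subseteq>t. st_map (\<sigma> u) s = st_map (\<sigma> u) t \<cdot> st_map (\<sigma> t) s))"

definition is_system :: "'o \<Rightarrow> 'o set \<Rightarrow> 'i set \<Rightarrow> ('i set \<Rightarrow> ('o, 'm, 'v, 'i) stage) \<Rightarrow> bool" where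
  "is_system X \<A> L \<sigma> \<longleftrightarrow> (\<forall>u. finite u \<and> u \<subseteq> L \<longrightarrow> system_at X \<A> \<sigma> u)"

lemma system_atD:
  assumes "system_at X \<A> \<sigma> u"
  shows "st_ob (\<sigma> u) \<in> \<A>" "st_base (\<sigma> u) \<in> hom K X (st_ob (\<sigma> u))"
    "st_map (\<sigma> u) u = Id K (st_ob (\<sigma> u))"
    "k \<in> u \<Longrightarrow> st_elt (\<sigma> u) k \<in> \<bar>st_ob (\<sigma> u)\<bar>\<^sub>U" "inj_on (st_elt (\<sigma> u)) u"
    "t \<subseteq> u \<Longrightarrow> st_map (\<sigma> u) t \<in> hom K (st_ob (\<sigma> t)) (st_ob (\<sigma> u))"
    "t \<subseteq> u \<Longrightarrow> st_map (\<sigma> u) t \<cdot> st_base (\<sigma> t) = st_base (\<sigma> u)"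
    "t \<subseteq> u \<Longrightarrow> k \<in> t \<Longrightarrow> fn (st_map (\<sigma> u) t) (st_elt (\<sigma> t) k) = st_elt (\<sigma> u) k"
    "t \<subseteq> u \<Longrightarrow> s \<subseteq> t \<Longrightarrow> st_map (\<sigma> u) s = st_map (\<sigma> u) t \<cdot> st_map (\<sigma> t) s"
proof -
  note h = assms[unfolded system_at_def]
  note h6 = h[THEN conjunct2, THEN conjunct2, THEN conjunct2, THEN conjunct2, THEN conjunct2, rule_format]
  show "st_ob (\<sigma> u) \<in> \<A>" "st_base (\<sigma> u) \<in> hom K X (st_ob (\<sigma> u))"
    "st_map (\<sigma> u) u = Id K (st_ob (\<sigma> u))" "inj_on (st_elt (\<sigma> u)) u"
    by (rule h[THEN conjunct1], rule h[THEN conjunct2, THEN conjunct1],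
        rule h[THEN conjunct2, THEN conjunct2, THEN conjunct1],
        rule h[THEN conjunct2, THEN conjunct2, THEN conjunct2, THEN conjunct2, THEN conjunct1])
  show "k \<in> u \<Longrightarrow> st_elt (\<sigma> u) k \<in> \<bar>st_ob (\<sigma> u)\<bar>\<^sub>U"
    by (rule h[THEN conjunct2, THEN conjunct2, THEN conjunct2, THEN conjunct1, rule_format])
  show "t \<subseteq> u \<Longrightarrow> st_map (\<sigma> u) t \<in> hom K (st_ob (\<sigma> t)) (st_ob (\<sigma> u))"
    by (rule h6[THEN conjunct1])
  show "t \<subseteq> u \<Longrightarrow> st_map (\<sigma> u) t \<cdot> st_base (\<sigma> t) = st_base (\<sigma> u)"
    by (rule h6[THEN conjunct2, THEN conjunct1])
  show "t \<subseteq> u \<Longrightarrow> k \<in> t \<Longrightarrow> fn (st_map (\<sigma> u) t) (st_elt (\<sigma> t) k) = st_elt (\<sigma> u) k"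
    by (rule h6[THEN conjunct2, THEN conjunct2, THEN conjunct1, rule_format])
  show "t \<subseteq> u \<Longrightarrow> s \<subseteq> t \<Longrightarrow> st_map (\<sigma> u) s = st_map (\<sigma> u) t \<cdot> st_map (\<sigma> t) s"
    by (rule h6[THEN conjunct2, THEN conjunct2, THEN conjunct2, rule_format])
qed

lemma system_atI:
  assumes "st_ob (\<sigma> u) \<in> \<A>" "st_base (\<sigma> u) \<in> hom K X (st_ob (\<sigma> u))"
    "st_map (\<sigma> u) u = Id K (st_ob (\<sigma> u))"
    "\<And>k. k \<in> u \<Longrightarrow> st_elt (\<sigma> u) k \<in> \<bar>st_ob (\<sigma> u)\<bar>\<^sub>U" "inj_on (st_elt (\<sigma> u)) u"
    "\<And>t. t \<subseteq> u \<Longrightarrow> st_map (\<sigma> u) t \<in> hom K (st_ob (\<sigma> t)) (st_ob (\<sigma> u))"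
    "\<And>t. t \<subseteq> u \<Longrightarrow> st_map (\<sigma> u) t \<cdot> st_base (\<sigma> t) = st_base (\<sigma> u)"
    "\<And>t k. t \<subseteq> u \<Longrightarrow> k \<in> t \<Longrightarrow> fn (st_map (\<sigma> u) t) (st_elt (\<sigma> t) k) = st_elt (\<sigma> u) k"
    "\<And>s t. t \<subseteq> u \<Longrightarrow> s \<subseteq> t \<Longrightarrow> st_map (\<sigma> u) s = st_map (\<sigma> u) t \<cdot> st_map (\<sigma> t) s"
  shows "system_at X \<A> \<sigma> u"
  unfolding system_at_def by (intro conjI ballI allI impI assms) assumption+

text \<open>
  A set \<open>a ` S\<close> of elements of an extension \<open>N\<close> of \<open>X\<close> yields a system over \<open>S\<close>. In a presentation of \<open>N\<close>, to each
  finite \<open>s \<subseteq> S\<close> an index is assigned, monotonically, whose object contains \<open>a ` s\<close> and through which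
  \<open>X \<rightarrow> N\<close> factors.
\<close>

lemma system_in_extension:
  assumes X: "presentable \<Omega> \<nu> K X" and f: "f \<in> hom K X N"
    and I: "directed_on \<nu> I r" "|I| <o \<Omega>" "diagram K I r D d" "colimit K I r D d N c"
    and a: "inj_on a S" "a ` S \<subseteq> \<bar>N\<bar>\<^sub>U"
  shows "\<exists>\<sigma>. is_system X (D ` I) S \<sigma>"
proof -
  note c = coconeD[OF colimit_cocone[OF I(4)]]
  note D = diagramD[OF I(3)]
  note ord = directed_on_order[OF I(1)]
  obtain i0 x0 where i0: "i0 \<in> I" "x0 \<in> hom K X (D i0)" "c i0 \<cdot> x0 = f"
    by (rule presentable_factor[OF X I f])
  have "\<exists>i. i \<in> I \<and> (i0, i) \<in> r \<and> a ` s \<subseteq> fn (c i) ` \<bar>D i\<bar>\<^sub>U" if "finite s" "s \<subseteq> S" for s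
  proof -
    have "|a ` s| <o \<nu>" by (rule finite_ordLess_Cinfinite[OF _ \<nu>_infinite]) (use that in simp)
    moreover have "a ` s \<subseteq> \<bar>N\<bar>\<^sub>U" using a(2) that by blast
    ultimately obtain i where "i \<in> I" "(i0, i) \<in> r" "a ` s \<subseteq> fn (c i) ` \<bar>D i\<bar>\<^sub>U"
      using index_capturing[OF I _ _ i0(1)] by metis
    then show ?thesis by blast
  qed
  then obtain g where g: "\<And>s. finite s \<Longrightarrow> s \<subseteq> S \<Longrightarrow> g s \<in> I"
    "\<And>s. finite s \<Longrightarrow> s \<subseteq> S \<Longrightarrow> (i0, g s) \<in> r"
    "\<And>s. finite s \<Longrightarrow> s \<subseteq> S \<Longrightarrow> a ` s \<subseteq> fn (c (g s)) ` \<bar>D (g s)\<bar>\<^sub>U" by metis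
  have dir: "directed_on natLeq I r" by (rule directed_on_mono[OF I(1) natLeq_ordLeq_Cinfinite[OF \<nu>_infinite]])
  obtain h where h: "\<And>s. finite s \<Longrightarrow> s \<subseteq> S \<Longrightarrow> h s \<in> I \<and> (g s, h s) \<in> r"
    "\<And>s t. finite t \<Longrightarrow> t \<subseteq> S \<Longrightarrow> s \<subseteq> t \<Longrightarrow> (h s, h t) \<in> r"
    by (rule monotone_choice_on_finite_subsets[OF dir, where S = S and g = g, OF g(1)]) auto
  define b where "b s k = inv_into \<bar>D (h s)\<bar>\<^sub>U (fn (c (h s))) (a k)" for s k
  define \<sigma> where "\<sigma> u = \<lparr>st_ob = D (h u), st_base = d i0 (h u) \<cdot> x0, st_map = (\<lambda>s. d (h s) (h u)), st_elt = b u\<rparr>" for u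
  have b: "b u k \<in> \<bar>D (h u)\<bar>\<^sub>U" "fn (c (h u)) (b u k) = a k" if u: "finite u" "u \<subseteq> S" and k: "k \<in> u" for u k
  proof -
    have gh: "(g u, h u) \<in> r" "h u \<in> I" using h(1)[OF u] by auto
    obtain y where y: "y \<in> \<bar>D (g u)\<bar>\<^sub>U" "a k = fn (c (g u)) y" using g(3)[OF u] k by blast
    have "a k = fn (c (h u)) (fn (d (g u) (h u)) y)"
      using U_comp[OF D(2)[OF gh(1)] c(2)[OF gh(2)] y(1)] c(3)[OF gh(1)] y(2) by simp
    then have "a k \<in> fn (c (h u)) ` \<bar>D (h u)\<bar>\<^sub>U" using U_in[OF D(2)[OF gh(1)] y(1)] by blast
    then show "b u k \<in> \<bar>D (h u)\<bar>\<^sub>U" "fn (c (h u)) (b u k) = a k"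
      unfolding b_def by (rule inv_into_into, rule f_inv_into_f)
  qed
  have "system_at X (D ` I) \<sigma> u" if u: "finite u" "u \<subseteq> S" for u
  proof (rule system_atI)
    have i0h: "(i0, h v) \<in> r" if "v \<subseteq> u" for v
    proof -
      have "finite v" "v \<subseteq> S" using that u finite_subset by auto
      then show ?thesis using g(2) h(1) ord(3) by blast
    qed
    have hI: "h u \<in> I" using h(1)[OF u] by blast
    show "st_ob (\<sigma> u) \<in> D ` I" using hI by (simp add: \<sigma>_def)
    show "st_base (\<sigma> u) \<in> hom K X (st_ob (\<sigma> u))"
      using Comp_in_hom[OF i0(2) D(2)[OF i0h]] by (simp add: \<sigma>_def)
    show "st_map (\<sigma> u) u = Id K (st_ob (\<sigma> u))" using D(3)[OF hI] by (simp add: \<sigma>_def)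
    show "st_elt (\<sigma> u) k \<in> \<bar>st_ob (\<sigma> u)\<bar>\<^sub>U" if "k \<in> u" for k using b(1)[OF u that] by (simp add: \<sigma>_def)
    show "inj_on (st_elt (\<sigma> u)) u"
    proof (rule inj_onI)
      fix k l assume kl: "k \<in> u" "l \<in> u" "st_elt (\<sigma> u) k = st_elt (\<sigma> u) l"
      then have "a k = a l" using b(2)[OF u kl(1)] b(2)[OF u kl(2)] by (simp add: \<sigma>_def)
      then show "k = l" using a(1) kl u(2) by (auto dest: inj_onD)
    qed
    fix t assume t: "t \<subseteq> u"
    have ft: "finite t" "t \<subseteq> S" using t u finite_subset by auto
    note tu = h(2)[OF u t]
    show mtu: "st_map (\<sigma> u) t \<in> hom K (st_ob (\<sigma> t)) (st_ob (\<sigma> u))" using D(2)[OF tu] by (simp add: \<sigma>_def)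
    show "st_map (\<sigma> u) t \<cdot> st_base (\<sigma> t) = st_base (\<sigma> u)"
      using Comp_assoc[OF i0(2) D(2)[OF i0h[OF t]] D(2)[OF tu]] D(4)[OF i0h[OF t] tu] by (simp add: \<sigma>_def)
    show "fn (st_map (\<sigma> u) t) (st_elt (\<sigma> t) k) = st_elt (\<sigma> u) k" if k: "k \<in> t" for k
    proof -
      have ku: "k \<in> u" using k t by blast
      have "fn (c (h u)) (fn (d (h t) (h u)) (b t k)) = a k"
        using U_comp[OF D(2)[OF tu] c(2)[OF hI] b(1)[OF ft k]] c(3)[OF tu] b(2)[OF ft k] by simp
      then have "fn (d (h t) (h u)) (b t k) = b u k"
        using U_inj[OF c(2)[OF hI] U_in[OF D(2)[OF tu] b(1)[OF ft k]] b(1)[OF u ku]] b(2)[OF u ku] by simp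
      then show ?thesis by (simp add: \<sigma>_def)
    qed
    show "st_map (\<sigma> u) s = st_map (\<sigma> u) t \<cdot> st_map (\<sigma> t) s" if s: "s \<subseteq> t" for s
      using D(4)[OF h(2)[OF ft s] tu] by (simp add: \<sigma>_def)
  qed
  then show ?thesis unfolding is_system_def by blast
qed

text \<open>Being a system is a condition on finite index sets, hence invariant under finite relabelling.\<close>

lemma system_at_relabel:
  assumes e: "inj_on e u"
    and eq: "\<And>t. t \<subseteq> u \<Longrightarrow> st_ob (\<sigma>' t) = st_ob (\<sigma> (e ` t))" "\<And>t. t \<subseteq> u \<Longrightarrow> st_base (\<sigma>' t) = st_base (\<sigma> (e ` t))"
      "\<And>s t. t \<subseteq> u \<Longrightarrow> s \<subseteq> t \<Longrightarrow> st_map (\<sigma>' t) s = st_map (\<sigma> (e ` t)) (e ` s)"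
      "\<And>k t. t \<subseteq> u \<Longrightarrow> k \<in> t \<Longrightarrow> st_elt (\<sigma>' t) k = st_elt (\<sigma> (e ` t)) (e k)"
    and sys: "system_at X \<A> \<sigma> (e ` u)"
  shows "system_at X \<A> \<sigma>' u"
proof (rule system_atI)
  note S = system_atD[OF sys]
  show "st_ob (\<sigma>' u) \<in> \<A>" "st_base (\<sigma>' u) \<in> hom K X (st_ob (\<sigma>' u))"
    "st_map (\<sigma>' u) u = Id K (st_ob (\<sigma>' u))" using S(1-3) by (simp_all add: eq)
  show "st_elt (\<sigma>' u) k \<in> \<bar>st_ob (\<sigma>' u)\<bar>\<^sub>U" if "k \<in> u" for k using S(4) that by (simp add: eq)
  show "inj_on (st_elt (\<sigma>' u)) u"
  proof (rule inj_onI)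
    fix k l assume kl: "k \<in> u" "l \<in> u" "st_elt (\<sigma>' u) k = st_elt (\<sigma>' u) l"
    then have "e k = e l" using inj_onD[OF S(5), of "e k" "e l"] by (simp add: eq)
    then show "k = l" using e kl by (auto dest: inj_onD)
  qed
  fix t assume t: "t \<subseteq> u"
  then have et: "e ` t \<subseteq> e ` u" by blast
  show "st_map (\<sigma>' u) t \<in> hom K (st_ob (\<sigma>' t)) (st_ob (\<sigma>' u))" using S(6)[OF et] t by (simp add: eq)
  show "st_map (\<sigma>' u) t \<cdot> st_base (\<sigma>' t) = st_base (\<sigma>' u)" using S(7)[OF et] t by (simp add: eq)
  show "fn (st_map (\<sigma>' u) t) (st_elt (\<sigma>' t) k) = st_elt (\<sigma>' u) k" if "k \<in> t" for k
  proof -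
    have "k \<in> u" using that t by blast
    then show ?thesis using S(8)[OF et, of "e k"] t that by (simp add: eq)
  qed
  show "st_map (\<sigma>' u) s = st_map (\<sigma>' u) t \<cdot> st_map (\<sigma>' t) s" if "s \<subseteq> t" for s
  proof -
    have "s \<subseteq> u" using that t by blast
    moreover have "e ` s \<subseteq> e ` t" using that by blast
    ultimately show ?thesis using S(9)[OF et, of "e ` s"] t that by (simp add: eq)
  qed
qed

lemma small_colours:
  fixes lt :: "'i \<Rightarrow> 'i \<Rightarrow> bool"
  assumes \<A>: "|\<A>| <o \<Omega>" "\<A> \<subseteq> Ob K" and X: "X \<in> Ob K" and lt: "strict_linear UNIV lt"
  shows "\<exists>\<C>. |\<C>| <o \<Omega> \<and> (\<forall>u \<sigma>. finite u \<and> card u = n \<and> system_at X \<A> \<sigma> u \<and>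
    (\<forall>t\<subseteq>u. st_ob (\<sigma> t) \<in> \<A>) \<longrightarrow> colour lt \<sigma> u \<in> \<C>)"
proof -
  define M where "M = (\<Union>A\<in>insert X \<A>. \<Union>B\<in>insert X \<A>. hom K A B)"
  have M: "|M| <o \<Omega>" unfolding M_def
    by (intro small_UN small_insert small_hom) (use \<A> X in auto)
  define V where "V = (\<Union>A\<in>\<A>. \<bar>A\<bar>\<^sub>U)"
  have V: "|V| <o \<Omega>" unfolding V_def by (rule small_UN[OF \<A>(1) U_small]) (use \<A>(2) in auto)
  define Q where "Q = \<A> \<times> M \<times> Func (Pow {..<n}) M \<times> Func {..<n} V"
  have Q: "|Q| <o \<Omega>" unfolding Q_def
    by (intro small_Times small_Func \<A>(1) M V small_finite) auto
  let ?mk = "\<lambda>(A, x, m, b). \<lparr>st_ob = A, st_base = x, st_map = m, st_elt = b\<rparr>"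
  show ?thesis
  proof (rule exI[of _ "?mk ` Q"], intro conjI allI impI)
    show "|?mk ` Q| <o \<Omega>" by (rule card_ordLess_image[OF Q])
    fix u and \<sigma> :: "'i set \<Rightarrow> ('o, 'm, 'v, 'i) stage"
    assume *: "finite u \<and> card u = n \<and> system_at X \<A> \<sigma> u \<and> (\<forall>t\<subseteq>u. st_ob (\<sigma> t) \<in> \<A>)"
    then have u: "finite u" "card u = n" and sys: "system_at X \<A> \<sigma> u"
      by (simp_all only: simp_thms)
    have ob: "\<And>t. t \<subseteq> u \<Longrightarrow> st_ob (\<sigma> t) \<in> \<A>"
      by (rule *[THEN conjunct2, THEN conjunct2, THEN conjunct2, rule_format])
    note S = system_atD[OF sys]
    have im: "pos lt u ` u = {..<n}" using pos_bij[OF lt u(1)] u(2) by (simp add: bij_betw_def)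
    have e: "inv_into u (pos lt u) i \<in> u" if "i < n" for i
      by (rule inv_into_into) (use im that in simp)
    have 1: "(\<lambda>P. if P \<subseteq> {..<n} then st_map (\<sigma> u) (inv_into u (pos lt u) ` P) else undefined) \<in> Func (Pow {..<n}) M"
    proof -
      have "st_map (\<sigma> u) (inv_into u (pos lt u) ` P) \<in> M" if "P \<subseteq> {..<n}" for P
      proof -
        have sub: "inv_into u (pos lt u) ` P \<subseteq> u" using e that by auto
        show ?thesis unfolding M_def using S(6)[OF sub] ob[OF sub] S(1) by blast
      qed
      then show ?thesis by (simp add: Func_def)
    qed
    have 2: "(\<lambda>i. if i < n then st_elt (\<sigma> u) (inv_into u (pos lt u) i) else undefined) \<in> Func {..<n} V"
      using S(1,4) e by (auto simp: Func_def V_def)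
    have 3: "st_base (\<sigma> u) \<in> M" using S(1,2) unfolding M_def by blast
    have "colour lt \<sigma> u = ?mk (st_ob (\<sigma> u), st_base (\<sigma> u),
      (\<lambda>P. if P \<subseteq> {..<n} then st_map (\<sigma> u) (inv_into u (pos lt u) ` P) else undefined),
      (\<lambda>i. if i < n then st_elt (\<sigma> u) (inv_into u (pos lt u) i) else undefined))"
      by (simp add: colour_def u(2))
    then show "colour lt \<sigma> u \<in> ?mk ` Q" unfolding Q_def using 1 2 3 S(1) by blast
  qed
qed

text \<open>That systems which follow the template \<open>q\<close> below \<open>n\<close> are arbitrarily large is expressed by comparison with every small set.\<close>

definition realized :: "('v \<Rightarrow> 'v \<Rightarrow> bool) \<Rightarrow> 'o \<Rightarrow> 'o set \<Rightarrow> nat \<Rightarrow> (nat \<Rightarrow> ('o, 'm, 'v, nat) stage) \<Rightarrow> bool" where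
  "realized lt X \<A> n q \<longleftrightarrow> (\<forall>A :: 'v set. |A| <o \<Omega> \<longrightarrow>
     (\<exists>S \<sigma>. |A| \<le>o |S| \<and> is_system X \<A> S \<sigma> \<and>
        (\<forall>k<n. \<forall>u. u \<subseteq> S \<and> finite u \<and> card u = k \<longrightarrow> colour lt \<sigma> u = q k)))"

lemma realized_cong:
  assumes q: "realized lt X \<A> n q" and eq: "\<And>k. k < n \<Longrightarrow> q k = q' k"
  shows "realized lt X \<A> n q'"
  unfolding realized_def
proof (intro allI impI)
  fix A :: "'v set" assume A: "|A| <o \<Omega>"
  obtain S \<sigma> where S: "|A| \<le>o |S|" "is_system X \<A> S \<sigma>"
    "\<forall>k<n. \<forall>u. u \<subseteq> S \<and> finite u \<and> card u = k \<longrightarrow> colour lt \<sigma> u = q k"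
    using q[unfolded realized_def, rule_format, OF A] by (elim exE conjE)
  then have "\<forall>k<n. \<forall>u. u \<subseteq> S \<and> finite u \<and> card u = k \<longrightarrow> colour lt \<sigma> u = q' k"
    using eq by simp
  then show "\<exists>S \<sigma>. |A| \<le>o |S| \<and> is_system X \<A> S \<sigma> \<and>
        (\<forall>k<n. \<forall>u. u \<subseteq> S \<and> finite u \<and> card u = k \<longrightarrow> colour lt \<sigma> u = q' k)"
    using S(1,2) by (intro exI[of _ S] exI[of _ \<sigma>] conjI)
qed

text \<open>
  If arbitrarily large systems have colours \<open>q\<close> on index sets of size below \<open>n\<close>, the partition theorem
  makes the colours of the index sets of size \<open>n\<close> constant as well; as there is only a small set of
  colours, one of them occurs for arbitrarily large systems.
\<close>

lemma realized_extend:
  assumes \<A>: "|\<A>| <o \<Omega>" "\<A> \<subseteq> Ob K" and X: "X \<in> Ob K" and lt: "strict_linear UNIV lt"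
    and q: "realized lt X \<A> n q"
  shows "\<exists>p. realized lt X \<A> (Suc n) (q(n := p))"
proof (rule ccontr)
  assume "\<not> ?thesis"
  then have "\<forall>p. \<exists>A :: 'v set. |A| <o \<Omega> \<and> \<not> (\<exists>S \<sigma>. |A| \<le>o |S| \<and> is_system X \<A> S \<sigma> \<and>
        (\<forall>k<Suc n. \<forall>u. u \<subseteq> S \<and> finite u \<and> card u = k \<longrightarrow> colour lt \<sigma> u = (q(n := p)) k))"
    unfolding realized_def by simp
  from choice[OF this] obtain bad :: "_ \<Rightarrow> 'v set" where bad: "\<And>p. |bad p| <o \<Omega>"
    "\<And>p. \<not> (\<exists>S \<sigma>. |bad p| \<le>o |S| \<and> is_system X \<A> S \<sigma> \<and>
        (\<forall>k<Suc n. \<forall>u. u \<subseteq> S \<and> finite u \<and> card u = k \<longrightarrow> colour lt \<sigma> u = (q(n := p)) k))"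
    by blast
  obtain \<C> where \<C>: "|\<C>| <o \<Omega>"
    "\<forall>u \<sigma>. finite u \<and> card u = n \<and> system_at X \<A> \<sigma> u \<and>
      (\<forall>t\<subseteq>u. st_ob (\<sigma> t) \<in> \<A>) \<longrightarrow> colour lt \<sigma> u \<in> \<C>"
    using small_colours[OF \<A> X lt, of n] by (elim exE conjE)
  have sbad: "|\<Union>p\<in>\<C>. bad p| <o \<Omega>" by (rule small_UN[OF \<C>(1) bad(1)])
  obtain A :: "'v set" where A: "|A| <o \<Omega>" "|\<Union>p\<in>\<C>. bad p| \<le>o |A|" "infinite A"
    by (rule small_card_infinite_set[OF sbad])
  \<comment> \<open>The extra colour is for the sets that are not coloured by \<open>\<sigma>\<close>.\<close>
  define \<C>' where "\<C>' = insert undefined \<C>"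
  have "|\<C>'| <o \<Omega>" unfolding \<C>'_def by (rule small_insert[OF \<C>(1)])
  from erdos_rado[OF this A(1), of n] obtain B :: "'v set" where B: "|B| <o \<Omega>"
    "\<forall>(S :: 'v set) f. |B| \<le>o |S| \<longrightarrow> (\<forall>s. f s \<in> \<C>') \<longrightarrow>
    (\<exists>H q. H \<subseteq> S \<and> |A| \<le>o |H| \<and> (\<forall>s. s \<subseteq> H \<and> finite s \<and> card s = n \<longrightarrow> f s = q))"
    by (elim exE conjE)
  obtain S \<sigma> where S: "|B| \<le>o |S|" "is_system X \<A> S \<sigma>"
    "\<forall>k<n. \<forall>u. u \<subseteq> S \<and> finite u \<and> card u = k \<longrightarrow> colour lt \<sigma> u = q k"
    using q[unfolded realized_def, rule_format, OF B(1)] by (elim exE conjE)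
  define f where "f s = (if s \<subseteq> S \<and> finite s \<and> card s = n then colour lt \<sigma> s else undefined)" for s
  have fC: "f s \<in> \<C>" if s: "s \<subseteq> S" "finite s" "card s = n" for s
  proof -
    have sys: "system_at X \<A> \<sigma> t" if "t \<subseteq> s" for t
      using S(2) that s finite_subset[OF that] unfolding is_system_def by blast
    have "colour lt \<sigma> s \<in> \<C>"
      by (rule \<C>(2)[rule_format]) (use s sys system_atD(1)[OF sys] in simp)
    then show ?thesis using s by (simp add: f_def)
  qed
  then have "\<forall>s. f s \<in> \<C>'" by (auto simp: \<C>'_def f_def)
  from B(2)[rule_format, OF S(1), of f, OF spec[OF this]] obtain H p where
    H: "H \<subseteq> S" "|A| \<le>o |H|" "\<forall>s. s \<subseteq> H \<and> finite s \<and> card s = n \<longrightarrow> f s = p" by (elim exE conjE)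
  have "infinite H" using A(3) card_of_ordLeq_infinite[OF H(2)] by blast
  then obtain s where s: "s \<subseteq> H" "finite s" "card s = n" using infinite_arbitrarily_large by blast
  have "p \<in> \<C>" using fC[of s] H s by blast
  then have "|bad p| \<le>o |H|"
    using ordLeq_transitive[OF card_of_mono1 ordLeq_transitive[OF A(2) H(2)]] by (meson UN_upper)
  moreover have "is_system X \<A> H \<sigma>" using S(2) H(1) unfolding is_system_def by blast
  moreover have "colour lt \<sigma> u = (q(n := p)) k" if "k < Suc n" "u \<subseteq> H" "finite u" "card u = k" for k u
  proof (cases "k = n")
    case True
    have "f u = p" using H(3) that True by blast
    then show ?thesis using that True H(1) by (auto simp: f_def)
  next
    case False
    then show ?thesis using S(3) that H(1) by auto
  qed
  ultimately show False using bad(2)[of p] by blast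
qed

text \<open>
  The template is chosen one level at a time. The homogeneous systems change from level to level; only
  the colours are kept.
\<close>

lemma template_exists:
  assumes \<A>: "|\<A>| <o \<Omega>" "\<A> \<subseteq> Ob K" and X: "X \<in> Ob K" and lt: "strict_linear UNIV lt"
    and large: "\<And>S :: 'v set. |S| <o \<Omega> \<Longrightarrow> \<exists>\<sigma>. is_system X \<A> S \<sigma>"
  obtains q where "\<And>n. realized lt X \<A> n q"
proof -
  have "realized lt X \<A> 0 q" for q
    unfolding realized_def
  proof (intro allI impI)
    fix A :: "'v set" assume "|A| <o \<Omega>"
    then obtain \<sigma> where "is_system X \<A> A \<sigma>" using large by blast
    then show "\<exists>S \<sigma>. |A| \<le>o |S| \<and> is_system X \<A> S \<sigma> \<and>
        (\<forall>k<0. \<forall>u. u \<subseteq> S \<and> finite u \<and> card u = k \<longrightarrow> colour lt \<sigma> u = q k)"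
      by (intro exI[of _ A] exI[of _ \<sigma>]) (simp add: ordLeq_refl[OF card_of_Card_order])
  qed
  then have "\<exists>q. \<forall>n. realized lt X \<A> n (q n) \<and> (\<forall>k<n. q (Suc n) k = q n k)"
  proof (intro dependent_nat_choice)
    fix q n assume "realized lt X \<A> n q"
    then obtain p where "realized lt X \<A> (Suc n) (q(n := p))"
      using realized_extend[OF \<A> X lt] by blast
    then show "\<exists>q'. realized lt X \<A> (Suc n) q' \<and> (\<forall>k<n. q' k = q k)"
      by (intro exI[of _ "q(n := p)"]) simp
  qed blast
  then obtain q where q: "\<And>n. realized lt X \<A> n (q n)" "\<And>n k. k < n \<Longrightarrow> q (Suc n) k = q n k" by blast
  have "q n k = q (Suc k) k" if "k < n" for n k
    using that
  proof (induction n)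
    case (Suc n)
    then show ?case using q(2)[of k n] by (cases "k = n") auto
  qed simp
  then have "realized lt X \<A> n (\<lambda>k. q (Suc k) k)" for n
    by (rule realized_cong[OF q(1)])
  then show ?thesis by (rule that)
qed

text \<open>
  The colours found on ever larger finite index sets define a system over an arbitrary linear order:
  each condition on it concerns a finite index set, which can be relabelled into one of the systems
  that have these colours.
\<close>

lemma template_system:
  assumes lt: "strict_linear UNIV lt" and q: "\<And>n. realized lt X \<A> n q" and L: "strict_linear L lt'"
  shows "is_system X \<A> L (template_stage lt' q)"
  unfolding is_system_def
proof (intro allI impI)
  fix u assume "finite u \<and> u \<subseteq> L"
  then have u: "finite u" "u \<subseteq> L" by auto
  obtain A :: "'v set" where A: "|A| <o \<Omega>" "infinite A"
    by (rule small_card_infinite_set[OF small_finite[of "{} :: 'v set"]]) auto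
  obtain S \<sigma> where S: "|A| \<le>o |S|" "is_system X \<A> S \<sigma>"
    "\<forall>k<Suc (card u). \<forall>v. v \<subseteq> S \<and> finite v \<and> card v = k \<longrightarrow> colour lt \<sigma> v = q k"
    using q[of "Suc (card u)", unfolded realized_def, rule_format, OF A(1)] by (elim exE conjE)
  have "infinite S" using A(2) card_of_ordLeq_infinite[OF S(1)] by blast
  then obtain v where v: "v \<subseteq> S" "finite v" "card v = card u" using infinite_arbitrarily_large by blast
  obtain e where e: "inj_on e u" "e ` u = v" "\<And>x y. x \<in> u \<Longrightarrow> y \<in> u \<Longrightarrow> lt (e x) (e y) \<longleftrightarrow> lt' x y"
    by (rule finite_order_iso[OF L u lt v(2) subset_UNIV v(3)[symmetric]]) auto
  have col: "colour lt \<sigma> (e ` t) = q (card t)" "finite (e ` t)" if "t \<subseteq> u" for t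
  proof -
    have "card (e ` t) = card t" using inj_on_subset[OF e(1) that] by (rule card_image)
    moreover have "card t \<le> card u" using card_mono[OF u(1) that] .
    moreover have "e ` t \<subseteq> S" using that e(2) v(1) by blast
    moreover show "finite (e ` t)" using finite_subset[OF that u(1)] by simp
    ultimately show "colour lt \<sigma> (e ` t) = q (card t)" using S(3) by simp
  qed
  have iso: "pos lt (e ` t) (e k) = pos lt' t k" if "t \<subseteq> u" "k \<in> t" for t k
    by (rule pos_order_iso[where t = u]) (use e that in auto)
  have sys: "system_at X \<A> \<sigma> (e ` u)" using S(2) e(2) v unfolding is_system_def by blast
  show "system_at X \<A> (template_stage lt' q) u"
  proof (rule system_at_relabel[OF e(1) _ _ _ _ sys])
    fix t assume t: "t \<subseteq> u"
    note c = colourD[OF col(1)[OF t] lt col(2)[OF t] subset_UNIV]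
    show "st_ob (template_stage lt' q t) = st_ob (\<sigma> (e ` t))" using c(1) by (simp add: template_stage_def)
    show "st_base (template_stage lt' q t) = st_base (\<sigma> (e ` t))" using c(2) by (simp add: template_stage_def)
    show "st_map (template_stage lt' q t) s = st_map (\<sigma> (e ` t)) (e ` s)" if s: "s \<subseteq> t" for s
    proof -
      have "pos lt (e ` t) ` e ` s = pos lt' t ` s"
        unfolding image_image by (rule image_cong) (use iso[OF t] s in auto)
      then show ?thesis using c(3)[of "e ` s"] s by (simp add: template_stage_def image_mono)
    qed
    show "st_elt (template_stage lt' q t) k = st_elt (\<sigma> (e ` t)) (e k)" if k: "k \<in> t" for k
      using c(4)[of "e k"] k iso[OF t k] by (simp add: template_stage_def)
  qed
qed

text \<open>Order embeddings do not change the stages, which depend on relative positions only.\<close>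

lemma template_stage_embed:
  assumes "inj_on e L" "\<And>x y. x \<in> L \<Longrightarrow> y \<in> L \<Longrightarrow> lt' (e x) (e y) \<longleftrightarrow> lt x y" "u \<subseteq> L"
  shows "st_ob (template_stage lt' q (e ` u)) = st_ob (template_stage lt q u)"
    "st_base (template_stage lt' q (e ` u)) = st_base (template_stage lt q u)"
    "s \<subseteq> u \<Longrightarrow> st_map (template_stage lt' q (e ` u)) (e ` s) = st_map (template_stage lt q u) s"
    "k \<in> u \<Longrightarrow> st_elt (template_stage lt' q (e ` u)) (e k) = st_elt (template_stage lt q u) k"
proof -
  have inj: "inj_on e u" using inj_on_subset[OF assms(1,3)] .
  have c: "card (e ` u) = card u" by (rule card_image[OF inj])
  have iso: "pos lt' (e ` u) (e k) = pos lt u k" if "k \<in> u" for k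
    by (rule pos_order_iso[OF inj _ subset_refl that]) (use assms in blast)
  show "st_ob (template_stage lt' q (e ` u)) = st_ob (template_stage lt q u)"
    "st_base (template_stage lt' q (e ` u)) = st_base (template_stage lt q u)"
    by (simp_all add: template_stage_def c)
  show "st_map (template_stage lt' q (e ` u)) (e ` s) = st_map (template_stage lt q u) s" if "s \<subseteq> u"
  proof -
    have "pos lt' (e ` u) ` e ` s = pos lt u ` s"
      unfolding image_image by (rule image_cong) (use iso that in auto)
    then show ?thesis by (simp add: template_stage_def c)
  qed
  show "st_elt (template_stage lt' q (e ` u)) (e k) = st_elt (template_stage lt q u) k" if "k \<in> u"
    using iso[OF that] by (simp add: template_stage_def c)
qed

end

section \<open>Extensions of exact size\<close>

lemma linear_order_copy:
  obtains lt :: "'v \<Rightarrow> 'v \<Rightarrow> bool" where "strict_linear UNIV lt"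
proof -
  obtain W :: "'v rel" where "well_order_on UNIV W" using well_order_on by blast
  then have lin: "linear_order_on UNIV W" by (simp add: well_order_on_def)
  then have W: "\<And>x y z. (x, y) \<in> W \<Longrightarrow> (y, z) \<in> W \<Longrightarrow> (x, z) \<in> W"
    "\<And>x y. (x, y) \<in> W \<Longrightarrow> (y, x) \<in> W \<Longrightarrow> x = y" "\<And>x y. x \<noteq> y \<Longrightarrow> (x, y) \<in> W \<or> (y, x) \<in> W"
    unfolding linear_order_on_def partial_order_on_def preorder_on_def total_on_def
    by (blast dest: transD, blast dest: antisymD, blast)
  have "strict_linear UNIV (\<lambda>x y. (x, y) \<in> W \<and> x \<noteq> y)"
    unfolding strict_linear_def using W by metis
  then show ?thesis by (rule that)
qed

definition lex_bool :: "('a \<Rightarrow> 'a \<Rightarrow> bool) \<Rightarrow> 'a \<times> bool \<Rightarrow> 'a \<times> bool \<Rightarrow> bool" where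
  "lex_bool lt p p' \<longleftrightarrow> lt (fst p) (fst p') \<or> fst p = fst p' \<and> \<not> snd p \<and> snd p'"

lemma strict_linear_lex_bool:
  assumes "strict_linear UNIV lt" shows "strict_linear L (lex_bool lt)"
  using assms unfolding strict_linear_def lex_bool_def by (auto simp: prod_eq_iff)

lemma strict_linear_subset: "strict_linear L lt \<Longrightarrow> L' \<subseteq> L \<Longrightarrow> strict_linear L' lt"
  unfolding strict_linear_def by blast

definition Fpow_order :: "'i set \<Rightarrow> 'i set rel" where
  "Fpow_order L = {(s, t). s \<in> Fpow L \<and> t \<in> Fpow L \<and> s \<subseteq> t}"

lemma Fpow_order_iff: "(s, t) \<in> Fpow_order L \<longleftrightarrow> finite t \<and> t \<subseteq> L \<and> s \<subseteq> t"
  by (auto simp: Fpow_order_def Fpow_def intro: finite_subset)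

lemma Fpow_directed: "directed_on natLeq (Fpow L) (Fpow_order L)"
proof (rule directed_on_natLeqI)
  show "Fpow L \<noteq> {}" by (rule Fpow_not_empty)
  fix s t assume "s \<in> Fpow L" "t \<in> Fpow L"
  then have "s \<union> t \<in> Fpow L \<and> (s, s \<union> t) \<in> Fpow_order L \<and> (t, s \<union> t) \<in> Fpow_order L"
    by (auto simp: Fpow_order_def Fpow_def)
  then show "\<exists>u\<in>Fpow L. (s, u) \<in> Fpow_order L \<and> (t, u) \<in> Fpow_order L" by blast
qed (auto simp: Fpow_order_def)

lemma regular_card_ordIso:
  assumes "regular_card r" "r =o r'" shows "regular_card r'"
  using assms Cinfinite_cong regularCard_ordIso unfolding regular_card_def by blast

lemma (in universe) regular_copy:
  assumes "regular_card r" "r <o \<Omega>"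
  obtains \<rho> :: "'v rel" where "regular_card \<rho>" "\<rho> =o r" "small_card \<Omega> \<rho>"
proof -
  have r: "Card_order r" using regular_card_infinite[OF assms(1)] by blast
  have F: "|Field r| =o r" by (rule card_of_Field_ordIso[OF r])
  obtain f :: "_ \<Rightarrow> 'v" where f: "inj_on f (Field r)"
    using small_copy[OF ordIso_ordLess_trans[OF F assms(2)]] by blast
  have "|f ` Field r| =o |Field r|"
    using card_of_ordIsoI[OF inj_on_imp_bij_betw[OF f]] ordIso_symmetric by blast
  then have iso: "|f ` Field r| =o r" using F by (rule ordIso_transitive)
  show ?thesis
  proof (rule that[of "|f ` Field r|"])
    show "regular_card |f ` Field r|" by (rule regular_card_ordIso[OF assms(1) ordIso_symmetric[OF iso]])
    show "small_card \<Omega> |f ` Field r|"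
      using ordIso_ordLess_trans[OF iso assms(2)] by (simp add: small_card_def card_of_Card_order)
  qed (rule iso)
qed

text \<open>
  Large classes with amalgamation and joint embedding, at a cardinal \<open>\<mu>\<close>: the general facts at a
  regular cardinal are then used at \<open>\<mu>\<^sup>+\<close>.
\<close>

locale large_class = concrete_category \<Omega> K U \<kappa> lam
  for \<Omega> \<kappa> lam :: "'v rel" and K :: "('o, 'm) category" (structure)
    and U :: "('o, 'm, 'v) set_functor" +
  fixes \<mu> :: "'v rel"
  assumes \<mu>_card: "Card_order \<mu>" and \<mu>_small: "\<mu> <o \<Omega>" and lam_\<mu>: "lam \<le>o \<mu>" and \<kappa>_\<mu>: "\<kappa> \<le>o \<mu>"
    and K_large: "large \<Omega> K" and K_joint: "joint_embedding K" and K_amalgamation: "amalgamation K"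
begin

lemma \<mu>_infinite: "Cinfinite \<mu>"
proof -
  have "Cinfinite lam" using K_accessible by (auto simp: accessible_def regular_card_infinite)
  then show ?thesis using cinfinite_mono[OF lam_\<mu>] \<mu>_card by blast
qed

lemma \<mu>_succ_small: "cardSuc \<mu> <o \<Omega>"
  by (rule small_cardSuc[OF \<mu>_card \<mu>_small])

sublocale concrete_category_at \<Omega> \<kappa> lam K U "cardSuc \<mu>"
proof unfold_locales
  show "regular_card (cardSuc \<mu>)" by (rule regular_card_cardSuc[OF \<mu>_infinite])
  show "lam \<le>o cardSuc \<mu>" by (rule ordLeq_transitive[OF lam_\<mu> cardSuc_ordLeq[OF \<mu>_card]])
  show "\<kappa> \<le>o cardSuc \<mu>" by (rule ordLeq_transitive[OF \<kappa>_\<mu> cardSuc_ordLeq[OF \<mu>_card]])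
  show "cardSuc \<mu> <o \<Omega>" by (rule \<mu>_succ_small)
qed

lemma Field_\<mu>: "|Field \<mu>| =o \<mu>" by (rule card_of_Field_ordIso[OF \<mu>_card])

lemma small_Field_\<mu>: "|Field \<mu>| <o \<Omega>" by (rule ordIso_ordLess_trans[OF Field_\<mu> \<mu>_small])

text \<open>
  An object of size at least \<open>\<beta>\<^sup>+\<close>, with \<open>\<beta> \<ge> \<mu>\<close>, has at least \<open>\<beta>\<close> elements, since otherwise it
  would be \<open>\<beta>\<^sup>+\<close>-presentable. Joint embedding puts such an object and \<open>X\<close> into a common extension.
\<close>

lemma large_extension:
  fixes S :: "'v set"
  assumes X: "X \<in> Ob K" and S: "|S| <o \<Omega>"
  obtains N f where "f \<in> hom K X N" "|S| \<le>o |\<bar>N\<bar>\<^sub>U|"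
proof -
  let ?B = "S \<union> Field \<mu>"
  have B: "|?B| <o \<Omega>" by (rule small_Un[OF S small_Field_\<mu>])
  have "infinite (Field \<mu>)" using \<mu>_infinite by (simp add: cinfinite_def)
  then have Binf: "Cinfinite |?B|" using card_of_Card_order[of ?B] by (simp add: cinfinite_def Field_card_of)
  have \<mu>B: "\<mu> \<le>o |?B|"
    by (rule ordIso_ordLeq_trans[OF ordIso_symmetric[OF Field_\<mu>] card_of_mono1]) simp
  \<comment> \<open>Asking for size at least \<open>2\<^sup>\<beta>\<close>, where \<open>\<beta> = |S \<union> Field \<mu>|\<close>, makes the size at least \<open>\<beta>\<^sup>+\<close>.\<close>
  obtain A :: "'v set" where A: "|A| <o \<Omega>" "|Pow ?B| \<le>o |A|" by (rule small_card_infinite_set[OF small_Pow[OF B]])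
  obtain L \<sigma> where L: "L \<in> Ob K" "has_size \<Omega> K L \<sigma>" "|A| \<le>o \<sigma>"
    using K_large small_card_of[OF A(1)] unfolding large_def by blast
  have "|S| \<le>o |\<bar>L\<bar>\<^sub>U|"
  proof (rule ccontr)
    assume "\<not> |S| \<le>o |\<bar>L\<bar>\<^sub>U|"
    then have less: "|\<bar>L\<bar>\<^sub>U| <o |S|" using not_ordLeq_iff_ordLess card_of_Well_order by blast
    have Bs: "cardSuc |?B| <o \<Omega>" by (rule small_cardSuc[OF card_of_Card_order B])
    obtain \<rho> :: "'v rel" where \<rho>: "regular_card \<rho>" "\<rho> =o cardSuc |?B|" "small_card \<Omega> \<rho>"
      by (rule regular_copy[OF regular_card_cardSuc[OF Binf] Bs])
    have B\<rho>: "|?B| \<le>o \<rho>"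
      by (rule ordLeq_ordIso_trans[OF cardSuc_ordLeq[OF card_of_Card_order] ordIso_symmetric[OF \<rho>(2)]])
    interpret R: concrete_category_at \<Omega> \<kappa> lam K U \<rho>
    proof unfold_locales
      show "regular_card \<rho>" by (rule \<rho>(1))
      show "lam \<le>o \<rho>" by (rule ordLeq_transitive[OF lam_\<mu> ordLeq_transitive[OF \<mu>B B\<rho>]])
      show "\<kappa> \<le>o \<rho>" by (rule ordLeq_transitive[OF \<kappa>_\<mu> ordLeq_transitive[OF \<mu>B B\<rho>]])
      show "\<rho> <o \<Omega>" using \<rho>(3) by (simp add: small_card_def)
    qed
    have "|S| \<le>o |?B|" by (rule card_of_mono1) simp
    then have "|\<bar>L\<bar>\<^sub>U| <o \<rho>" by (rule ordLess_ordLeq_trans[OF less ordLeq_transitive[OF _ B\<rho>]])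
    then have "presentable \<Omega> \<rho> K L" by (rule R.presentable_if_few_elements[OF L(1)])
    then have \<sigma>\<rho>: "cardSuc \<sigma> \<le>o \<rho>"
      using L(2) \<rho>(1,3) unfolding has_size_def presentability_rank_def by blast
    have "cardSuc |?B| \<le>o |Pow ?B|" by (rule cardSuc_least[OF card_of_Card_order card_of_Card_order card_of_Pow])
    then have "\<rho> \<le>o \<sigma>"
      by (rule ordIso_ordLeq_trans[OF \<rho>(2) ordLeq_transitive[OF _ ordLeq_transitive[OF A(2) L(3)]]])
    then have "cardSuc \<sigma> \<le>o \<sigma>" by (rule ordLeq_transitive[OF \<sigma>\<rho>])
    moreover have "\<sigma> <o cardSuc \<sigma>"
      using L(2) cardSuc_greater unfolding has_size_def small_card_def by blast
    ultimately show False using not_ordLess_ordLeq by blast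
  qed
  moreover obtain N f g where fg: "f \<in> hom K X N" "g \<in> hom K L N"
    using K_joint X L(1) unfolding joint_embedding_def by blast
  moreover have "|\<bar>L\<bar>\<^sub>U| \<le>o |\<bar>N\<bar>\<^sub>U|"
    by (rule card_of_ordLeqI[of "fn g"]) (use U_in[OF fg(2)] U_inj[OF fg(2)] in \<open>auto intro: inj_onI\<close>)
  ultimately show ?thesis using that ordLeq_transitive by blast
qed

lemma is_systemD: "is_system X \<A> L \<sigma> \<Longrightarrow> finite u \<Longrightarrow> u \<subseteq> L \<Longrightarrow> system_at X \<A> \<sigma> u"
  by (simp add: is_system_def)

lemma system_at_mono:
  assumes "system_at X \<A> \<sigma> u" "\<A> \<subseteq> \<B>"
  shows "system_at X \<B> \<sigma> u"
  using assms(1) subsetD[OF assms(2)] unfolding system_at_def by (elim conjE) (intro conjI; assumption | blast)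

lemma system_diagram:
  assumes "is_system X \<A> L \<sigma>" "\<A> \<subseteq> Ob K"
  shows "diagram K (Fpow L) (Fpow_order L) (\<lambda>s. st_ob (\<sigma> s)) (\<lambda>s t. st_map (\<sigma> t) s)"
proof -
  note sys = is_systemD[OF assms(1)]
  show ?thesis
  proof (rule diagramI)
    fix u assume "u \<in> Fpow L"
    then have u: "finite u" "u \<subseteq> L" by (auto simp: Fpow_def)
    show "st_ob (\<sigma> u) \<in> Ob K" using system_atD(1)[OF sys[OF u]] assms(2) by blast
    show "st_map (\<sigma> u) u = Id K (st_ob (\<sigma> u))" by (rule system_atD(3)[OF sys[OF u]])
  next
    fix t u assume "(t, u) \<in> Fpow_order L"
    then have u: "finite u" "u \<subseteq> L" "t \<subseteq> u" by (auto simp: Fpow_order_iff)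
    show "st_map (\<sigma> u) t \<in> hom K (st_ob (\<sigma> t)) (st_ob (\<sigma> u))" by (rule system_atD(6)[OF sys[OF u(1,2)] u(3)])
  next
    fix s t u assume "(s, t) \<in> Fpow_order L" "(t, u) \<in> Fpow_order L"
    then have u: "finite u" "u \<subseteq> L" "t \<subseteq> u" "s \<subseteq> t" by (auto simp: Fpow_order_iff)
    show "st_map (\<sigma> u) s = st_map (\<sigma> u) t \<cdot> st_map (\<sigma> t) s" by (rule system_atD(9)[OF sys[OF u(1,2)] u(3,4)])
  qed
qed

text \<open>
  \<open>Y\<close> is the \<open>\<rho>\<close>-directed colimit of the colimits \<open>Y\<^sub>T\<close> over subsets \<open>T\<close> of \<open>I\<close> of size below \<open>\<rho>\<close>,
  so if it were \<open>\<rho>\<close>-presentable, some \<open>Y\<^sub>T \<rightarrow> Y\<close> would be split. The two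
  embeddings of \<open>I\<close> into \<open>I \<times> {0,1}\<close> that send \<open>i\<close> to \<open>(i,0)\<close>, respectively to \<open>(i,0)\<close> or \<open>(i,1)\<close> according
  to whether \<open>i \<in> T\<close>, induce morphisms that agree on \<open>Y\<^sub>T\<close>, hence are equal. But they
  separate the elements attached to an \<open>i \<notin> T\<close>.
\<close>

lemma indiscernible_colimit_not_presentable:
  fixes \<rho> :: "'v rel"
  assumes lt: "strict_linear UNIV lt" and q: "\<And>n. realized lt X \<A> n q" and \<A>: "\<A> \<subseteq> Ob K"
    and I: "|I :: 'v set| <o \<Omega>"
    and col: "colimit K (Fpow I) (Fpow_order I) (\<lambda>s. st_ob (template_stage lt q s))
      (\<lambda>s t. st_map (template_stage lt q t) s) Y c"
    and \<rho>: "regular_card \<rho>" "\<rho> \<le>o |I|"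
  shows "\<not> presentable \<Omega> \<rho> K Y"
proof
  assume Y: "presentable \<Omega> \<rho> K Y"
  have \<rho>i: "Cinfinite \<rho>" by (rule regular_card_infinite[OF \<rho>(1)])
  let ?\<sigma> = "template_stage lt q" and ?D = "\<lambda>s. st_ob (template_stage lt q s)"
    and ?d = "\<lambda>s t. st_map (template_stage lt q t) s"
  have sys: "is_system X \<A> I ?\<sigma>" by (rule template_system[OF lt q strict_linear_subset[OF lt subset_UNIV]])
  have dia: "diagram K (Fpow I) (Fpow_order I) ?D ?d" by (rule system_diagram[OF sys \<A>])
  note c = coconeD[OF colimit_cocone[OF col]]
  define \<T> where "\<T> = {Fpow T | T. T \<subseteq> I \<and> |T| <o \<rho>}"
  let ?O = "{(P, P'). P \<in> \<T> \<and> P' \<in> \<T> \<and> P \<subseteq> P'}"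
  have "\<exists>Z n. P \<subseteq> Fpow I \<and> colimit K P (Fpow_order I \<inter> P \<times> P) ?D ?d Z n" if P: "P \<in> \<T>" for P
  proof -
    obtain T where T: "P = Fpow T" "T \<subseteq> I" using P by (auto simp: \<T>_def)
    have sub: "Fpow T \<subseteq> Fpow I" using Fpow_mono[OF T(2)] .
    have ord: "Fpow_order I \<inter> P \<times> P = Fpow_order T" using sub T(1) by (auto simp: Fpow_order_def)
    have diaT: "diagram K (Fpow T) (Fpow_order T) ?D ?d"
      using system_diagram[OF template_system[OF lt q strict_linear_subset[OF lt subset_UNIV]] \<A>] .
    have "|Fpow T| <o \<Omega>"
      by (rule card_Fpow_less[OF Omega_Cinfinite card_ordLess_subset[OF I T(2)]])
    from colimit_exists[OF Fpow_directed this diaT] obtain Z n where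
      "colimit K (Fpow T) (Fpow_order T) ?D ?d Z n" .
    then show ?thesis using sub T(1) ord by auto
  qed
  then obtain Z n where Z: "\<And>P. P \<in> \<T> \<Longrightarrow> P \<subseteq> Fpow I \<and> colimit K P (Fpow_order I \<inter> P \<times> P) ?D ?d (Z P) (n P)"
    by metis
  have dirT: "directed_on \<rho> \<T> ?O"
  proof (rule directed_onI)
    fix \<S> assume S: "\<S> \<subseteq> \<T>" "|\<S>| <o \<rho>"
    have each: "P = Fpow (\<Union>P) \<and> \<Union>P \<subseteq> I \<and> |\<Union>P| <o \<rho>" if P: "P \<in> \<S>" for P
    proof -
      obtain T where T: "P = Fpow T" "T \<subseteq> I" "|T| <o \<rho>" using P S(1) by (auto simp: \<T>_def)
      have "\<Union>(Fpow T) = T" by (auto simp: Fpow_def)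
      then show ?thesis using T by simp
    qed
    let ?T = "\<Union>P\<in>\<S>. \<Union>P"
    have "|?T| <o \<rho>" by (rule regular_card_UNION[OF \<rho>(1) S(2)]) (use each in blast)
    moreover have "?T \<subseteq> I" using each by blast
    ultimately have "Fpow ?T \<in> \<T>" unfolding \<T>_def by blast
    moreover have "P \<subseteq> Fpow ?T" if P: "P \<in> \<S>" for P
    proof -
      have "\<Union>P \<subseteq> ?T" using P by blast
      then show ?thesis using each[OF P] Fpow_mono by metis
    qed
    ultimately show "\<exists>u\<in>\<T>. \<forall>x\<in>\<S>. (x, u) \<in> ?O" using S(1) by blast
  qed auto
  have cover: "Fpow I \<subseteq> \<Union>\<T>"
  proof
    fix s assume s: "s \<in> Fpow I"
    then have "|s| <o \<rho>" using finite_ordLess_Cinfinite[OF _ \<rho>i] by (auto simp: Fpow_def)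
    moreover have "s \<in> Fpow s" "s \<subseteq> I" using s by (auto simp: Fpow_def)
    ultimately show "s \<in> \<Union>\<T>" unfolding \<T>_def by blast
  qed
  have up: "\<exists>P''\<in>\<T>. P \<subseteq> P'' \<and> P' \<subseteq> P''" if P: "P \<in> \<T>" "P' \<in> \<T>" for P P'
  proof -
    have fin: "|{P, P'}| <o \<rho>" by (rule finite_ordLess_Cinfinite[OF _ \<rho>i]) simp
    obtain u where "u \<in> \<T>" "\<And>x. x \<in> {P, P'} \<Longrightarrow> (x, u) \<in> ?O"
      by (rule directed_onD[OF dirT _ fin]) (use P in auto)
    then show ?thesis by blast
  qed
  have ordI: "Fpow_order I \<subseteq> Fpow I \<times> Fpow I" by (auto simp: Fpow_order_def)
  obtain e k where ek: "diagram K \<T> ?O Z e" "colimit K \<T> ?O Z e Y k"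
    "\<And>P s. P \<in> \<T> \<Longrightarrow> s \<in> P \<Longrightarrow> k P \<cdot> n P s = c s"
    by (rule colimit_of_subdiagrams[OF ordI dia col Z up cover]) auto
  have sT: "|\<T>| <o \<Omega>"
  proof -
    have "\<T> \<subseteq> Fpow ` Pow I" by (auto simp: \<T>_def)
    then show ?thesis by (rule card_ordLess_subset[OF card_ordLess_image[OF small_Pow[OF I]]])
  qed
  obtain P g where P: "P \<in> \<T>" "g \<in> hom K Y (Z P)" "k P \<cdot> g = Id K Y"
    by (rule presentable_factor[OF Y dirT sT ek(1,2) Id_in_hom[OF c(1)]])
  obtain T where T: "P = Fpow T" "T \<subseteq> I" "|T| <o \<rho>" using P(1) by (auto simp: \<T>_def)
  have "T \<noteq> I" using T(3) \<rho>(2) not_ordLess_ordLeq by blast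
  then obtain i where i: "i \<in> I" "i \<notin> T" using T(2) by blast
  let ?L = "I \<times> (UNIV :: bool set)"
  let ?\<tau> = "template_stage (lex_bool lt) q"
  have sysL: "is_system X \<A> ?L ?\<tau>" by (rule template_system[OF lt q strict_linear_lex_bool[OF lt]])
  have "|?L| <o \<Omega>" by (intro small_Times I small_finite) simp
  then have "|Fpow ?L| <o \<Omega>" by (rule card_Fpow_less[OF Omega_Cinfinite])
  from colimit_exists[OF Fpow_directed this system_diagram[OF sysL \<A>]] obtain V v where
    V: "colimit K (Fpow ?L) (Fpow_order ?L) (\<lambda>s. st_ob (?\<tau> s)) (\<lambda>s t. st_map (?\<tau> t) s) V v" .
  note v = coconeD[OF colimit_cocone[OF V]]
  have emb: "\<exists>h. h \<in> hom K Y V \<and> (\<forall>s\<in>Fpow I. h \<cdot> c s = v (f ` s))"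
    if f: "inj f" "\<And>x y. lex_bool lt (f x) (f y) \<longleftrightarrow> lt x y" "f ` I \<subseteq> ?L" for f :: "'v \<Rightarrow> 'v \<times> bool"
  proof -
    have st: "st_ob (?\<tau> (f ` u)) = st_ob (?\<sigma> u)"
      "s \<subseteq> u \<Longrightarrow> st_map (?\<tau> (f ` u)) (f ` s) = st_map (?\<sigma> u) s" for u s
      using template_stage_embed[where e = f and L = UNIV and lt = lt and lt' = "lex_bool lt" and q = q and u = u] f(1,2)
      by simp_all
    have fF: "f ` s \<in> Fpow ?L" if "s \<in> Fpow I" for s using that f(3) by (auto simp: Fpow_def)
    have "cocone K (Fpow I) (Fpow_order I) ?D ?d V (\<lambda>s. v (f ` s))"
    proof (rule coconeI)
      show "V \<in> Ob K" by (rule v(1))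
      show "v (f ` s) \<in> hom K (?D s) V" if "s \<in> Fpow I" for s using v(2)[OF fF[OF that]] st(1) by simp
      fix s t assume "(s, t) \<in> Fpow_order I"
      then have st': "s \<subseteq> t" "t \<in> Fpow I" by (auto simp: Fpow_order_def)
      then have o: "(f ` s, f ` t) \<in> Fpow_order ?L" using fF[of t] by (auto simp: Fpow_order_iff Fpow_def)
      show "v (f ` t) \<cdot> ?d s t = v (f ` s)" using v(3)[OF o] st(2)[OF st'(1)] by simp
    qed
    from colimit_ex[OF col this] show ?thesis by metis
  qed
  define f1 where "f1 j = (j, False)" for j :: 'v
  define f2 where "f2 j = (j, j \<notin> T)" for j
  have irr: "\<not> lt x x" for x using lt by (simp add: strict_linear_def)
  obtain h1 where h1: "h1 \<in> hom K Y V" "\<forall>s\<in>Fpow I. h1 \<cdot> c s = v (f1 ` s)"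
    using emb[of f1] by (auto simp: f1_def inj_def lex_bool_def irr)
  obtain h2 where h2: "h2 \<in> hom K Y V" "\<forall>s\<in>Fpow I. h2 \<cdot> c s = v (f2 ` s)"
    using emb[of f2] by (auto simp: f2_def inj_def lex_bool_def irr)
  have PI: "P \<subseteq> Fpow I" and colP: "colimit K P (Fpow_order I \<inter> P \<times> P) ?D ?d (Z P) (n P)"
    using Z[OF P(1)] by auto
  have kP: "k P \<in> hom K (Z P) Y" by (rule coconeD(2)[OF colimit_cocone[OF ek(2)] P(1)])
  note nP = coconeD[OF colimit_cocone[OF colP]]
  have agree: "h1 \<cdot> k P = h2 \<cdot> k P"
  proof (rule colimit_eq[OF colP _ Comp_in_hom[OF kP h1(1)] Comp_in_hom[OF kP h2(1)]])
    show "(h1 \<cdot> k P) \<cdot> n P s = v (f1 ` s)" if "s \<in> P" for s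
      using Comp_assoc[OF nP(2)[OF that] kP h1(1)] ek(3)[OF P(1) that] h1(2) PI that by auto
    show "(h2 \<cdot> k P) \<cdot> n P s = v (f1 ` s)" if "s \<in> P" for s
    proof -
      have "f2 ` s = f1 ` s" using that T(1) by (intro image_cong) (auto simp: f1_def f2_def Fpow_def)
      then show ?thesis
        using Comp_assoc[OF nP(2)[OF that] kP h2(1)] ek(3)[OF P(1) that] h2(2) PI that by auto
    qed
    show "cocone K P (Fpow_order I \<inter> P \<times> P) ?D ?d V (\<lambda>s. v (f1 ` s))"
    proof (rule coconeI)
      have eq: "v (f1 ` s) = (h1 \<cdot> k P) \<cdot> n P s" if "s \<in> P" for s
        using Comp_assoc[OF nP(2)[OF that] kP h1(1)] ek(3)[OF P(1) that] h1(2) PI that by auto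
      show "v (f1 ` s) \<in> hom K (?D s) V" if "s \<in> P" for s
        using eq[OF that] Comp_in_hom[OF nP(2)[OF that] Comp_in_hom[OF kP h1(1)]] by simp
      fix s t assume st: "(s, t) \<in> Fpow_order I \<inter> P \<times> P"
      then have "s \<in> P" "t \<in> P" "(s, t) \<in> Fpow_order I" by auto
      then show "v (f1 ` t) \<cdot> ?d s t = v (f1 ` s)"
        using eq nP(3)[OF st] Comp_assoc[OF diagramD(2)[OF dia] nP(2) Comp_in_hom[OF kP h1(1)]] by metis
    qed (rule v(1))
  qed
  have "h = (h \<cdot> k P) \<cdot> g" if "h \<in> hom K Y V" for h
    unfolding Comp_assoc[OF P(2) kP that] P(3) by (rule Comp_Id[OF that, symmetric])
  from this[OF h1(1)] this[OF h2(1)] have "h1 = h2" unfolding agree by (rule trans[OF _ sym])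
  have iI: "{i} \<in> Fpow I" using i(1) by (simp add: Fpow_def)
  have "v (f1 ` {i}) = v (f2 ` {i})" using bspec[OF h1(2) iI] bspec[OF h2(2) iI] \<open>h1 = h2\<close> by simp
  then have vv: "v {(i, False)} = v {(i, True)}" using i(2) by (simp add: f1_def f2_def)
  let ?w = "{(i, False), (i, True)}"
  have w: "finite ?w" "?w \<subseteq> ?L" using i(1) by auto
  have sw: "system_at X \<A> ?\<tau> ?w" by (rule is_systemD[OF sysL w])
  have vw: "v ?w \<in> hom K (st_ob (?\<tau> ?w)) V" by (rule v(2)) (use w in \<open>auto simp: Fpow_def\<close>)
  have elt: "fn (v {(i, b)}) (st_elt (?\<tau> {(i, b)}) (i, b)) = fn (v ?w) (st_elt (?\<tau> ?w) (i, b))" for b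
  proof -
    have sub: "{(i, b)} \<subseteq> ?w" by (cases b) auto
    have ord: "({(i, b)}, ?w) \<in> Fpow_order ?L" unfolding Fpow_order_iff using w sub by blast
    have sb: "system_at X \<A> ?\<tau> {(i, b)}" by (rule is_systemD[OF sysL _ subset_trans[OF sub w(2)]]) simp
    have "fn (v ?w) (st_elt (?\<tau> ?w) (i, b)) = fn (v ?w) (fn (st_map (?\<tau> ?w) {(i, b)}) (st_elt (?\<tau> {(i, b)}) (i, b)))"
      using system_atD(8)[OF sw sub, of "(i, b)"] by simp
    also have "\<dots> = fn (v ?w \<cdot> st_map (?\<tau> ?w) {(i, b)}) (st_elt (?\<tau> {(i, b)}) (i, b))"
      using U_comp[OF system_atD(6)[OF sw sub] vw system_atD(4)[OF sb, of "(i, b)"]] by simp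
    finally show ?thesis using v(3)[OF ord] by simp
  qed
  \<comment> \<open>Both indices have position 0 in their singletons, so the two stages coincide.\<close>
  have same: "st_elt (?\<tau> {(i, True)}) (i, True) = st_elt (?\<tau> {(i, False)}) (i, False)"
  proof -
    have "pos (lex_bool lt) {(i, b)} (i, b) = 0" for b by (auto simp: pos_def lex_bool_def irr)
    then show ?thesis by (simp add: template_stage_def)
  qed
  have "fn (v ?w) (st_elt (?\<tau> ?w) (i, False)) = fn (v ?w) (st_elt (?\<tau> ?w) (i, True))"
    using elt[of False] elt[of True] vv same by simp
  then have "st_elt (?\<tau> ?w) (i, False) = st_elt (?\<tau> ?w) (i, True)"
    by (rule U_inj[OF vw system_atD(4)[OF sw] system_atD(4)[OF sw], rotated 2]) auto
  then show False using inj_onD[OF system_atD(5)[OF sw], of "(i, False)" "(i, True)"] by simp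
qed

text \<open>
  As a colimit of \<open>\<mu>\<close> objects that are \<open>\<mu>\<^sup>+\<close>-presentable, the colimit of an indiscernible system over
  \<open>Field \<mu>\<close> is \<open>\<mu>\<^sup>+\<close>-presentable, and by the preceding lemma its rank is not smaller.
\<close>

lemma exact_extension:
  assumes X: "presentable \<Omega> (cardSuc \<mu>) K X"
  obtains Y x where "x \<in> hom K X Y" "has_size \<Omega> K Y \<mu>"
proof -
  have XOb: "X \<in> Ob K" by (rule presentable_Ob[OF X])
  obtain \<A> where \<A>: "|\<A>| <o \<Omega>" "\<And>A. A \<in> \<A> \<Longrightarrow> presentable \<Omega> (cardSuc \<mu>) K A"
    "\<And>X. X \<in> Ob K \<Longrightarrow> \<exists>I r D d c. directed_on (cardSuc \<mu>) I r \<and> |I :: 'v set| <o \<Omega> \<and>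
      diagram K I r D d \<and> D ` I \<subseteq> \<A> \<and> colimit K I r D d X c"
    by (rule accessible_presentation[OF K_accessible_\<nu>], rule that)
  have \<A>Ob: "\<A> \<subseteq> Ob K" using \<A>(2) presentable_Ob by blast
  obtain lt :: "'v \<Rightarrow> 'v \<Rightarrow> bool" where lt: "strict_linear UNIV lt" by (rule linear_order_copy)
  have "\<exists>\<sigma>. is_system X \<A> S \<sigma>" if S: "|S| <o \<Omega>" for S :: "'v set"
  proof -
    obtain N f where N: "f \<in> hom K X N" "|S| \<le>o |\<bar>N\<bar>\<^sub>U|" by (rule large_extension[OF XOb S])
    obtain a where a: "inj_on a S" "a ` S \<subseteq> \<bar>N\<bar>\<^sub>U" using N(2) card_of_ordLeq[of S "\<bar>N\<bar>\<^sub>U"] by auto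
    obtain I :: "'v set" and r D d c where I: "directed_on (cardSuc \<mu>) I r" "|I| <o \<Omega>"
      "diagram K I r D d" "D ` I \<subseteq> \<A>" "colimit K I r D d N c"
      using \<A>(3)[OF hom_Ob(2)[OF N(1)]] by (elim exE conjE)
    obtain \<sigma> where \<sigma>: "is_system X (D ` I) S \<sigma>"
      using system_in_extension[OF X N(1) I(1,2,3,5) a] by blast
    have "system_at X \<A> \<sigma> u" if "finite u \<and> u \<subseteq> S" for u
    proof -
      have "system_at X (D ` I) \<sigma> u" using is_systemD[OF \<sigma>] that by simp
      then show ?thesis using I(4) by (rule system_at_mono)
    qed
    then show ?thesis unfolding is_system_def by (intro exI[of _ \<sigma>]) simp
  qed
  then obtain q where q: "\<And>n. realized lt X \<A> n q" by (rule template_exists[OF \<A>(1) \<A>Ob XOb lt]) auto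
  let ?I = "Field \<mu>" and ?\<sigma> = "template_stage lt q"
  have sys: "is_system X \<A> ?I ?\<sigma>" by (rule template_system[OF lt q strict_linear_subset[OF lt subset_UNIV]])
  note dia = system_diagram[OF sys \<A>Ob]
  have "|Fpow ?I| \<le>o \<mu>" by (rule card_Fpow_le[OF \<mu>_infinite ordIso_imp_ordLeq[OF Field_\<mu>]])
  then have few: "|Fpow ?I| <o cardSuc \<mu>" by (simp add: card_ordLess_cardSuc_iff[OF \<mu>_card])
  have "|Fpow ?I| <o \<Omega>" by (rule card_Fpow_less[OF Omega_Cinfinite small_Field_\<mu>])
  from colimit_exists[OF Fpow_directed this dia] obtain Y c where
    col: "colimit K (Fpow ?I) (Fpow_order ?I) (\<lambda>s. st_ob (?\<sigma> s)) (\<lambda>s t. st_map (?\<sigma> t) s) Y c" .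
  have at: "system_at X \<A> ?\<sigma> s" if "s \<in> Fpow ?I" for s by (rule is_systemD[OF sys]) (use that in \<open>auto simp: Fpow_def\<close>)
  have Y: "presentable \<Omega> (cardSuc \<mu>) K Y"
    by (rule colimit_of_presentables[OF \<nu>_infinite few _ dia col])
      (use \<A>(2) system_atD(1)[OF at] in \<open>auto simp: Fpow_order_def\<close>)
  have "cardSuc \<mu> \<le>o \<rho>" if \<rho>: "small_card \<Omega> \<rho>" "regular_card \<rho>" "presentable \<Omega> \<rho> K Y" for \<rho>
  proof (rule ccontr)
    assume "\<not> cardSuc \<mu> \<le>o \<rho>"
    then have less: "\<rho> <o cardSuc \<mu>"
      using \<rho>(1) cardSuc_Well_order[OF \<mu>_card] not_ordLeq_iff_ordLess
      unfolding small_card_def card_order_on_def by blast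
    have "Card_order \<rho>" using \<rho>(1) by (simp add: small_card_def)
    then have "\<rho> \<le>o \<mu>" using less by (simp add: ordLess_cardSuc_iff[OF \<mu>_card])
    then have "\<rho> \<le>o |?I|" by (rule ordLeq_ordIso_trans[OF _ ordIso_symmetric[OF Field_\<mu>]])
    then show False
      using indiscernible_colimit_not_presentable[OF lt q \<A>Ob small_Field_\<mu> col \<rho>(2)] \<rho>(3) by blast
  qed
  then have size: "has_size \<Omega> K Y \<mu>"
    unfolding has_size_def presentability_rank_def small_card_def
    using \<mu>_card \<mu>_small regular_card_cardSuc[OF \<mu>_infinite] Y by (simp add: small_card_def)
  have e: "{} \<in> Fpow ?I" by (simp add: Fpow_def)
  have "c {} \<cdot> st_base (?\<sigma> {}) \<in> hom K X Y"
    by (rule Comp_in_hom[OF system_atD(2)[OF at[OF e]] coconeD(2)[OF colimit_cocone[OF col] e]])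
  then show ?thesis using size by (rule that)
qed

end

section \<open>Transfinite chains\<close>

abbreviation restr :: "'i rel \<Rightarrow> 'i set \<Rightarrow> 'i rel" where
  "restr W A \<equiv> W \<inter> A \<times> A"

lemma well_order_onD:
  assumes "well_order_on I W"
  shows "W \<subseteq> I \<times> I" "i \<in> I \<Longrightarrow> (i, i) \<in> W" "(i, j) \<in> W \<Longrightarrow> (j, k) \<in> W \<Longrightarrow> (i, k) \<in> W"
    "(i, j) \<in> W \<Longrightarrow> (j, i) \<in> W \<Longrightarrow> i = j" "i \<in> I \<Longrightarrow> j \<in> I \<Longrightarrow> (i, j) \<in> W \<or> (j, i) \<in> W"
    "wf (W - Relation.Id)"
proof -
  have lin: "linear_order_on I W" and wf: "wf (W - Relation.Id)" using assms by (auto simp: well_order_on_def)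
  then show "W \<subseteq> I \<times> I" "i \<in> I \<Longrightarrow> (i, i) \<in> W"
    by (auto simp: linear_order_on_def partial_order_on_def preorder_on_def refl_on_def)
  show "(i, j) \<in> W \<Longrightarrow> (j, k) \<in> W \<Longrightarrow> (i, k) \<in> W"
    using lin by (auto simp: linear_order_on_def partial_order_on_def preorder_on_def dest: transD)
  show "(i, j) \<in> W \<Longrightarrow> (j, i) \<in> W \<Longrightarrow> i = j"
    using lin by (auto simp: linear_order_on_def partial_order_on_def dest: antisymD)
  show "i \<in> I \<Longrightarrow> j \<in> I \<Longrightarrow> (i, j) \<in> W \<or> (j, i) \<in> W"
    using lin \<open>i \<in> I \<Longrightarrow> (i, i) \<in> W\<close> by (cases "i = j") (auto simp: linear_order_on_def total_on_def)
  show "wf (W - Relation.Id)" by (rule wf)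
qed

lemma directed_restr:
  assumes W: "well_order_on I W" and A: "A \<subseteq> I" "A \<noteq> {}"
  shows "directed_on natLeq A (restr W A)"
proof (rule directed_on_natLeqI)
  note w = well_order_onD[OF W]
  show "\<And>j. j \<in> A \<Longrightarrow> (j, j) \<in> restr W A" using w(2) A(1) by auto
  show "\<And>i j k. (i, j) \<in> restr W A \<Longrightarrow> (j, k) \<in> restr W A \<Longrightarrow> (i, k) \<in> restr W A" using w(3) by auto
  show "\<And>i j. (i, j) \<in> restr W A \<Longrightarrow> (j, i) \<in> restr W A \<Longrightarrow> i = j" using w(4) by auto
  fix i j assume ij: "i \<in> A" "j \<in> A"
  then have "(i, i) \<in> W" "(j, j) \<in> W" "(i, j) \<in> W \<or> (j, i) \<in> W" using w(2,5) A(1) by auto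
  then show "\<exists>u\<in>A. (i, u) \<in> restr W A \<and> (j, u) \<in> restr W A" using ij by auto
qed (use A(2) in auto)

lemma underS_iff: "j \<in> underS W i \<longleftrightarrow> (j, i) \<in> W \<and> j \<noteq> i"
  by (auto simp: underS_def)

text \<open>The index \<open>z\<close> is reserved for the start of a chain; the others enumerate the tasks.\<close>

lemma enumeration_avoiding:
  assumes "infinite A" "|T| \<le>o |A|"
  obtains a where "T \<subseteq> a ` (A - {z})"
proof -
  obtain b where b: "bij_betw b A (A - {z})" using infinite_imp_bij_betw[OF assms(1)] by blast
  have "|A| \<le>o |A - {z}|" by (rule card_of_ordLeqI[of b]) (use b in \<open>auto simp: bij_betw_def\<close>)
  then have "|T| \<le>o |A - {z}|" by (rule ordLeq_transitive[OF assms(2)])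
  moreover have "A - {z} \<noteq> {}" using assms(1) by (metis finite.emptyI finite_insert insert_Diff_single finite_Diff2)
  ultimately show ?thesis by (rule nonempty_surj) (rule that)
qed

context mono_category begin

lemma colimit_of_constant:
  assumes X: "X \<in> Ob K" and dir: "directed_on natLeq J s"
  shows "diagram K J s (\<lambda>_. X) (\<lambda>_ _. Id K X)" "colimit K J s (\<lambda>_. X) (\<lambda>_ _. Id K X) X (\<lambda>_. Id K X)"
proof -
  note I = Id_in_hom[OF X]
  show "diagram K J s (\<lambda>_. X) (\<lambda>_ _. Id K X)"
    by (rule diagramI) (use X I Comp_Id[OF I] in auto)
  show "colimit K J s (\<lambda>_. X) (\<lambda>_ _. Id K X) X (\<lambda>_. Id K X)"
    unfolding colimit_def
  proof (intro conjI allI impI)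
    show "cocone K J s (\<lambda>_. X) (\<lambda>_ _. Id K X) X (\<lambda>_. Id K X)"
      by (rule coconeI) (use X I Comp_Id[OF I] in auto)
    fix Y e assume e: "cocone K J s (\<lambda>_. X) (\<lambda>_ _. Id K X) Y e"
    note e = coconeD[OF e]
    have s: "e i = e j" if "(i, j) \<in> s" for i j
    proof -
      have "j \<in> J" using that directed_on_order(1)[OF dir] by auto
      then show ?thesis using e(3)[OF that] Comp_Id[OF e(2)] by simp
    qed
    have same: "e i = e j" if ij: "i \<in> J" "j \<in> J" for i j
    proof -
      obtain u where u: "u \<in> J" "\<And>x. x \<in> {i, j} \<Longrightarrow> (x, u) \<in> s"
        by (rule directed_on_finite[OF dir, of "{i, j}"]) (use ij in auto)
      then show ?thesis using s[of i u] s[of j u] by simp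
    qed
    obtain j where j: "j \<in> J" by (rule directed_on_finite[OF dir, of "{}"]) auto
    show "\<exists>!u. u \<in> hom K X Y \<and> (\<forall>i\<in>J. u \<cdot> Id K X = e i)"
    proof (rule ex1I[of _ "e j"])
      show "e j \<in> hom K X Y \<and> (\<forall>i\<in>J. e j \<cdot> Id K X = e i)" 
        unfolding Comp_Id[OF e(2)[OF j]] using e(2)[OF j] same[OF j] by blast
      fix u assume "u \<in> hom K X Y \<and> (\<forall>i\<in>J. u \<cdot> Id K X = e i)"
      then show "u = e j" using Comp_Id[of u X Y] j by auto
    qed
  qed
qed

text \<open>
  Given a well-ordered diagram \<open>M\<close>, a second diagram \<open>N\<close> and a natural transformation \<open>f\<close> from \<open>M\<close>
  to \<open>N\<close> are built by transfinite recursion. At \<open>i\<close>, the colimit \<open>P i\<close> of the earlier \<open>M j\<close> maps to the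
  colimit \<open>Y\<close> of the earlier \<open>N j\<close>, and the hypothesis \<open>step\<close> completes \<open>M i \<leftarrow> P i \<rightarrow> Y\<close> to a
  commutative square with a prescribed property.
\<close>

lemma natural_chain:
  fixes W :: "'i rel" and Pr :: "'o \<Rightarrow> bool"
  assumes W: "well_order_on I W" and z: "z \<in> I" "\<And>i. i \<in> I \<Longrightarrow> (z, i) \<in> W" and small: "|I| <o \<Omega>"
    and M: "diagram K I W M m"
    and P: "\<And>i. i \<in> I \<Longrightarrow> i \<noteq> z \<Longrightarrow> colimit K (underS W i) (restr W (underS W i)) M m (P i) (p i)"
    and q: "\<And>i. i \<in> I \<Longrightarrow> i \<noteq> z \<Longrightarrow> q i \<in> hom K (P i) (M i)"
      "\<And>i j. i \<in> I \<Longrightarrow> i \<noteq> z \<Longrightarrow> j \<in> underS W i \<Longrightarrow> q i \<cdot> p i j = m j i"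
    and f0: "f0 \<in> hom K (M z) N0" and Pr0: "Pr N0"
    and step: "\<And>i N n Y c g. i \<in> I \<Longrightarrow> i \<noteq> z \<Longrightarrow> diagram K (underS W i) (restr W (underS W i)) N n \<Longrightarrow>
      N z = N0 \<Longrightarrow> (\<And>j. j \<in> underS W i \<Longrightarrow> Pr (N j)) \<Longrightarrow>
      colimit K (underS W i) (restr W (underS W i)) N n Y c \<Longrightarrow> g \<in> hom K (P i) Y \<Longrightarrow>
      \<exists>Z y f. y \<in> hom K Y Z \<and> f \<in> hom K (M i) Z \<and> f \<cdot> q i = y \<cdot> g \<and> Pr Z \<and> C i Y c Z y f"
  obtains N n f where "diagram K I W N n" "N z = N0" "f z = f0" "\<And>i. i \<in> I \<Longrightarrow> Pr (N i)"
    "\<And>i. i \<in> I \<Longrightarrow> f i \<in> hom K (M i) (N i)" "\<And>i j. (i, j) \<in> W \<Longrightarrow> f j \<cdot> m i j = n i j \<cdot> f i"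
    "\<And>i. i \<in> I \<Longrightarrow> i \<noteq> z \<Longrightarrow> \<exists>Y c y. colimit K (underS W i) (restr W (underS W i)) N n Y c \<and>
      y \<in> hom K Y (N i) \<and> (\<forall>j\<in>underS W i. n j i = y \<cdot> c j) \<and> C i Y c (N i) y (f i)"
proof -
  note w = well_order_onD[OF W]
  define No :: "('i \<Rightarrow> 'o \<times> ('i \<Rightarrow> 'm) \<times> 'm) \<Rightarrow> 'i \<Rightarrow> 'o" where "No F j = fst (F j)" for F j
  define Na :: "('i \<Rightarrow> 'o \<times> ('i \<Rightarrow> 'm) \<times> 'm) \<Rightarrow> 'i \<Rightarrow> 'i \<Rightarrow> 'm"
    where "Na F j k = (if j = k then Id K (No F j) else fst (snd (F k)) j)" for F j k
  define fa :: "('i \<Rightarrow> 'o \<times> ('i \<Rightarrow> 'm) \<times> 'm) \<Rightarrow> 'i \<Rightarrow> 'm" where "fa F j = snd (snd (F j))" for F j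
  define S where "S i = underS W i" for i
  define ok where "ok F i Z e f Y c y \<longleftrightarrow>
      colimit K (S i) (restr W (S i)) (No F) (Na F) Y c \<and> y \<in> hom K Y Z \<and>
      (\<forall>j\<in>S i. e j = y \<cdot> c j) \<and> f \<in> hom K (M i) Z \<and> (\<forall>j\<in>S i. f \<cdot> m j i = e j \<cdot> fa F j) \<and>
      Pr Z \<and> C i Y c Z y f" for F i Z e f Y c y
  \<comment> \<open>The value at \<open>i\<close> is a triple: the object \<open>N i\<close>, the morphisms \<open>N j \<rightarrow> N i\<close> for \<open>j\<close> below \<open>i\<close>, and \<open>f i\<close>.\<close>
  define Q where "Q F i r \<longleftrightarrow> (i \<in> I \<longrightarrow> (if i = z then fst r = N0 \<and> snd (snd r) = f0
      else \<exists>Y c y. ok F i (fst r) (fst (snd r)) (snd (snd r)) Y c y))" for F i r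
  have SI: "S i \<subseteq> I" for i using w(1) by (auto simp: S_def underS_iff)
  have SS: "S j \<subseteq> S i" if "j \<in> S i" for i j
    using that w(3,4) unfolding S_def underS_iff[abs_def] by (auto simp: underS_iff) 
  have zS: "z \<in> S i" if "i \<in> I" "i \<noteq> z" for i using z(2) that by (auto simp: S_def underS_iff)
  \<comment> \<open>The data satisfying \<open>Q\<close> on an initial segment form a diagram and a natural transformation there.\<close>
  have segment: "diagram K A (restr W A) (No F) (Na F) \<and> (\<forall>i\<in>A. fa F i \<in> hom K (M i) (No F i)) \<and>
      (\<forall>i j. (i, j) \<in> restr W A \<longrightarrow> fa F j \<cdot> m i j = Na F i j \<cdot> fa F i) \<and> (\<forall>i\<in>A. Pr (No F i))"
    if A: "A \<subseteq> I" "\<And>i. i \<in> A \<Longrightarrow> S i \<subseteq> A" and Q: "\<And>i. i \<in> A \<Longrightarrow> Q F i (F i)" for A F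
  proof -
    have okF: "\<exists>Y c y. ok F i (No F i) (fst (snd (F i))) (fa F i) Y c y" if "i \<in> A" "i \<noteq> z" for i
      using Q[OF that(1)] A(1) that by (auto simp: Q_def No_def fa_def)
    have base: "No F z = N0" "fa F z = f0" if "z \<in> A" using Q[OF that] z(1) by (auto simp: Q_def No_def fa_def)
    have fh: "fa F i \<in> hom K (M i) (No F i)" if "i \<in> A" for i
    proof (cases "i = z")
      case True then show ?thesis using base that f0 by simp
    next
      case False then show ?thesis using okF[OF that] unfolding ok_def by blast
    qed
    have Ob: "No F i \<in> Ob K" if "i \<in> A" for i using hom_Ob(2)[OF fh[OF that]] .
    have Pri: "Pr (No F i)" if "i \<in> A" for i
    proof (cases "i = z")
      case True then show ?thesis using base that Pr0 by simp
    next
      case False then show ?thesis using okF[OF that] unfolding ok_def by blast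
    qed
    have lessD: "j \<in> A \<and> j \<noteq> z \<and> i \<in> S j" if "(i, j) \<in> restr W A" "i \<noteq> j" for i j
      using that z(2) A(1) w(4) by (auto simp: S_def underS_iff)
    have less: "Na F i j \<in> hom K (No F i) (No F j) \<and> fa F j \<cdot> m i j = Na F i j \<cdot> fa F i"
      if ij: "(i, j) \<in> restr W A" "i \<noteq> j" for i j
    proof -
      note l = lessD[OF ij]
      obtain Y c y where o: "ok F j (No F j) (fst (snd (F j))) (fa F j) Y c y" using okF l by blast
      have col: "colimit K (S j) (restr W (S j)) (No F) (Na F) Y c" and y: "y \<in> hom K Y (No F j)"
        and e: "fst (snd (F j)) i = y \<cdot> c i" and nat: "fa F j \<cdot> m i j = fst (snd (F j)) i \<cdot> fa F i"
        using o l unfolding ok_def by auto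
      have "c i \<in> hom K (No F i) Y" using coconeD(2)[OF colimit_cocone[OF col]] l by blast
      then show ?thesis using Comp_in_hom[OF _ y] e nat ij(2) by (simp add: Na_def)
    qed
    have mId: "m i i = Id K (M i)" if "i \<in> I" for i using diagramD(3)[OF M that] .
    have "diagram K A (restr W A) (No F) (Na F)"
    proof (rule diagramI)
      fix i j assume ij: "(i, j) \<in> restr W A"
      then show "Na F i j \<in> hom K (No F i) (No F j)"
        using less[OF ij] Id_in_hom[OF Ob[of i]] by (cases "i = j") (auto simp: Na_def)
      fix k assume jk: "(j, k) \<in> restr W A"
      show "Na F i k = Na F j k \<cdot> Na F i j"
      proof (cases "i = j \<or> j = k")
        case True
        have "j \<in> A" using ij by blast
        show ?thesis
        proof (cases "i = j")
          case True
          show ?thesis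
          proof (cases "j = k")
            case True
            then show ?thesis using \<open>i = j\<close> Id_Comp[OF Id_in_hom[OF Ob[OF \<open>j \<in> A\<close>]]] by (simp add: Na_def)
          next
            case False
            then show ?thesis using \<open>i = j\<close> Comp_Id[OF conjunct1[OF less[OF jk False]]] by (simp add: Na_def)
          qed
        next
          case False
          then show ?thesis using \<open>i = j \<or> j = k\<close> Id_Comp[OF conjunct1[OF less[OF ij False]]] by (auto simp: Na_def)
        qed
      next
        case False
        have ik: "(i, k) \<in> restr W A" using ij jk w(3) by blast
        have "i \<noteq> k" using False ij jk w(4) by blast
        note l = lessD[OF jk] lessD[OF ik \<open>i \<noteq> k\<close>]
        obtain Y c y where o: "ok F k (No F k) (fst (snd (F k))) (fa F k) Y c y" using okF l False by blast
        have col: "colimit K (S k) (restr W (S k)) (No F) (Na F) Y c" and y: "y \<in> hom K Y (No F k)"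
          and e: "\<And>j. j \<in> S k \<Longrightarrow> fst (snd (F k)) j = y \<cdot> c j"
          using o unfolding ok_def by auto
        note c = coconeD[OF colimit_cocone[OF col]]
        have jS: "j \<in> S k" and iS: "i \<in> S k" using l False by auto
        have ijS: "(i, j) \<in> restr W (S k)" using ij jS iS by blast
        have "i \<noteq> j" using False by blast
        have "(y \<cdot> c j) \<cdot> Na F i j = y \<cdot> c i"
          unfolding Comp_assoc[OF conjunct1[OF less[OF ij \<open>i \<noteq> j\<close>]] c(2)[OF jS] y] c(3)[OF ijS] ..
        then show ?thesis using e[OF jS] e[OF iS] False \<open>i \<noteq> k\<close> by (simp add: Na_def)
      qed
    qed (use Ob in \<open>auto simp: Na_def\<close>)
    moreover have "fa F j \<cdot> m i j = Na F i j \<cdot> fa F i" if ij: "(i, j) \<in> restr W A" for i j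
    proof (cases "i = j")
      case True
      have "i \<in> A" using ij by blast
      then show ?thesis using True mId[of i] A(1) Comp_Id[OF fh[of i]] Id_Comp[OF fh[of i]] by (auto simp: Na_def)
    next
      case False then show ?thesis using less[OF ij] by blast
    qed
    ultimately show ?thesis using fh Pri by blast
  qed
  have "\<exists>F. \<forall>i. Q F i (F i)"
  proof (rule dependent_wf_choice[OF w(6)])
    fix F G :: "'i \<Rightarrow> 'o \<times> ('i \<Rightarrow> 'm) \<times> 'm" and i r
    assume "\<And>j. (j, i) \<in> W - Relation.Id \<Longrightarrow> F j = G j"
    then have eq: "\<And>j. j \<in> S i \<Longrightarrow> F j = G j" by (auto simp: S_def underS_iff)
    have "colimit K (S i) (restr W (S i)) (No F) (Na F) Y c \<longleftrightarrow>
        colimit K (S i) (restr W (S i)) (No G) (Na G) Y c" for Y c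
      by (rule colimit_cong) (auto simp: No_def Na_def eq)
    moreover have "fa F j = fa G j" if "j \<in> S i" for j using eq[OF that] by (simp add: fa_def)
    ultimately show "Q F i r = Q G i r" unfolding Q_def ok_def by simp
  next
    fix i and F :: "'i \<Rightarrow> 'o \<times> ('i \<Rightarrow> 'm) \<times> 'm"
    assume "\<And>j. (j, i) \<in> W - Relation.Id \<Longrightarrow> Q F j (F j)"
    then have QS: "\<And>j. j \<in> S i \<Longrightarrow> Q F j (F j)" by (auto simp: S_def underS_iff)
    show "\<exists>r. Q F i r"
    proof (cases "i \<in> I \<and> i \<noteq> z")
      case False
      then show ?thesis unfolding Q_def by (intro exI[of _ "(N0, undefined, f0)"]) auto
    next
      case True
      then have i: "i \<in> I" "i \<noteq> z" by auto
      note seg = segment[OF SI SS QS]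
      then have dia: "diagram K (S i) (restr W (S i)) (No F) (Na F)" by blast
      have ofh: "\<And>j. j \<in> S i \<Longrightarrow> fa F j \<in> hom K (M j) (No F j)"
        and nat: "\<And>j k. (j, k) \<in> restr W (S i) \<Longrightarrow> fa F k \<cdot> m j k = Na F j k \<cdot> fa F j"
        and Pri: "\<And>j. j \<in> S i \<Longrightarrow> Pr (No F j)" using seg by blast+
      have "S i \<noteq> {}" using zS[OF i] by blast
      from colimit_exists[OF directed_restr[OF W SI this] card_ordLess_subset[OF small SI] dia]
      obtain Y c where col: "colimit K (S i) (restr W (S i)) (No F) (Na F) Y c" .
      note c = coconeD[OF colimit_cocone[OF col]]
      have "Q F z (F z)" using QS zS[OF i] by blast
      then have Nz: "No F z = N0" using z(1) by (simp add: Q_def No_def)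
      have "cocone K (S i) (restr W (S i)) M m Y (\<lambda>j. c j \<cdot> fa F j)"
      proof (rule coconeI)
        show "Y \<in> Ob K" by (rule c(1))
        show "\<And>j. j \<in> S i \<Longrightarrow> c j \<cdot> fa F j \<in> hom K (M j) Y" using Comp_in_hom[OF ofh c(2)] .
        fix j k assume jk: "(j, k) \<in> restr W (S i)"
        then have mem: "j \<in> S i" "k \<in> S i" "(j, k) \<in> W" by auto
        show "(c k \<cdot> fa F k) \<cdot> m j k = c j \<cdot> fa F j"
          using Comp_assoc[OF diagramD(2)[OF M mem(3)] ofh[OF mem(2)] c(2)[OF mem(2)]] nat[OF jk]
            Comp_assoc[OF ofh[OF mem(1)] diagramD(2)[OF dia jk] c(2)[OF mem(2)]] c(3)[OF jk] by simp
      qed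
      from colimit_ex[OF P[OF i, folded S_def] this]
      obtain g where g: "g \<in> hom K (P i) Y" "\<And>j. j \<in> S i \<Longrightarrow> g \<cdot> p i j = c j \<cdot> fa F j" by metis
      obtain Z y f where Z: "y \<in> hom K Y Z" "f \<in> hom K (M i) Z" "f \<cdot> q i = y \<cdot> g" "Pr Z" "C i Y c Z y f"
        using step[OF i dia[unfolded S_def] Nz Pri[unfolded S_def] col[unfolded S_def] g(1)] by blast
      note pi = coconeD(2)[OF colimit_cocone[OF P[OF i, folded S_def]]]
      have "f \<cdot> m j i = (y \<cdot> c j) \<cdot> fa F j" if j: "j \<in> S i" for j
      proof -
        have "f \<cdot> m j i = (f \<cdot> q i) \<cdot> p i j"
          using q(2)[OF i j[unfolded S_def]] Comp_assoc[OF pi[OF j] q(1)[OF i] Z(2)] by simp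
        also have "\<dots> = y \<cdot> (g \<cdot> p i j)" unfolding Z(3) by (rule Comp_assoc[OF pi[OF j] g(1) Z(1)])
        also have "\<dots> = (y \<cdot> c j) \<cdot> fa F j"
          unfolding g(2)[OF j] by (rule Comp_assoc[OF ofh[OF j] c(2)[OF j] Z(1), symmetric])
        finally show ?thesis .
      qed
      then have "ok F i Z (\<lambda>j. y \<cdot> c j) f Y c y" unfolding ok_def using col Z by simp
      then show ?thesis using i unfolding Q_def by (intro exI[of _ "(Z, \<lambda>j. y \<cdot> c j, f)"]) auto
    qed
  qed
  then obtain F where F: "\<And>i. Q F i (F i)" by blast
  have rI: "restr W I = W" using w(1) by blast
  note seg = segment[OF subset_refl SI F, unfolded rI]
  show ?thesis
  proof (rule that)
    show "diagram K I W (No F) (Na F)" using seg by blast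
    show "No F z = N0" "fa F z = f0" using F[of z] z(1) by (simp_all add: Q_def No_def fa_def)
    show "\<And>i. i \<in> I \<Longrightarrow> Pr (No F i)" "\<And>i. i \<in> I \<Longrightarrow> fa F i \<in> hom K (M i) (No F i)"
      "\<And>i j. (i, j) \<in> W \<Longrightarrow> fa F j \<cdot> m i j = Na F i j \<cdot> fa F i" using seg by blast+
    fix i assume i: "i \<in> I" "i \<noteq> z"
    then obtain Y c y where o: "ok F i (No F i) (fst (snd (F i))) (fa F i) Y c y"
      using F[of i] by (auto simp: Q_def No_def fa_def)
    have "Na F j i = y \<cdot> c j" if "j \<in> S i" for j
      using o that unfolding ok_def by (auto simp: Na_def S_def underS_iff)
    then show "\<exists>Y c y. colimit K (underS W i) (restr W (underS W i)) (No F) (Na F) Y c \<and>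
      y \<in> hom K Y (No F i) \<and> (\<forall>j\<in>underS W i. Na F j i = y \<cdot> c j) \<and> C i Y c (No F i) y (fa F i)"
      using o unfolding ok_def S_def by blast
  qed
qed

text \<open>
  With the constant diagram at \<open>N0\<close> in place of \<open>M\<close>, the natural transformation consists of the
  morphisms from the first member of the chain.
\<close>

lemma transfinite_chain:
  fixes W :: "'i rel" and Pr :: "'o \<Rightarrow> bool"
  assumes W: "well_order_on I W" and z: "z \<in> I" "\<And>i. i \<in> I \<Longrightarrow> (z, i) \<in> W" and small: "|I| <o \<Omega>"
    and N0: "N0 \<in> Ob K" "Pr N0"
    and step: "\<And>i N n Y c. i \<in> I \<Longrightarrow> i \<noteq> z \<Longrightarrow> diagram K (underS W i) (restr W (underS W i)) N n \<Longrightarrow>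
      N z = N0 \<Longrightarrow> (\<And>j. j \<in> underS W i \<Longrightarrow> Pr (N j)) \<Longrightarrow>
      colimit K (underS W i) (restr W (underS W i)) N n Y c \<Longrightarrow>
      \<exists>Z y. y \<in> hom K Y Z \<and> Pr Z \<and> C i Y c Z y"
  obtains N n where "diagram K I W N n" "N z = N0" "\<And>i. i \<in> I \<Longrightarrow> Pr (N i)"
    "\<And>i. i \<in> I \<Longrightarrow> i \<noteq> z \<Longrightarrow> \<exists>Y c y. colimit K (underS W i) (restr W (underS W i)) N n Y c \<and>
      y \<in> hom K Y (N i) \<and> (\<forall>j\<in>underS W i. n j i = y \<cdot> c j) \<and> C i Y c (N i) y"
proof -
  note w = well_order_onD[OF W]
  note I = Id_in_hom[OF N0(1)]
  have rI: "restr W I = W" using w(1) by blast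
  have "I \<noteq> {}" using z(1) by blast
  have M: "diagram K I W (\<lambda>_. N0) (\<lambda>_ _. Id K N0)"
    using colimit_of_constant(1)[OF N0(1) directed_restr[OF W subset_refl \<open>I \<noteq> {}\<close>]] unfolding rI .
  have P: "colimit K (underS W i) (restr W (underS W i)) (\<lambda>_. N0) (\<lambda>_ _. Id K N0) N0 (\<lambda>_. Id K N0)"
    if i: "i \<in> I" "i \<noteq> z" for i
  proof (rule colimit_of_constant(2)[OF N0(1) directed_restr[OF W]])
    show "underS W i \<subseteq> I" using w(1) by (auto simp: underS_iff)
    have "z \<in> underS W i" using z(2) i by (auto simp: underS_iff)
    then show "underS W i \<noteq> {}" by blast
  qed
  show ?thesis
  proof (rule natural_chain[OF W z small M P, where q = "\<lambda>_. Id K N0" and ?f0.0 = "Id K N0" and ?N0.0 = N0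
        and Pr = Pr and C = "\<lambda>i Y c Z y f. C i Y c Z y"])
    fix i N n Y c g
    assume *: "i \<in> I" "i \<noteq> z" "diagram K (underS W i) (restr W (underS W i)) N n" "N z = N0"
      "\<And>j. j \<in> underS W i \<Longrightarrow> Pr (N j)" "colimit K (underS W i) (restr W (underS W i)) N n Y c" "g \<in> hom K N0 Y"
    obtain Z y where Z: "y \<in> hom K Y Z" "Pr Z" "C i Y c Z y" using step[OF *(1-6)] by blast
    have "y \<cdot> g \<in> hom K N0 Z" by (rule Comp_in_hom[OF *(7) Z(1)])
    then show "\<exists>Z y f. y \<in> hom K Y Z \<and> f \<in> hom K N0 Z \<and> f \<cdot> Id K N0 = y \<cdot> g \<and> Pr Z \<and> C i Y c Z y"
      using Z Comp_Id by blast
  qed (use I Comp_Id[OF I] N0(2) that in auto)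
qed

end

context large_class begin

lemma amalgam:
  assumes "f \<in> hom K A B" "g \<in> hom K A C"
  obtains D f' g' where "f' \<in> hom K B D" "g' \<in> hom K C D" "f' \<cdot> f = g' \<cdot> g"
  using K_amalgamation hom_Ob[OF assms(1)] hom_Ob(2)[OF assms(2)] assms unfolding amalgamation_def by metis

text \<open>
  The extensions in the family are amalgamated one after another along a chain, and \<open>X\<close> is its first member. The
  chain is indexed by an infinite set, so that the indices after the first suffice for the family.
\<close>

lemma amalgam_of_family:
  assumes X: "X \<in> Ob K" and T: "|T| <o \<Omega>" and g: "\<And>t. t \<in> T \<Longrightarrow> g t \<in> hom K X (B t)"
  obtains Z z k where "z \<in> hom K X Z" "\<And>t. t \<in> T \<Longrightarrow> k t \<in> hom K (B t) Z" "\<And>t. t \<in> T \<Longrightarrow> k t \<cdot> g t = z"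
proof -
  obtain I :: "'v set" where I: "|I| <o \<Omega>" "|T| \<le>o |I|" "infinite I" by (rule small_card_infinite_set[OF T])
  let ?W = "|I|"
  have W: "well_order_on I ?W" by (rule card_of_well_order_on)
  note w = well_order_onD[OF W]
  have "I \<noteq> {}" using I(3) by auto
  then obtain z where z: "z \<in> I" "\<And>i. i \<in> I \<Longrightarrow> (z, i) \<in> ?W"
    using wfE_min'[OF w(6), of I] w(2,5) by (metis DiffI pair_in_Id_conv)
  obtain a where a: "T \<subseteq> a ` (I - {z})" by (rule enumeration_avoiding[OF I(3,2)])
  define C where "C i Y c Z y \<longleftrightarrow> (a i \<in> T \<longrightarrow> (\<exists>k. k \<in> hom K (B (a i)) Z \<and> k \<cdot> g (a i) = y \<cdot> c z))"
    for i and Y :: 'o and c :: "'v \<Rightarrow> 'm" and Z y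
  have step: "\<exists>Z y. y \<in> hom K Y Z \<and> True \<and> C i Y c Z y"
    if i: "i \<in> I" "i \<noteq> z" and Nz: "N z = X"
      and col: "colimit K (underS ?W i) (restr ?W (underS ?W i)) N n Y c" for i N n Y c
  proof -
    note c = coconeD[OF colimit_cocone[OF col]]
    have "z \<in> underS ?W i" using z i by (auto simp: underS_iff)
    then have cz: "c z \<in> hom K X Y" using c(2) Nz by metis
    show ?thesis
    proof (cases "a i \<in> T")
      case True
      obtain D y k where "y \<in> hom K Y D" "k \<in> hom K (B (a i)) D" "y \<cdot> c z = k \<cdot> g (a i)"
        by (rule amalgam[OF cz g[OF True]])
      then show ?thesis unfolding C_def by metis
    next
      case False
      then show ?thesis using Id_in_hom[OF c(1)] unfolding C_def by blast
    qed
  qed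
  obtain N n where N: "diagram K I ?W N n" "N z = X"
    "\<And>i. i \<in> I \<Longrightarrow> i \<noteq> z \<Longrightarrow> \<exists>Y c y. colimit K (underS ?W i) (restr ?W (underS ?W i)) N n Y c \<and>
      y \<in> hom K Y (N i) \<and> (\<forall>j\<in>underS ?W i. n j i = y \<cdot> c j) \<and> C i Y c (N i) y"
  proof (rule transfinite_chain[OF W z I(1) X, where Pr = "\<lambda>_. True" and C = C])
    fix i N n Y c
    assume "i \<in> I" "i \<noteq> z" "N z = X" "colimit K (underS ?W i) (restr ?W (underS ?W i)) N n Y c"
    then show "\<exists>Z y. y \<in> hom K Y Z \<and> True \<and> C i Y c Z y" by (rule step)
  next
    fix N n
    assume *: "diagram K I ?W N n" "N z = X"
      "\<And>i. i \<in> I \<Longrightarrow> i \<noteq> z \<Longrightarrow> \<exists>Y c y. colimit K (underS ?W i) (restr ?W (underS ?W i)) N n Y c \<and>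
        y \<in> hom K Y (N i) \<and> (\<forall>j\<in>underS ?W i. n j i = y \<cdot> c j) \<and> C i Y c (N i) y"
    show thesis by (rule that[OF *])
  qed (assumption | rule TrueI)+
  have rI: "restr ?W I = ?W" using w(1) by blast
  from colimit_exists[OF directed_restr[OF W subset_refl \<open>I \<noteq> {}\<close>, unfolded rI] I(1) N(1)]
  obtain V v where V: "colimit K I ?W N n V v" .
  note v = coconeD[OF colimit_cocone[OF V]]
  have "\<exists>k. k \<in> hom K (B t) V \<and> k \<cdot> g t = v z" if t: "t \<in> T" for t
  proof -
    obtain i where i: "i \<in> I" "i \<noteq> z" "t = a i" using a t by blast
    obtain Y c y where Y: "y \<in> hom K Y (N i)" "\<forall>j\<in>underS ?W i. n j i = y \<cdot> c j" "C i Y c (N i) y"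
      using N(3)[OF i(1,2)] by blast
    have zi: "(z, i) \<in> ?W" using z i by blast
    then have "n z i = y \<cdot> c z" using Y(2) i(2) by (auto simp: underS_iff)
    then obtain k where k: "k \<in> hom K (B t) (N i)" "k \<cdot> g t = n z i" using Y(3) t i(3) by (auto simp: C_def)
    have "(v i \<cdot> k) \<cdot> g t = v z" using Comp_assoc[OF g[OF t] k(1) v(2)[OF i(1)]] k(2) v(3)[OF zi] by simp
    then show ?thesis using Comp_in_hom[OF k(1) v(2)[OF i(1)]] by blast
  qed
  then obtain k where "\<And>t. t \<in> T \<Longrightarrow> k t \<in> hom K (B t) V \<and> k t \<cdot> g t = v z" by metis
  moreover have "v z \<in> hom K X V" using v(2)[OF z(1)] N(2) by simp
  ultimately show ?thesis using that by blast
qed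

end

section \<open>Realising all types\<close>

locale stable_class = large_class \<Omega> \<kappa> lam K U \<mu>
  for \<Omega> \<kappa> lam :: "'v rel" and K :: "('o, 'm) category" (structure)
    and U :: "('o, 'm, 'v) set_functor" and \<mu> :: "'v rel" +
  assumes K_stable: "stable_in \<Omega> K U \<mu>"
begin

lemma has_size_presentable: "has_size \<Omega> K M \<mu> \<Longrightarrow> presentable \<Omega> (cardSuc \<mu>) K M"
  by (simp add: has_size_def presentability_rank_def)

lemma pretype: "g \<in> hom K M N \<Longrightarrow> a \<in> \<bar>N\<bar>\<^sub>U \<Longrightarrow> (g, a) \<in> pretypes K U M"
  by (simp add: pretypes_def hom_def)

lemma type_rel_refl:
  assumes "g \<in> hom K M N" "a \<in> \<bar>N\<bar>\<^sub>U"
  shows "((g, a), (g, a)) \<in> type_rel K U M"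
  using pretype[OF assms] Id_in_hom[OF hom_Ob(2)[OF assms(1)]] homD[OF assms(1)] unfolding type_rel_def by auto

text \<open>
  Distinct elements of an object of size \<open>\<mu>\<close> have distinct types over it, so stability bounds the
  number of elements; smaller objects have extensions of size \<open>\<mu>\<close>.
\<close>

lemma few_elements:
  assumes "presentable \<Omega> (cardSuc \<mu>) K N"
  shows "|\<bar>N\<bar>\<^sub>U| \<le>o \<mu>"
proof -
  obtain E e where e: "e \<in> hom K N E" "has_size \<Omega> K E \<mu>" by (rule exact_extension[OF assms])
  have EOb: "E \<in> Ob K" using hom_Ob(2)[OF e(1)] .
  note I = Id_in_hom[OF EOb]
  let ?t = "\<lambda>a. type_rel K U E `` {(Id K E, a)}"
  have "inj_on ?t \<bar>E\<bar>\<^sub>U"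
  proof (rule inj_onI)
    fix a b assume ab: "a \<in> \<bar>E\<bar>\<^sub>U" "b \<in> \<bar>E\<bar>\<^sub>U" "?t a = ?t b"
    have "(Id K E, b) \<in> ?t a" unfolding ab(3) using type_rel_refl[OF I ab(2)] by simp
    then have "((Id K E, a), (Id K E, b)) \<in> type_rel K U E" by simp
    then obtain N h0 h1 where h: "h0 \<in> hom K E N" "h1 \<in> hom K E N" "h0 \<cdot> Id K E = h1 \<cdot> Id K E"
      "fn h0 a = fn h1 b"
      using homD(3)[OF I] unfolding type_rel_def by auto
    then have "h0 = h1" using Comp_Id[OF h(1)] Comp_Id[OF h(2)] by simp
    then show "a = b" using U_inj[OF h(2) ab(1,2)] h(4) by simp
  qed
  moreover have "?t ` \<bar>E\<bar>\<^sub>U \<subseteq> types K U E"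
    unfolding types_def using pretype[OF I] by (auto intro: quotientI)
  ultimately have "|\<bar>E\<bar>\<^sub>U| \<le>o |types K U E|" by (rule card_of_ordLeqI[OF _ subsetD[OF _ imageI]])
  also have "|types K U E| \<le>o \<mu>" using K_stable EOb e(2) by (simp add: stable_in_def)
  finally have "|\<bar>E\<bar>\<^sub>U| \<le>o \<mu>" .
  moreover have "|\<bar>N\<bar>\<^sub>U| \<le>o |\<bar>E\<bar>\<^sub>U|"
    by (rule card_of_ordLeqI[of "fn e"]) (use U_in[OF e(1)] U_inj[OF e(1)] in \<open>auto intro: inj_onI\<close>)
  ultimately show ?thesis by (rule ordLeq_transitive[rotated])
qed

text \<open>
  Types are realised in the sense of amalgams instead of equivalence classes, which makes sense over
  every object and is what the construction of chains uses.
\<close>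

definition realizes_types :: "'o \<Rightarrow> 'o \<Rightarrow> 'm \<Rightarrow> bool" where
  "realizes_types P Q q \<longleftrightarrow> q \<in> hom K P Q \<and> (\<forall>Y g a. g \<in> hom K P Y \<and> a \<in> \<bar>Y\<bar>\<^sub>U \<longrightarrow>
     (\<exists>Z f y. f \<in> hom K Q Z \<and> y \<in> hom K Y Z \<and> f \<cdot> q = y \<cdot> g \<and> fn y a \<in> fn f ` \<bar>Q\<bar>\<^sub>U))"

text \<open>
  \<open>P\<close> is first replaced by an extension \<open>E\<close> of size \<open>\<mu>\<close>, to which stability applies. Representatives of the types
  over \<open>E\<close> are amalgamated into one object \<open>Z\<close>, and \<open>Q\<close> is a \<open>\<mu>\<^sup>+\<close>-presentable subobject of \<open>Z\<close> that contains
  the at most \<open>\<mu>\<close> elements representing the types.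
\<close>

lemma all_types_realized:
  assumes P: "presentable \<Omega> (cardSuc \<mu>) K P"
  obtains Q q where "presentable \<Omega> (cardSuc \<mu>) K Q" "realizes_types P Q q"
proof -
  obtain E x where x: "x \<in> hom K P E" and E: "has_size \<Omega> K E \<mu>" by (rule exact_extension[OF P])
  have EOb: "E \<in> Ob K" using hom_Ob(2)[OF x] .
  let ?T = "types K U E" and ?R = "type_rel K U E"
  have T\<mu>: "|?T| \<le>o \<mu>" using K_stable EOb E by (simp add: stable_in_def)
  define rep where "rep t = (SOME r. r \<in> t)" for t :: "('m \<times> 'v) set"
  have rep: "(p, rep (?R `` {p})) \<in> ?R" if p: "p \<in> pretypes K U E" for p
  proof -
    obtain g a where ga: "p = (g, a)" by (cases p)
    then have g: "g \<in> hom K E (Cod K g)" "a \<in> \<bar>Cod K g\<bar>\<^sub>U" using p by (auto simp: pretypes_def hom_def)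
    have "p \<in> ?R `` {p}" using type_rel_refl[OF g] ga by simp
    then have "rep (?R `` {p}) \<in> ?R `` {p}" unfolding rep_def by (rule someI)
    then show ?thesis by simp
  qed
  define F where "F t = fst (rep t)" for t
  have F: "F t \<in> hom K E (Cod K (F t))" "snd (rep t) \<in> \<bar>Cod K (F t)\<bar>\<^sub>U" if t: "t \<in> ?T" for t
  proof -
    obtain p where p: "p \<in> pretypes K U E" "t = ?R `` {p}" using t unfolding types_def by (rule quotientE)
    then have "rep t \<in> pretypes K U E" using rep[OF p(1)] by (auto simp: type_rel_def)
    then show "F t \<in> hom K E (Cod K (F t))" "snd (rep t) \<in> \<bar>Cod K (F t)\<bar>\<^sub>U"
      by (auto simp: F_def pretypes_def hom_def)
  qed
  have sT: "|?T| <o \<Omega>" by (rule ordLeq_ordLess_trans[OF T\<mu> \<mu>_small])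
  obtain Z z k where Z: "z \<in> hom K E Z" "\<And>t. t \<in> ?T \<Longrightarrow> k t \<in> hom K (Cod K (F t)) Z"
    "\<And>t. t \<in> ?T \<Longrightarrow> k t \<cdot> F t = z"
    by (rule amalgam_of_family[OF EOb sT F(1)]) auto
  define B where "B = (\<lambda>t. fn (k t) (snd (rep t))) ` ?T"
  have B: "B \<subseteq> \<bar>Z\<bar>\<^sub>U" unfolding B_def using U_in[OF Z(2) F(2)] by blast
  have "|B| \<le>o \<mu>" unfolding B_def by (rule ordLeq_transitive[OF card_of_image T\<mu>])
  then have few: "|B| <o cardSuc \<mu>" by (simp add: card_ordLess_cardSuc_iff[OF \<mu>_card])
  obtain Q y g where Q: "presentable \<Omega> (cardSuc \<mu>) K Q" "y \<in> hom K Q Z" "g \<in> hom K E Q" "y \<cdot> g = z"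
    "B \<subseteq> fn y ` \<bar>Q\<bar>\<^sub>U"
    by (rule loewenheim_skolem[OF has_size_presentable[OF E] Z(1) B few])
  have gx: "g \<cdot> x \<in> hom K P Q" by (rule Comp_in_hom[OF x Q(3)])
  have "\<exists>Z' f w. f \<in> hom K Q Z' \<and> w \<in> hom K Y Z' \<and> f \<cdot> (g \<cdot> x) = w \<cdot> h \<and> fn w a \<in> fn f ` \<bar>Q\<bar>\<^sub>U"
    if h: "h \<in> hom K P Y" and a: "a \<in> \<bar>Y\<bar>\<^sub>U" for Y h a
  proof -
    obtain V e w where V: "e \<in> hom K E V" "w \<in> hom K Y V" "e \<cdot> x = w \<cdot> h" by (rule amalgam[OF x h])
    have wa: "fn w a \<in> \<bar>V\<bar>\<^sub>U" by (rule U_in[OF V(2) a])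
    let ?p = "(e, fn w a)"
    let ?t = "?R `` {?p}"
    have p: "?p \<in> pretypes K U E" by (rule pretype[OF V(1) wa])
    have t: "?t \<in> ?T" unfolding types_def by (rule quotientI[OF p])
    have "(?p, F ?t, snd (rep ?t)) \<in> ?R" using rep[OF p] by (simp add: F_def)
    then obtain N h0 h1 where N: "h0 \<in> hom K V N" "h1 \<in> hom K (Cod K (F ?t)) N" "h0 \<cdot> e = h1 \<cdot> F ?t"
      "fn h0 (fn w a) = fn h1 (snd (rep ?t))"
      using homD(3)[OF V(1)] unfolding type_rel_def by auto
    obtain Z2 v u where Z2: "v \<in> hom K N Z2" "u \<in> hom K Z Z2" "v \<cdot> h1 = u \<cdot> k ?t"
      by (rule amalgam[OF N(2) Z(2)[OF t]])
    have uy: "u \<cdot> y \<in> hom K Q Z2" by (rule Comp_in_hom[OF Q(2) Z2(2)])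
    have vh: "v \<cdot> h0 \<in> hom K V Z2" by (rule Comp_in_hom[OF N(1) Z2(1)])
    have w': "(v \<cdot> h0) \<cdot> w \<in> hom K Y Z2" by (rule Comp_in_hom[OF V(2) vh])
    have "(u \<cdot> y) \<cdot> g = u \<cdot> z" unfolding Comp_assoc[OF Q(3,2) Z2(2)] Q(4) ..
    also have "\<dots> = (u \<cdot> k ?t) \<cdot> F ?t"
      unfolding Comp_assoc[OF F(1)[OF t] Z(2)[OF t] Z2(2)] Z(3)[OF t] ..
    also have "\<dots> = v \<cdot> (h1 \<cdot> F ?t)" unfolding Z2(3)[symmetric] by (rule Comp_assoc[OF F(1)[OF t] N(2) Z2(1)])
    also have "\<dots> = (v \<cdot> h0) \<cdot> e" unfolding N(3)[symmetric] by (rule Comp_assoc[OF V(1) N(1) Z2(1), symmetric])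
    finally have ge: "(u \<cdot> y) \<cdot> g = (v \<cdot> h0) \<cdot> e" .
    have "(u \<cdot> y) \<cdot> (g \<cdot> x) = ((v \<cdot> h0) \<cdot> e) \<cdot> x"
      unfolding ge[symmetric] by (rule Comp_assoc[OF x Q(3) uy, symmetric])
    also have "\<dots> = (v \<cdot> h0) \<cdot> (w \<cdot> h)" unfolding V(3)[symmetric] by (rule Comp_assoc[OF x V(1) vh])
    also have "\<dots> = ((v \<cdot> h0) \<cdot> w) \<cdot> h" by (rule Comp_assoc[OF h V(2) vh, symmetric])
    finally have square: "(u \<cdot> y) \<cdot> (g \<cdot> x) = ((v \<cdot> h0) \<cdot> w) \<cdot> h" .
    have "fn ((v \<cdot> h0) \<cdot> w) a = fn v (fn h1 (snd (rep ?t)))"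
      using U_comp[OF V(2) vh a] U_comp[OF N(1) Z2(1) wa] N(4) by simp
    also have "\<dots> = fn u (fn (k ?t) (snd (rep ?t)))"
      using U_comp[OF N(2) Z2(1) F(2)[OF t]] U_comp[OF Z(2)[OF t] Z2(2) F(2)[OF t]] Z2(3) by simp
    finally have val: "fn ((v \<cdot> h0) \<cdot> w) a = fn u (fn (k ?t) (snd (rep ?t)))" .
    have "fn (k ?t) (snd (rep ?t)) \<in> B" unfolding B_def using t by blast
    then obtain b where b: "b \<in> \<bar>Q\<bar>\<^sub>U" "fn (k ?t) (snd (rep ?t)) = fn y b" using Q(5) by blast
    have "fn ((v \<cdot> h0) \<cdot> w) a = fn (u \<cdot> y) b" using val b U_comp[OF Q(2) Z2(2) b(1)] by simp
    then show ?thesis using uy w' square b(1) by blast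
  qed
  then have "realizes_types P Q (g \<cdot> x)" unfolding realizes_types_def using gx by simp
  then show ?thesis using that Q(1) by blast
qed

section \<open>Universal extensions\<close>

text \<open>
  The chain \<open>A\<close> starts with \<open>M\<close> and realises all types at each later step. Its colimit \<open>B\<close> already receives
  every \<open>N\<close>; the final extension \<open>M'\<close> of \<open>B\<close> only serves to make the size exactly \<open>\<mu>\<close>.
\<close>

theorem universal_extension:
  assumes M: "M \<in> Ob K" "has_size \<Omega> K M \<mu>"
  shows "\<exists>M'\<in>Ob K. \<exists>m\<in>hom K M M'. has_size \<Omega> K M' \<mu> \<and> universal_over \<Omega> K \<mu> M M' m"
proof -
  let ?I = "Field \<mu>"
  have W: "well_order_on ?I \<mu>" using \<mu>_card by (simp add: card_order_on_well_order_on)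
  note w = well_order_onD[OF W]
  have inf: "infinite ?I" using \<mu>_infinite by (simp add: cinfinite_def)
  then have "?I \<noteq> {}" by auto
  then obtain z where z: "z \<in> ?I" "\<And>i. i \<in> ?I \<Longrightarrow> (z, i) \<in> \<mu>"
    using wfE_min'[OF w(6), of ?I] w(2,5) by (metis DiffI pair_in_Id_conv)
  have rI: "restr \<mu> ?I = \<mu>" using w(1) by blast
  have dirI: "directed_on natLeq ?I \<mu>" using directed_restr[OF W subset_refl \<open>?I \<noteq> {}\<close>] unfolding rI .
  have fewI: "|?I| <o cardSuc \<mu>"
    by (rule ordIso_ordLess_trans[OF Field_\<mu> cardSuc_greater[OF \<mu>_card]])
  have few_below: "|underS \<mu> i| <o cardSuc \<mu>" for i
    by (rule card_ordLess_subset[OF fewI]) (auto simp: underS_def Field_def)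
  let ?Pr = "presentable \<Omega> (cardSuc \<mu>) K"
  have stepM: "\<exists>Z y. y \<in> hom K Y Z \<and> ?Pr Z \<and> realizes_types Y Z y"
    if dia: "diagram K (underS \<mu> i) (restr \<mu> (underS \<mu> i)) N n"
      and pr: "\<And>j. j \<in> underS \<mu> i \<Longrightarrow> ?Pr (N j)"
      and col: "colimit K (underS \<mu> i) (restr \<mu> (underS \<mu> i)) N n Y c" for i N n Y c
  proof -
    have "?Pr Y" by (rule colimit_of_presentables[OF \<nu>_infinite few_below _ dia col pr]) auto
    then obtain Q q where "?Pr Q" "realizes_types Y Q q" by (rule all_types_realized)
    then show ?thesis unfolding realizes_types_def by blast
  qed
  obtain A m where A: "diagram K ?I \<mu> A m" "A z = M" "\<And>i. i \<in> ?I \<Longrightarrow> ?Pr (A i)"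
    "\<And>i. i \<in> ?I \<Longrightarrow> i \<noteq> z \<Longrightarrow> \<exists>Y c y. colimit K (underS \<mu> i) (restr \<mu> (underS \<mu> i)) A m Y c \<and>
      y \<in> hom K Y (A i) \<and> (\<forall>j\<in>underS \<mu> i. m j i = y \<cdot> c j) \<and> realizes_types Y (A i) y"
  proof (rule transfinite_chain[where Pr = ?Pr and C = "\<lambda>i Y c Z y. realizes_types Y Z y",
        OF W z small_Field_\<mu> M(1) has_size_presentable[OF M(2)]])
    fix i N n Y c
    assume "diagram K (underS \<mu> i) (restr \<mu> (underS \<mu> i)) N n" "\<And>j. j \<in> underS \<mu> i \<Longrightarrow> ?Pr (N j)"
      "colimit K (underS \<mu> i) (restr \<mu> (underS \<mu> i)) N n Y c"
    then show "\<exists>Z y. y \<in> hom K Y Z \<and> ?Pr Z \<and> realizes_types Y Z y" by (rule stepM)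
  next
    fix N n
    assume *: "diagram K ?I \<mu> N n" "N z = M" "\<And>i. i \<in> ?I \<Longrightarrow> ?Pr (N i)"
      "\<And>i. i \<in> ?I \<Longrightarrow> i \<noteq> z \<Longrightarrow> \<exists>Y c y. colimit K (underS \<mu> i) (restr \<mu> (underS \<mu> i)) N n Y c \<and>
      y \<in> hom K Y (N i) \<and> (\<forall>j\<in>underS \<mu> i. n j i = y \<cdot> c j) \<and> realizes_types Y (N i) y"
    show thesis by (rule that[OF *])
  qed assumption+
  have "\<forall>i. \<exists>Y c y. i \<in> ?I \<and> i \<noteq> z \<longrightarrow> colimit K (underS \<mu> i) (restr \<mu> (underS \<mu> i)) A m Y c \<and>
      (\<forall>j\<in>underS \<mu> i. m j i = y \<cdot> c j) \<and> realizes_types Y (A i) y"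
    using A(4) by meson
  then obtain P p q where P: "\<And>i. i \<in> ?I \<Longrightarrow> i \<noteq> z \<Longrightarrow> colimit K (underS \<mu> i) (restr \<mu> (underS \<mu> i)) A m (P i) (p i)"
    and q: "\<And>i j. i \<in> ?I \<Longrightarrow> i \<noteq> z \<Longrightarrow> j \<in> underS \<mu> i \<Longrightarrow> m j i = q i \<cdot> p i j"
      "\<And>i. i \<in> ?I \<Longrightarrow> i \<noteq> z \<Longrightarrow> realizes_types (P i) (A i) (q i)"
    by metis
  obtain B b where B: "colimit K ?I \<mu> A m B b" by (rule colimit_exists[OF dirI small_Field_\<mu> A(1)])
  note b = coconeD[OF colimit_cocone[OF B]]
  have PB: "?Pr B" by (rule colimit_of_presentables[OF \<nu>_infinite fewI w(1) A(1) B A(3)])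
  obtain M' e where e: "e \<in> hom K B M'" "has_size \<Omega> K M' \<mu>" by (rule exact_extension[OF PB])
  have bz: "b z \<in> hom K M B" using b(2)[OF z(1)] A(2) by simp
  have ebz: "e \<cdot> b z \<in> hom K M M'" by (rule Comp_in_hom[OF bz e(1)])
  have univ: "\<exists>t\<in>hom K N M'. t \<cdot> h = e \<cdot> b z"
    if size: "has_size_at_most \<Omega> K N \<mu>" and h: "h \<in> hom K M N" for N h
  proof -
    have "?Pr N" using size presentable_mono unfolding has_size_at_most_def presentability_rank_def by blast
    then have "|\<bar>N\<bar>\<^sub>U| \<le>o \<mu>" by (rule few_elements)
    then have "|\<bar>N\<bar>\<^sub>U| \<le>o |?I|" by (rule ordLeq_ordIso_trans[OF _ ordIso_symmetric[OF Field_\<mu>]])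
    then obtain a where a: "\<bar>N\<bar>\<^sub>U \<subseteq> a ` (?I - {z})" by (rule enumeration_avoiding[OF inf])
    \<comment> \<open>At \<open>i\<close> the element \<open>a i\<close> of \<open>N\<close> enters the image of \<open>A i\<close>.\<close>
    define C where "C i Y c Z y f \<longleftrightarrow> (a i \<in> \<bar>N\<bar>\<^sub>U \<longrightarrow> fn (y \<cdot> c z) (a i) \<in> fn f ` \<bar>A i\<bar>\<^sub>U)"
      for i and Y :: 'o and c :: "'v \<Rightarrow> 'm" and Z :: 'o and y f
    have stepN: "\<exists>Z y f. y \<in> hom K Y Z \<and> f \<in> hom K (A i) Z \<and> f \<cdot> q i = y \<cdot> g \<and> True \<and> C i Y c Z y f"
      if i: "i \<in> ?I" "i \<noteq> z" and Nz: "D z = N"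
        and col: "colimit K (underS \<mu> i) (restr \<mu> (underS \<mu> i)) D d Y c" and g: "g \<in> hom K (P i) Y" for i D d Y c g
    proof -
      have "z \<in> underS \<mu> i" using z i by (auto simp: underS_iff)
      then have cz: "c z \<in> hom K N Y" using coconeD(2)[OF colimit_cocone[OF col]] Nz by metis
      have qi: "q i \<in> hom K (P i) (A i)" using q(2)[OF i] by (simp add: realizes_types_def)
      show ?thesis
      proof (cases "a i \<in> \<bar>N\<bar>\<^sub>U")
        case True
        have ca: "fn (c z) (a i) \<in> \<bar>Y\<bar>\<^sub>U" by (rule U_in[OF cz True])
        obtain Z f y where Z: "f \<in> hom K (A i) Z" "y \<in> hom K Y Z" "f \<cdot> q i = y \<cdot> g"
          "fn y (fn (c z) (a i)) \<in> fn f ` \<bar>A i\<bar>\<^sub>U"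
          using q(2)[OF i] g ca unfolding realizes_types_def by blast
        then have "C i Y c Z y f" unfolding C_def using U_comp[OF cz Z(2) True] by simp
        then show ?thesis using Z by blast
      next
        case False
        obtain Z f y where "f \<in> hom K (A i) Z" "y \<in> hom K Y Z" "f \<cdot> q i = y \<cdot> g" by (rule amalgam[OF qi g])
        then show ?thesis unfolding C_def using False by blast
      qed
    qed
    have hz: "h \<in> hom K (A z) N" using h A(2) by simp
    obtain D d f where D: "diagram K ?I \<mu> D d" "D z = N" "f z = h"
      "\<And>i. i \<in> ?I \<Longrightarrow> f i \<in> hom K (A i) (D i)" "\<And>i j. (i, j) \<in> \<mu> \<Longrightarrow> f j \<cdot> m i j = d i j \<cdot> f i"
      "\<And>i. i \<in> ?I \<Longrightarrow> i \<noteq> z \<Longrightarrow> \<exists>Y c y. (\<forall>j\<in>underS \<mu> i. d j i = y \<cdot> c j) \<and> C i Y c (D i) y (f i)"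
    proof (rule natural_chain[where q = q and Pr = "\<lambda>_. True" and C = C, OF W z small_Field_\<mu> A(1) P _ _ hz])
      fix i D d Y c g
      assume "i \<in> ?I" "i \<noteq> z" "D z = N" "colimit K (underS \<mu> i) (restr \<mu> (underS \<mu> i)) D d Y c" "g \<in> hom K (P i) Y"
      then show "\<exists>Z y f. y \<in> hom K Y Z \<and> f \<in> hom K (A i) Z \<and> f \<cdot> q i = y \<cdot> g \<and> True \<and> C i Y c Z y f"
        by (rule stepN)
    next
      fix i j assume "i \<in> ?I" "i \<noteq> z" "j \<in> underS \<mu> i"
      then show "q i \<cdot> p i j = m j i" using q(1) by simp
    next
      fix D d f
      assume *: "diagram K ?I \<mu> D d" "D z = N" "f z = h"
        "\<And>i. i \<in> ?I \<Longrightarrow> f i \<in> hom K (A i) (D i)" "\<And>i j. (i, j) \<in> \<mu> \<Longrightarrow> f j \<cdot> m i j = d i j \<cdot> f i"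
        "\<And>i. i \<in> ?I \<Longrightarrow> i \<noteq> z \<Longrightarrow> \<exists>Y c y. colimit K (underS \<mu> i) (restr \<mu> (underS \<mu> i)) D d Y c \<and>
          y \<in> hom K Y (D i) \<and> (\<forall>j\<in>underS \<mu> i. d j i = y \<cdot> c j) \<and> C i Y c (D i) y (f i)"
      have "\<exists>Y c y. (\<forall>j\<in>underS \<mu> i. d j i = y \<cdot> c j) \<and> C i Y c (D i) y (f i)" if "i \<in> ?I" "i \<noteq> z" for i
        using *(6)[OF that] by meson
      from that[OF *(1-5) this] show thesis .
    qed (use q(2) in \<open>simp_all add: realizes_types_def\<close>)
    obtain V v where V: "colimit K ?I \<mu> D d V v" by (rule colimit_exists[OF dirI small_Field_\<mu> D(1)])
    note v = coconeD[OF colimit_cocone[OF V]]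
    have "cocone K ?I \<mu> A m V (\<lambda>i. v i \<cdot> f i)"
    proof (rule coconeI)
      show "V \<in> Ob K" by (rule v(1))
      show "\<And>i. i \<in> ?I \<Longrightarrow> v i \<cdot> f i \<in> hom K (A i) V" using Comp_in_hom[OF D(4) v(2)] .
      fix i j assume ij: "(i, j) \<in> \<mu>"
      then have mem: "i \<in> ?I" "j \<in> ?I" using w(1) by auto
      show "(v j \<cdot> f j) \<cdot> m i j = v i \<cdot> f i"
        using Comp_assoc[OF diagramD(2)[OF A(1) ij] D(4)[OF mem(2)] v(2)[OF mem(2)]] D(5)[OF ij]
          Comp_assoc[OF D(4)[OF mem(1)] diagramD(2)[OF D(1) ij] v(2)[OF mem(2)]] v(3)[OF ij] by simp
    qed
    from colimit_ex[OF B this] obtain F where F: "F \<in> hom K B V" "\<And>i. i \<in> ?I \<Longrightarrow> F \<cdot> b i = v i \<cdot> f i"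
      by metis
    have vz: "v z \<in> hom K N V" using v(2)[OF z(1)] D(2) by simp
    have caught: "fn (v z) x \<in> fn F ` \<bar>B\<bar>\<^sub>U" if x: "x \<in> \<bar>N\<bar>\<^sub>U" for x
    proof -
      obtain i where i: "i \<in> ?I" "i \<noteq> z" "x = a i" using a x by blast
      obtain Y c y where Y: "\<forall>j\<in>underS \<mu> i. d j i = y \<cdot> c j" "C i Y c (D i) y (f i)" using D(6)[OF i(1,2)] by blast
      have zi: "(z, i) \<in> \<mu>" using z(2) i(1) by blast
      then have "d z i = y \<cdot> c z" using Y(1) i(2) by (auto simp: underS_iff)
      then have "fn (d z i) x \<in> fn (f i) ` \<bar>A i\<bar>\<^sub>U" using Y(2) x i(3) by (simp add: C_def)
      then obtain r where r: "r \<in> \<bar>A i\<bar>\<^sub>U" "fn (d z i) x = fn (f i) r" by blast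
      have dz: "d z i \<in> hom K N (D i)" using diagramD(2)[OF D(1) zi] D(2) by simp
      have "fn (v z) x = fn (v i \<cdot> d z i) x" using v(3)[OF zi] by simp
      also have "\<dots> = fn (v i \<cdot> f i) r"
        using U_comp[OF dz v(2)[OF i(1)] x] U_comp[OF D(4)[OF i(1)] v(2)[OF i(1)] r(1)] r(2) by simp
      also have "\<dots> = fn F (fn (b i) r)" using F(2)[OF i(1)] U_comp[OF b(2)[OF i(1)] F(1) r(1)] by simp
      finally show ?thesis using U_in[OF b(2)[OF i(1)] r(1)] by blast
    qed
    obtain t where t: "t \<in> hom K N B" "F \<cdot> t = v z" by (rule coherent_factor[OF vz F(1) caught])
    have th: "t \<cdot> h \<in> hom K M B" by (rule Comp_in_hom[OF h t(1)])
    have "F \<cdot> (t \<cdot> h) = F \<cdot> b z"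
      using Comp_assoc[OF h t(1) F(1)] t(2) F(2)[OF z(1)] D(3) by simp
    then have "t \<cdot> h = b z" by (rule mono_cancel[OF F(1) th bz])
    then have "(e \<cdot> t) \<cdot> h = e \<cdot> b z" using Comp_assoc[OF h t(1) e(1)] by simp
    then show ?thesis using Comp_in_hom[OF t(1) e(1)] by blast
  qed
  have "universal_over \<Omega> K \<mu> M M' (e \<cdot> b z)"
    unfolding universal_over_def using ebz M(2) e(2) univ by blast
  then show ?thesis using hom_Ob(2)[OF e(1)] ebz e(2) by blast
qed

end

theorem corollary3p6:
  fixes \<Omega> \<kappa> lam lamU \<mu> :: "'v rel"
    and K :: "('o, 'm) category"
    and U :: "('o, 'm, 'v) set_functor"
  assumes "inaccessible \<Omega>"
    and "proper_class_of_weak_power_fixpoints \<Omega>"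
    and "weak_CAEC \<Omega> \<kappa> lam K U"
    and "large \<Omega> K"
    and "amalgamation K"
    and "joint_embedding K"
    and "is_lambda_U \<Omega> lam K U lamU"
    and "small_card \<Omega> \<mu>"
    and "sharply_less \<kappa> (cardSuc \<mu>)"
    and "lam +c lamU \<le>o \<mu>"
    and "stable_in \<Omega> K U \<mu>"
  shows "\<forall>M \<in> Ob K. has_size \<Omega> K M \<mu> \<longrightarrow>
    (\<exists>M' \<in> Ob K. \<exists>m \<in> hom K M M'. has_size \<Omega> K M' \<mu> \<and> universal_over \<Omega> K \<mu> M M' m)"
proof -
  have \<mu>: "Card_order \<mu>" "\<mu> <o \<Omega>" using assms(8) by (auto simp: small_card_def)
  have CA: "cat_functor K (set_cat \<Omega>) U" "faithful K U" "accessible \<Omega> lam K"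
    "has_directed_colimits \<Omega> natLeq K" "\<forall>f \<in> Arr K. mono_arr K f" "coherent \<Omega> K U" "concrete_monos K U"
    "preserves_directed_colimits \<Omega> \<kappa> K (set_cat \<Omega>) U" "Card_order \<kappa>" "Card_order lam"
    using assms(3) by (simp_all add: weak_CAEC_def small_card_def)
  have lam: "lam \<le>o \<mu>" by (rule ordLeq_transitive[OF ordLeq_csum1[OF CA(10)] assms(10)])
  have \<kappa>: "\<kappa> \<le>o \<mu>"
    using assms(9) ordLess_cardSuc_iff[OF \<mu>(1) CA(9)] by (simp add: sharply_less_def)
  have cat: "category K" "locally_small \<Omega> K" using CA(3) by (simp_all add: accessible_def)
  interpret category K by (rule cat(1))
  interpret stable_class \<Omega> \<kappa> lam K U \<mu>
    by (intro stable_class.intro large_class.intro concrete_category.intro mono_category.intro universe.intro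
        stable_class_axioms.intro large_class_axioms.intro concrete_category_axioms.intro
        mono_category_axioms.intro)
      (use assms(1,4,5,6,11) CA(1-8) cat \<mu> lam \<kappa> in simp_all)
  show ?thesis using universal_extension by blast
qed

end
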